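(* Let $\mathcal A=kQ/I$ be a string algebra over an algebraically closed field $k$ and let $(b,m)$ be a band with $\mathcal F(b,m)\subseteq\operatorname{mod}(\mathcal A,d)$. If the closure of $\mathcal F(b,m)$ is an irreducible component of $\operatorname{mod}(\mathcal A,d)$, then $[(b,m)]$ is not negligible.
   Context: String algebras. $k$ is an algebraically closed field. $Q=(Q_0,Q_1,s,t)$ is a quiver with finite sets $Q_0$ of vertices and $Q_1$ of arrows, and source/target maps $s,t:Q_1\to Q_0$. A path is either $1_u$ ($u\in Q_0$) or a finite sequence of arrows $\alpha_1\cdots\alpha_n$ with $s(\alpha_i)=t(\alpha_{i+1})$. The path algebra $kQ$ has the paths as basis, and the product of paths $p,q$ is the concatenation $pq$ if $s(p)=t(q)$ and $0$ otherwise. $\mathcal A=kQ/I$ is a string algebra if: $I$ is an admissible ideal ($(kQ^+)^n\subseteq I\subseteq (kQ^+)^2$ for some $n$, where $kQ^+$ is the ideal generated by the arrows); $I$ is generated by a set of paths; at every vertex at most two arrows start and at most two arrows end; for each arrow $\alpha$ there is at most one arrow $\beta$ with $s(\alpha)=t(\beta)$ and $\alpha\beta\notin I$; for each arrow $\beta$ there is at most one arrow $\alpha$ with $s(\alpha)=t(\beta)$ and $\alpha\beta\notin I$. Strings. Let $Q_1^{-1}=\{\alpha^{-1}:\alpha\in Q_1\}$ be formal inverses, $s(\alpha^{-1})=t(\alpha)$, $t(\alpha^{-1})=s(\alpha)$, $(\alpha^{-1})^{-1}=\alpha$. A string is either a trivial string $1_u$ ($u\in Q_0$) or a word $\alpha_1\cdots\alpha_n$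 in letters of $Q_1\cup Q_1^{-1}$ with $s(\alpha_i)=t(\alpha_{i+1})$ and $\alpha_i\ne\alpha_{i+1}^{-1}$, such that no subword $\alpha_i\cdots\alpha_j$ and no inverse $\alpha_j^{-1}\cdots\alpha_i^{-1}$ of a subword belongs to $I$. For $c=\alpha_1\cdots\alpha_n$: $t(c)=t(\alpha_1)$, $s(c)=s(\alpha_n)$, length $l(c)=n$, $c^{-1}=\alpha_n^{-1}\cdots\alpha_1^{-1}$; for $c=1_u$: $s(c)=t(c)=u$, $l(c)=0$, $c^{-1}=c$. Trivial strings act as identities for concatenation. A string $\alpha_1\cdots\alpha_n$ starts with an (inverse) arrow if $\alpha_n\in Q_1$ (resp. $\in Q_1^{-1}$), and ends with an (inverse) arrow if $\alpha_1\in Q_1$ (resp. $\in Q_1^{-1}$). Quasi-bands and bands. A quasi-band $(b,m)$ is a map $b:\mathbb Z\to Q_1\cup Q_1^{-1}$ with an integer $m\ge1$ such that $b(i)=b(i+m)$ for all $i$ and $b(i)b(i+1)\cdots b(i+n)$ is a string for all $i\in\mathbb Z$, $n\ge0$. One writes $(b,m)=b(1)\cdots b(m)$; an equality $(b,sm)=x$ with $x$ a word means $b(1)\cdots b(sm)=x$. A word of length $n$ is called a quasi-band if its $n$-periodic extension $c:\mathbb Z\to Q_1\cup Q_1^{-1}$ (with $c(1)\cdots c(n)$ the word) gives a quasi-band $(c,n)$. A quasi-band $(b,m)$ is a band if $(b,m')$ is not a quasi-band for $0<m'<m$. $(b,m)\sim(b',m')$ means $m=m'$ and there is $i\in\mathbb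 Z$ with either $b(j)=b'(i+j)$ for all $j$, or $b(j)=b'(i-j)^{-1}$ for all $j$; $[(b,m)]$ is the equivalence class. Band modules. For a quasi-band $(b,m)$, $M(b)$ is the $\mathcal A$-module with basis $\{e_i:i\in\mathbb Z\}$ where $1_ue_i=e_i$ if $u=s(b(i))$ and $0$ otherwise, and an arrow $\alpha$ acts by $\alpha e_{i-1}=e_i$ if $b(i)=\alpha^{-1}$, $\alpha e_i=e_{i-1}$ if $b(i)=\alpha$, and by $0$ on basis vectors not covered by these rules. For $\lambda\in k^*$, $M(b,m,\lambda)=M(b)/\operatorname{span}\{e_i-\lambda e_{i+m}:i\in\mathbb Z\}$, an $m$-dimensional module. Families. $\operatorname{mod}(\mathcal A,d)$ is the affine variety of $k$-algebra homomorphisms $\mathcal A\to M_d(k)$; its points are $d$-dimensional left $\mathcal A$-modules. For a quasi-band $(b,m)$ and $d=m$, $\mathcal F(b,m)\subseteq\operatorname{mod}(\mathcal A,d)$ is the set of points isomorphic to $M(b,m,\lambda)$ for some $\lambda\in k^*$. Negligible bands. A band $(b,m)$ is negligible if one of the following holds: (1) there are strings $u,v,w,x,y$, arrows $\alpha,\beta,\gamma,\delta$ and $s\ge1$ with $(b,m)=u\gamma v\alpha^{-1}$ and $(b,sm)=w\beta x\alpha^{-1}=u\gamma w\delta^{-1}y$ such that $u\gamma$ and $v\alpha^{-1}$ are quasi-bands; (2) there are a string $u$ that starts and ends with an arrow, a string $v$ that starts and ends with an inverse arrow and a string $w$ with $(b,m)=wuw^{-1}v$ such that $wu^{-1}w^{-1}v$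 is a quasi-band. An equivalence class of bands is negligible if it contains a negligible band. *)

theory Defs
  imports
    "Graph_Theory.Digraph"
    "HOL-Analysis.Abstract_Topology"
    "HOL-Library.Poly_Mapping"
    "HOL-Library.Sublist"
    "HOL-Computational_Algebra.Polynomial"
    "Jordan_Normal_Form.Matrix"
    "HOL-Algebra.Ideal_Product"
    "HOL-Algebra.QuotRing"
begin

section \<open>Paths and path algebras\<close>

text \<open>
  A quiver is a \<^locale>\<open>fin_digraph\<close> (loops and multiple arrows are allowed there), with
  \<^const>\<open>tail\<close> as source and \<^const>\<open>head\<close> as target. Paths and strings are written from left to
  right as in \<open>\<alpha>\<^sub>1\<cdots>\<alpha>\<^sub>n\<close> with \<open>s(\<alpha>\<^sub>i) = t(\<alpha>\<^sub>i\<^sub>+\<^sub>1)\<close>, so a walk starts at the source of its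
  \<^emph>\<open>last\<close> letter. \<open>Walk []\<close> is a junk value; it is neither a path nor a string.
\<close>

datatype ('v, 'l) walk = Triv 'v | Walk "'l list"

fun letters :: "('v, 'l) walk \<Rightarrow> 'l list" where
  "letters (Triv u) = []"
| "letters (Walk xs) = xs"

fun walk_source :: "('l \<Rightarrow> 'v) \<Rightarrow> ('v, 'l) walk \<Rightarrow> 'v" where
  "walk_source s (Triv u) = u"
| "walk_source s (Walk xs) = s (last xs)"

fun walk_target :: "('l \<Rightarrow> 'v) \<Rightarrow> ('v, 'l) walk \<Rightarrow> 'v" where
  "walk_target t (Triv u) = u"
| "walk_target t (Walk xs) = t (hd xs)"

fun walk_append :: "('v, 'l) walk \<Rightarrow> ('v, 'l) walk \<Rightarrow> ('v, 'l) walk" where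
  "walk_append (Triv u) q = q"
| "walk_append p (Triv u) = p"
| "walk_append (Walk xs) (Walk ys) = Walk (xs @ ys)"

definition paths :: "('v, 'a) pre_digraph \<Rightarrow> ('v, 'a) walk set" where
  "paths Q = Triv ` verts Q \<union>
     {Walk as | as. as \<noteq> [] \<and> set as \<subseteq> arcs Q \<and> successively (\<lambda>\<alpha> \<beta>. tail Q \<alpha> = head Q \<beta>) as}"

definition pm_scale :: "'k::semiring_0 \<Rightarrow> ('x \<Rightarrow>\<^sub>0 'k) \<Rightarrow> ('x \<Rightarrow>\<^sub>0 'k)" where
  "pm_scale c = Poly_Mapping.map ((*) c)"

abbreviation basis_elem :: "'x \<Rightarrow> ('x \<Rightarrow>\<^sub>0 'k::zero_neq_one)" where
  "basis_elem x \<equiv> Poly_Mapping.single x 1"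

definition linear_extension ::
    "('x \<Rightarrow> ('y \<Rightarrow>\<^sub>0 'k::comm_semiring_0)) \<Rightarrow> ('x \<Rightarrow>\<^sub>0 'k) \<Rightarrow> ('y \<Rightarrow>\<^sub>0 'k)" where
  "linear_extension f x =
     (\<Sum>i\<in>Poly_Mapping.keys x. pm_scale (Poly_Mapping.lookup x i) (f i))"

definition path_prod :: "('v, 'a) pre_digraph \<Rightarrow> ('v, 'a) walk \<Rightarrow> ('v, 'a) walk
    \<Rightarrow> (('v, 'a) walk \<Rightarrow>\<^sub>0 'k::field)" where
  "path_prod Q p q =
     (if walk_source (tail Q) p = walk_target (head Q) q then basis_elem (walk_append p q) else 0)"

definition path_algebra ::
    "('v, 'a) pre_digraph \<Rightarrow> ('k::field, ('v, 'a) walk \<Rightarrow>\<^sub>0 'k) module" where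
  "path_algebra Q = \<lparr>
     carrier = {x. Poly_Mapping.keys x \<subseteq> paths Q},
     mult = (\<lambda>x y. linear_extension (\<lambda>p. linear_extension (path_prod Q p) y) x),
     one = (\<Sum>u\<in>verts Q. basis_elem (Triv u)),
     zero = 0,
     add = (+),
     smult = pm_scale\<rparr>"

section \<open>String algebras\<close>

definition arrow_ideal :: "('v, 'a) pre_digraph \<Rightarrow> (('v, 'a) walk \<Rightarrow>\<^sub>0 'k::field) set" where
  "arrow_ideal Q = genideal (path_algebra Q) ((\<lambda>\<alpha>. basis_elem (Walk [\<alpha>])) ` arcs Q)"

definition ideal_pow :: "('x, 'b) ring_scheme \<Rightarrow> 'x set \<Rightarrow> nat \<Rightarrow> 'x set" where
  "ideal_pow R J n = (ideal_prod R J ^^ n) (carrier R)"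

definition admissible_ideal ::
    "('v, 'a) pre_digraph \<Rightarrow> (('v, 'a) walk \<Rightarrow>\<^sub>0 'k::field) set \<Rightarrow> bool" where
  "admissible_ideal Q I \<longleftrightarrow> ideal I (path_algebra Q) \<and>
     I \<subseteq> ideal_pow (path_algebra Q) (arrow_ideal Q) 2 \<and>
     (\<exists>n. ideal_pow (path_algebra Q) (arrow_ideal Q) n \<subseteq> I)"

definition string_algebra ::
    "('v, 'a) pre_digraph \<Rightarrow> (('v, 'a) walk \<Rightarrow>\<^sub>0 'k::field) set \<Rightarrow> bool" where
  "string_algebra Q I \<longleftrightarrow>
     fin_digraph Q \<and>
     admissible_ideal Q I \<and>
     (\<exists>P \<subseteq> paths Q. I = genideal (path_algebra Q) (basis_elem ` P)) \<and>
     (\<forall>u \<in> verts Q. card {\<alpha> \<in> arcs Q. tail Q \<alpha> = u} \<le> 2 \<and> card {\<alpha> \<in> arcs Q. head Q \<alpha> = u} \<le> 2) \<and>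
     (\<forall>\<alpha> \<in> arcs Q. card {\<beta> \<in> arcs Q. tail Q \<alpha> = head Q \<beta> \<and> basis_elem (Walk [\<alpha>, \<beta>]) \<notin> I} \<le> 1) \<and>
     (\<forall>\<beta> \<in> arcs Q. card {\<alpha> \<in> arcs Q. tail Q \<alpha> = head Q \<beta> \<and> basis_elem (Walk [\<alpha>, \<beta>]) \<notin> I} \<le> 1)"

text \<open>The \<open>k\<close>-algebra \<open>R/I\<close>: the library quotient ring together with the induced scalar action.\<close>

definition quotient_algebra :: "('k, 'x) module \<Rightarrow> 'x set \<Rightarrow> ('k, 'x set) module" where
  "quotient_algebra R I =
     ring.extend (R Quot I)
       (module.fields (\<lambda>c X. \<Union>x\<in>X. I +>\<^bsub>R\<^esub> (c \<odot>\<^bsub>R\<^esub> x)))"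

section \<open>Strings, quasi-bands and bands\<close>

datatype 'a letter = Dir 'a | Inv 'a

fun letter_inv :: "'a letter \<Rightarrow> 'a letter" where
  "letter_inv (Dir \<alpha>) = Inv \<alpha>"
| "letter_inv (Inv \<alpha>) = Dir \<alpha>"

fun letter_source :: "('v, 'a) pre_digraph \<Rightarrow> 'a letter \<Rightarrow> 'v" where
  "letter_source Q (Dir \<alpha>) = tail Q \<alpha>"
| "letter_source Q (Inv \<alpha>) = head Q \<alpha>"

fun letter_target :: "('v, 'a) pre_digraph \<Rightarrow> 'a letter \<Rightarrow> 'v" where
  "letter_target Q (Dir \<alpha>) = head Q \<alpha>"
| "letter_target Q (Inv \<alpha>) = tail Q \<alpha>"

definition word_inv :: "'a letter list \<Rightarrow> 'a letter list" where
  "word_inv xs = rev (map letter_inv xs)"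

fun string_inv :: "('v, 'a letter) walk \<Rightarrow> ('v, 'a letter) walk" where
  "string_inv (Triv u) = Triv u"
| "string_inv (Walk xs) = Walk (word_inv xs)"

text \<open>A word belongs to \<open>I\<close> only if it is a path, that is, consists of direct letters.\<close>

definition is_string :: "('v, 'a) pre_digraph \<Rightarrow> (('v, 'a) walk \<Rightarrow>\<^sub>0 'k::field) set
    \<Rightarrow> ('v, 'a letter) walk \<Rightarrow> bool" where
  "is_string Q I c \<longleftrightarrow> (case c of
     Triv u \<Rightarrow> u \<in> verts Q
   | Walk xs \<Rightarrow>
       xs \<noteq> [] \<and> set xs \<subseteq> Dir ` arcs Q \<union> Inv ` arcs Q \<and>
       successively (\<lambda>x y. letter_source Q x = letter_target Q y \<and> x \<noteq> letter_inv y) xs \<and>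
       (\<forall>ys as. sublist ys xs \<and> ys \<noteq> [] \<and> (ys = map Dir as \<or> word_inv ys = map Dir as)
          \<longrightarrow> basis_elem (Walk as) \<notin> I))"

definition starts_and_ends_with_arrow :: "('v, 'a letter) walk \<Rightarrow> bool" where
  "starts_and_ends_with_arrow c \<longleftrightarrow>
     letters c \<noteq> [] \<and> last (letters c) \<in> range Dir \<and> hd (letters c) \<in> range Dir"

definition starts_and_ends_with_inverse_arrow :: "('v, 'a letter) walk \<Rightarrow> bool" where
  "starts_and_ends_with_inverse_arrow c \<longleftrightarrow>
     letters c \<noteq> [] \<and> last (letters c) \<in> range Inv \<and> hd (letters c) \<in> range Inv"

definition quasi_band :: "('v, 'a) pre_digraph \<Rightarrow> (('v, 'a) walk \<Rightarrow>\<^sub>0 'k::field) set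
    \<Rightarrow> (int \<Rightarrow> 'a letter) \<Rightarrow> nat \<Rightarrow> bool" where
  "quasi_band Q I b m \<longleftrightarrow> m \<ge> 1 \<and> (\<forall>i. b i = b (i + int m)) \<and>
     (\<forall>i. \<forall>n::nat. is_string Q I (Walk (map b [i..i + int n])))"

definition band :: "('v, 'a) pre_digraph \<Rightarrow> (('v, 'a) walk \<Rightarrow>\<^sub>0 'k::field) set
    \<Rightarrow> (int \<Rightarrow> 'a letter) \<Rightarrow> nat \<Rightarrow> bool" where
  "band Q I b m \<longleftrightarrow> quasi_band Q I b m \<and> (\<forall>m'. 0 < m' \<and> m' < m \<longrightarrow> \<not> quasi_band Q I b m')"

definition band_word :: "(int \<Rightarrow> 'a letter) \<Rightarrow> nat \<Rightarrow> 'a letter list" where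
  "band_word b m = map b [1..int m]"

text \<open>The periodic extension is indexed so that \<open>c(1)\<cdots>c(n)\<close> is the given word.\<close>

definition quasi_band_word :: "('v, 'a) pre_digraph \<Rightarrow> (('v, 'a) walk \<Rightarrow>\<^sub>0 'k::field) set
    \<Rightarrow> 'a letter list \<Rightarrow> bool" where
  "quasi_band_word Q I xs \<longleftrightarrow>
     quasi_band Q I (\<lambda>i. xs ! nat ((i - 1) mod int (length xs))) (length xs)"

definition band_equiv :: "(int \<Rightarrow> 'a letter) \<times> nat \<Rightarrow> (int \<Rightarrow> 'a letter) \<times> nat \<Rightarrow> bool" where
  "band_equiv B B' \<longleftrightarrow> snd B = snd B' \<and>
     (\<exists>i. (\<forall>j. fst B j = fst B' (i + j)) \<or> (\<forall>j. fst B j = letter_inv (fst B' (i - j))))"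

definition band_class :: "('v, 'a) pre_digraph \<Rightarrow> (('v, 'a) walk \<Rightarrow>\<^sub>0 'k::field) set
    \<Rightarrow> (int \<Rightarrow> 'a letter) \<times> nat \<Rightarrow> ((int \<Rightarrow> 'a letter) \<times> nat) set" where
  "band_class Q I B = {B'. quasi_band Q I (fst B') (snd B') \<and> band_equiv B B'}"

section \<open>Negligible bands\<close>

text \<open>
  \<open>is_concat Q cs xs\<close>: the strings in \<open>cs\<close> can be concatenated (trivial ones included, at matching
  vertices) and the result is the word \<open>xs\<close>.
\<close>

definition is_concat :: "('v, 'a) pre_digraph \<Rightarrow> ('v, 'a letter) walk list
    \<Rightarrow> 'a letter list \<Rightarrow> bool" where
  "is_concat Q cs xs \<longleftrightarrow>
     successively (\<lambda>c c'. walk_source (letter_source Q) c = walk_target (letter_target Q) c') cs \<and>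
     xs = concat (map letters cs)"

definition concat_quasi_band :: "('v, 'a) pre_digraph \<Rightarrow> (('v, 'a) walk \<Rightarrow>\<^sub>0 'k::field) set
    \<Rightarrow> ('v, 'a letter) walk list \<Rightarrow> bool" where
  "concat_quasi_band Q I cs \<longleftrightarrow> (\<exists>xs. is_concat Q cs xs \<and> quasi_band_word Q I xs)"

abbreviation arr :: "'a \<Rightarrow> ('v, 'a letter) walk" where
  "arr \<alpha> \<equiv> Walk [Dir \<alpha>]"

abbreviation inv_arr :: "'a \<Rightarrow> ('v, 'a letter) walk" where
  "inv_arr \<alpha> \<equiv> Walk [Inv \<alpha>]"

definition negligible_band1 :: "('v, 'a) pre_digraph \<Rightarrow> (('v, 'a) walk \<Rightarrow>\<^sub>0 'k::field) set
    \<Rightarrow> (int \<Rightarrow> 'a letter) \<Rightarrow> nat \<Rightarrow> bool" where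
  "negligible_band1 Q I b m \<longleftrightarrow>
     (\<exists>u v w x y. \<exists>\<alpha>\<in>arcs Q. \<exists>\<beta>\<in>arcs Q. \<exists>\<gamma>\<in>arcs Q. \<exists>\<delta>\<in>arcs Q. \<exists>s\<ge>1.
        is_string Q I u \<and> is_string Q I v \<and> is_string Q I w \<and> is_string Q I x \<and> is_string Q I y \<and>
        is_concat Q [u, arr \<gamma>, v, inv_arr \<alpha>] (band_word b m) \<and>
        is_concat Q [w, arr \<beta>, x, inv_arr \<alpha>] (band_word b (s * m)) \<and>
        is_concat Q [u, arr \<gamma>, w, inv_arr \<delta>, y] (band_word b (s * m)) \<and>
        concat_quasi_band Q I [u, arr \<gamma>] \<and>
        concat_quasi_band Q I [v, inv_arr \<alpha>])"

definition negligible_band2 :: "('v, 'a) pre_digraph \<Rightarrow> (('v, 'a) walk \<Rightarrow>\<^sub>0 'k::field) set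
    \<Rightarrow> (int \<Rightarrow> 'a letter) \<Rightarrow> nat \<Rightarrow> bool" where
  "negligible_band2 Q I b m \<longleftrightarrow>
     (\<exists>u v w. is_string Q I u \<and> is_string Q I v \<and> is_string Q I w \<and>
        starts_and_ends_with_arrow u \<and> starts_and_ends_with_inverse_arrow v \<and>
        is_concat Q [w, u, string_inv w, v] (band_word b m) \<and>
        concat_quasi_band Q I [w, string_inv u, string_inv w, v])"

definition negligible_band :: "('v, 'a) pre_digraph \<Rightarrow> (('v, 'a) walk \<Rightarrow>\<^sub>0 'k::field) set
    \<Rightarrow> (int \<Rightarrow> 'a letter) \<Rightarrow> nat \<Rightarrow> bool" where
  "negligible_band Q I b m \<longleftrightarrow>
     band Q I b m \<and> (negligible_band1 Q I b m \<or> negligible_band2 Q I b m)"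

definition negligible_class :: "('v, 'a) pre_digraph \<Rightarrow> (('v, 'a) walk \<Rightarrow>\<^sub>0 'k::field) set
    \<Rightarrow> ((int \<Rightarrow> 'a letter) \<times> nat) set \<Rightarrow> bool" where
  "negligible_class Q I C \<longleftrightarrow> (\<exists>(b, m) \<in> C. negligible_band Q I b m)"

section \<open>Modules\<close>

text \<open>
  The library's \<^locale>\<open>module\<close> locale requires a commutative ring, so left modules over an algebra
  are given here by records of type \<^typ>\<open>('r, 'm) module\<close> only; the fields \<^const>\<open>mult\<close> and
  \<^const>\<open>one\<close> are irrelevant. \<open>k\<close>-linearity of module homomorphisms is implied by linearity over
  the algebra.
\<close>

definition left_module_iso ::
    "('r, 'b) ring_scheme \<Rightarrow> ('r, 'm) module \<Rightarrow> ('r, 'n) module \<Rightarrow> ('m \<Rightarrow> 'n) set" where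
  "left_module_iso R M N =
     {f. bij_betw f (carrier M) (carrier N) \<and>
         (\<forall>x\<in>carrier M. \<forall>y\<in>carrier M. f (x \<oplus>\<^bsub>M\<^esub> y) = f x \<oplus>\<^bsub>N\<^esub> f y) \<and>
         (\<forall>r\<in>carrier R. \<forall>x\<in>carrier M. f (r \<odot>\<^bsub>M\<^esub> x) = r \<odot>\<^bsub>N\<^esub> f x)}"

definition quotient_module :: "('r, 'm) module \<Rightarrow> 'm set \<Rightarrow> ('r, 'm set) module" where
  "quotient_module M N = \<lparr>
     carrier = a_rcosets\<^bsub>M\<^esub> N,
     mult = undefined,
     one = undefined,
     zero = N,
     add = set_add M,
     smult = (\<lambda>r X. \<Union>x\<in>X. N +>\<^bsub>M\<^esub> (r \<odot>\<^bsub>M\<^esub> x))\<rparr>"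

definition vertex_act :: "('v, 'a) pre_digraph \<Rightarrow> (int \<Rightarrow> 'a letter) \<Rightarrow> 'v
    \<Rightarrow> (int \<Rightarrow>\<^sub>0 'k::field) \<Rightarrow> (int \<Rightarrow>\<^sub>0 'k)" where
  "vertex_act Q b u =
     linear_extension (\<lambda>i. if u = letter_source Q (b i) then basis_elem i else 0)"

text \<open>
  The two cases are \<open>\<alpha> e\<^sub>i = e\<^sub>i\<^sub>-\<^sub>1\<close> if \<open>b(i) = \<alpha>\<close> and (shifting the index) \<open>\<alpha> e\<^sub>i = e\<^sub>i\<^sub>+\<^sub>1\<close> if
  \<open>b(i + 1) = \<alpha>\<^sup>-\<^sup>1\<close>. They exclude each other since \<open>b(i) \<noteq> b(i + 1)\<^sup>-\<^sup>1\<close> in a quasi-band.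
\<close>

definition arrow_act :: "(int \<Rightarrow> 'a letter) \<Rightarrow> 'a \<Rightarrow> (int \<Rightarrow>\<^sub>0 'k::field) \<Rightarrow> (int \<Rightarrow>\<^sub>0 'k)" where
  "arrow_act b \<alpha> = linear_extension
     (\<lambda>i. if b i = Dir \<alpha> then basis_elem (i - 1)
          else if b (i + 1) = Inv \<alpha> then basis_elem (i + 1)
          else 0)"

fun path_act :: "('v, 'a) pre_digraph \<Rightarrow> (int \<Rightarrow> 'a letter) \<Rightarrow> ('v, 'a) walk
    \<Rightarrow> (int \<Rightarrow>\<^sub>0 'k::field) \<Rightarrow> (int \<Rightarrow>\<^sub>0 'k)" where
  "path_act Q b (Triv u) v = vertex_act Q b u v"
| "path_act Q b (Walk as) v = foldr (arrow_act b) as v"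

definition path_algebra_act :: "('v, 'a) pre_digraph \<Rightarrow> (int \<Rightarrow> 'a letter)
    \<Rightarrow> (('v, 'a) walk \<Rightarrow>\<^sub>0 'k::field) \<Rightarrow> (int \<Rightarrow>\<^sub>0 'k) \<Rightarrow> (int \<Rightarrow>\<^sub>0 'k)" where
  "path_algebra_act Q b x v = linear_extension (\<lambda>p. path_act Q b p v) x"

text \<open>
  \<open>M(b)\<close> as a module over \<open>kQ/I\<close>. A coset acts through any of its representatives; the set below
  is a singleton, as \<open>I\<close> annihilates \<open>M(b)\<close> for a quasi-band \<open>b\<close>.
\<close>

definition periodic_module :: "('v, 'a) pre_digraph \<Rightarrow> (int \<Rightarrow> 'a letter)
    \<Rightarrow> ((('v, 'a) walk \<Rightarrow>\<^sub>0 'k::field) set, int \<Rightarrow>\<^sub>0 'k) module" where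
  "periodic_module Q b = \<lparr>
     carrier = UNIV,
     mult = undefined,
     one = undefined,
     zero = 0,
     add = (+),
     smult = (\<lambda>X v. the_elem ((\<lambda>x. path_algebra_act Q b x v) ` X))\<rparr>"

definition band_submodule :: "nat \<Rightarrow> 'k::field \<Rightarrow> (int \<Rightarrow>\<^sub>0 'k) set" where
  "band_submodule m c =
     module.span pm_scale
       (range (\<lambda>i. basis_elem i - pm_scale c (basis_elem (i + int m))))"

definition band_module :: "('v, 'a) pre_digraph \<Rightarrow> (int \<Rightarrow> 'a letter) \<Rightarrow> nat \<Rightarrow> 'k::field
    \<Rightarrow> ((('v, 'a) walk \<Rightarrow>\<^sub>0 'k) set, (int \<Rightarrow>\<^sub>0 'k) set) module" where
  "band_module Q b m c = quotient_module (periodic_module Q b) (band_submodule m c)"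

section \<open>Module varieties\<close>

text \<open>
  Points of \<open>mod(A, d)\<close> are unital \<open>k\<close>-algebra homomorphisms \<open>A \<rightarrow> M\<^sub>d(k)\<close>; extensionality makes
  them unique as functions on the carrier.
\<close>

definition module_variety :: "('k::field, 'x) module \<Rightarrow> nat \<Rightarrow> ('x \<Rightarrow> 'k mat) set" where
  "module_variety A d =
     {\<phi> \<in> ring_hom A (ring_mat TYPE('k) d ()) \<inter> extensional (carrier A).
        \<forall>c. \<forall>a\<in>carrier A. \<phi> (c \<odot>\<^bsub>A\<^esub> a) = c \<cdot>\<^sub>m \<phi> a}"

definition point_module :: "nat \<Rightarrow> ('x \<Rightarrow> 'k::field mat) \<Rightarrow> ('x, 'k vec) module" where
  "point_module d \<phi> = \<lparr>
     carrier = carrier_vec d,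
     mult = undefined,
     one = undefined,
     zero = 0\<^sub>v d,
     add = (+),
     smult = (\<lambda>a v. \<phi> a *\<^sub>v v)\<rparr>"

text \<open>
  The coordinates of a point \<open>\<phi>\<close> are the matrix entries of the \<open>\<phi>(a)\<close>. Letting \<open>a\<close> range over all of
  \<open>A\<close> instead of over a finite basis yields the same polynomial functions.
\<close>

inductive_set polynomial_functions :: "('k::field, 'x) module \<Rightarrow> nat \<Rightarrow> (('x \<Rightarrow> 'k mat) \<Rightarrow> 'k) set"
  for A :: "('k, 'x) module" and d :: nat where
  const: "(\<lambda>_. c) \<in> polynomial_functions A d"
| coord: "a \<in> carrier A \<Longrightarrow> i < d \<Longrightarrow> j < d \<Longrightarrow> (\<lambda>\<phi>. \<phi> a $$ (i, j)) \<in> polynomial_functions A d"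
| add: "f \<in> polynomial_functions A d \<Longrightarrow> g \<in> polynomial_functions A d \<Longrightarrow>
    (\<lambda>\<phi>. f \<phi> + g \<phi>) \<in> polynomial_functions A d"
| mult: "f \<in> polynomial_functions A d \<Longrightarrow> g \<in> polynomial_functions A d \<Longrightarrow>
    (\<lambda>\<phi>. f \<phi> * g \<phi>) \<in> polynomial_functions A d"

definition zero_locus :: "('k::field, 'x) module \<Rightarrow> nat \<Rightarrow> (('x \<Rightarrow> 'k mat) \<Rightarrow> 'k) set
    \<Rightarrow> ('x \<Rightarrow> 'k mat) set" where
  "zero_locus A d S = {\<phi> \<in> module_variety A d. \<forall>f\<in>S. f \<phi> = 0}"

definition zariski_topology :: "('k::field, 'x) module \<Rightarrow> nat \<Rightarrow> ('x \<Rightarrow> 'k mat) topology" where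
  "zariski_topology A d = topology
     (\<lambda>U. \<exists>S \<subseteq> polynomial_functions A d. U = module_variety A d - zero_locus A d S)"

lemma openin_zariski_topology:
  "openin (zariski_topology A d) U \<longleftrightarrow>
     (\<exists>S \<subseteq> polynomial_functions A d. U = module_variety A d - zero_locus A d S)"
proof -
  let ?P = "polynomial_functions A d" and ?M = "module_variety A d"
  let ?L = "\<lambda>U. \<exists>S \<subseteq> ?P. U = ?M - zero_locus A d S"
  have "istopology ?L"
    unfolding istopology_def
  proof (intro conjI allI impI)
    fix U V assume "?L U" "?L V"
    then obtain S T where S: "S \<subseteq> ?P" "U = ?M - zero_locus A d S"
      and T: "T \<subseteq> ?P" "V = ?M - zero_locus A d T" by blast
    let ?ST = "{\<lambda>\<phi>. f \<phi> * g \<phi> | f g. f \<in> S \<and> g \<in> T}"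
    have "?ST \<subseteq> ?P" using S T by (auto intro: polynomial_functions.mult)
    moreover have "zero_locus A d ?ST = zero_locus A d S \<union> zero_locus A d T"
    proof (intro equalityI subsetI)
      fix \<phi> assume \<phi>: "\<phi> \<in> zero_locus A d ?ST"
      show "\<phi> \<in> zero_locus A d S \<union> zero_locus A d T"
      proof (rule ccontr)
        assume "\<not> ?thesis"
        then obtain f g where fg: "f \<in> S" "f \<phi> \<noteq> 0" "g \<in> T" "g \<phi> \<noteq> 0"
          using \<phi> by (auto simp: zero_locus_def)
        then have mem: "(\<lambda>\<phi>. f \<phi> * g \<phi>) \<in> ?ST" by blast
        have "\<forall>h\<in>?ST. h \<phi> = 0" using \<phi> by (simp add: zero_locus_def)
        from bspec[OF this mem] have "f \<phi> * g \<phi> = 0" .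
        then show False using fg by simp
      qed
    qed (auto simp: zero_locus_def)
    then have "U \<inter> V = ?M - zero_locus A d ?ST"
      unfolding S(2) T(2) by (simp only: Diff_Un)
    ultimately show "?L (U \<inter> V)" by blast
  next
    fix \<K> assume "\<forall>K\<in>\<K>. ?L K"
    then have "\<exists>S. \<forall>K\<in>\<K>. S K \<subseteq> ?P \<and> K = ?M - zero_locus A d (S K)"
      by (intro bchoice) blast
    then obtain S where S: "\<And>K. K \<in> \<K> \<Longrightarrow> S K \<subseteq> ?P"
        "\<And>K. K \<in> \<K> \<Longrightarrow> K = ?M - zero_locus A d (S K)"
      by blast
    have "(\<Union>K\<in>\<K>. S K) \<subseteq> ?P" using S by blast
    moreover have "(\<Union>K\<in>\<K>. K) = (\<Union>K\<in>\<K>. ?M - zero_locus A d (S K))"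
      by (rule SUP_cong[OF refl S(2)])
    then have "\<Union>\<K> = ?M - zero_locus A d (\<Union>K\<in>\<K>. S K)"
      by (auto simp: zero_locus_def)
    ultimately show "?L (\<Union>\<K>)" by blast
  qed
  then show ?thesis by (simp add: zariski_topology_def topology_inverse')
qed

lemma topspace_zariski_topology: "topspace (zariski_topology A d) = module_variety A d"
proof -
  have "{\<lambda>_. 1} \<subseteq> polynomial_functions A d" by (simp add: polynomial_functions.const)
  moreover have "zero_locus A d {\<lambda>_. 1} = {}" by (auto simp: zero_locus_def)
  ultimately have "openin (zariski_topology A d) (module_variety A d)"
    unfolding openin_zariski_topology by (metis Diff_empty)
  moreover have "U \<subseteq> module_variety A d" if "openin (zariski_topology A d) U" for U
    using that unfolding openin_zariski_topology by blast
  ultimately show ?thesis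
    unfolding topspace_def by blast
qed

definition irreducible_in :: "'x topology \<Rightarrow> 'x set \<Rightarrow> bool" where
  "irreducible_in X S \<longleftrightarrow> S \<subseteq> topspace X \<and> S \<noteq> {} \<and>
     (\<forall>C D. closedin X C \<and> closedin X D \<and> S \<subseteq> C \<union> D \<longrightarrow> S \<subseteq> C \<or> S \<subseteq> D)"

definition irreducible_component :: "'x topology \<Rightarrow> 'x set \<Rightarrow> bool" where
  "irreducible_component X S \<longleftrightarrow>
     irreducible_in X S \<and> (\<forall>T. irreducible_in X T \<and> S \<subseteq> T \<longrightarrow> T = S)"

definition band_family :: "('v, 'a) pre_digraph \<Rightarrow> (('v, 'a) walk \<Rightarrow>\<^sub>0 'k::field) set
    \<Rightarrow> (int \<Rightarrow> 'a letter) \<Rightarrow> nat \<Rightarrow> ((('v, 'a) walk \<Rightarrow>\<^sub>0 'k) set \<Rightarrow> 'k mat) set" where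
  "band_family Q I b m =
     (let A = quotient_algebra (path_algebra Q) I in
      {\<phi> \<in> module_variety A m.
         \<exists>c. c \<noteq> 0 \<and> left_module_iso A (point_module m \<phi>) (band_module Q b m c) \<noteq> {}})"

end

theory Submission
  imports Defs "Jordan_Normal_Form.Determinant"
begin

text \<open>
  A negligible band contains a string \<open>w\<close> twice: as \<open>\<alpha>\<^sup>-\<^sup>1 w \<beta>\<close>, where \<open>M(w)\<close> is a
  submodule of the band module, and as \<open>\<gamma> w \<delta>\<^sup>-\<^sup>1\<close>, possibly read backwards, where \<open>M(w)\<close> is a factor
  module. Exchanging the arms of the two copies at one end produces the quasi-bands in the definition:
  \<open>u\<gamma>\<close> and \<open>v\<alpha>\<^sup>-\<^sup>1\<close> in the first case, \<open>w u\<^sup>-\<^sup>1 w\<^sup>-\<^sup>1 v\<close> in the second one. The modules of the exchanged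
  words degenerate to the band modules of \<open>b\<close>, so the closure of \<open>\<F>(b, m)\<close> is properly contained in
  a larger irreducible set.

  To see this explicitly, let \<open>e\<^sub>0\<close> and \<open>e\<^sub>f\<close> be the basis vectors at the left ends of the two copies. In
  the representation \<open>N(z, s)\<close> of the locale \<open>bend\<close> the arrow that enters \<open>e\<^sub>0\<close> takes the value
  \<open>z (e\<^sub>0 + s e\<^sub>f)\<close>, the arrow that leaves \<open>e\<^sub>f\<close> reads the coordinate \<open>e\<^sub>f\<^sup>* - s e\<^sub>0\<^sup>*\<close>, and nothing else
  is changed. Its matrices are polynomial in \<open>z\<close> and \<open>s\<close>, and \<open>N(z, 0)\<close> is the band module
  \<open>M(b, m, z\<^sup>-\<^sup>1)\<close>. For \<open>s \<noteq> 0\<close> the representation is spanned by sequences on which the arrows act as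
  along the exchanged words (\<open>corrected_walk\<close>, \<open>bound_rep_two_bands\<close>, \<open>bound_rep_one_band\<close>), and strings
  contain no path of \<open>I\<close>, so \<open>N(z, s)\<close> is a module over \<open>kQ/I\<close>. Conjugating by all invertible
  matrices gives the set \<open>bent_family\<close>; any two of its points lie on a rational curve inside the
  set, hence it is irreducible (\<open>bent_family_irreducible\<close>), and it contains \<open>\<F>(b, m)\<close>.

  The inclusion of closures is proper because \<open>dim Hom(M(w), N(z, s))\<close> jumps at \<open>s = 0\<close>: the
  embedding of the submodule copy of \<open>w\<close> is a homomorphism for \<open>s = 0\<close> with coordinate \<open>1\<close> at \<open>e\<^sub>0\<close>,
  whereas for \<open>s \<noteq> 0\<close> every homomorphism has coordinate \<open>0\<close> there (\<open>word_rank_jump\<close>). The points where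
  the linear system for these homomorphisms has rank below a given bound form a closed set. If the two
  closures were equal, \<open>\<F>(b, m)\<close> would therefore contain a point whose rank is at least the maximal
  rank for \<open>s \<noteq> 0\<close>, and the jump would exceed this maximum (\<open>closure_not_component\<close>).
\<close>

section \<open>Linear maps on finitely supported functions\<close>

abbreviation pm_linear :: "(('x \<Rightarrow>\<^sub>0 'k::field) \<Rightarrow> ('y \<Rightarrow>\<^sub>0 'k)) \<Rightarrow> bool" where
  "pm_linear \<equiv> Vector_Spaces.linear pm_scale pm_scale"

lemma lookup_pm_scale [simp]:
  "Poly_Mapping.lookup (pm_scale c x) i = c * Poly_Mapping.lookup (x :: 'x \<Rightarrow>\<^sub>0 'k::field) i"
  unfolding pm_scale_def by (simp add: Poly_Mapping.map.rep_eq when_def)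

interpretation pm: vector_space "pm_scale :: 'k::field \<Rightarrow> ('x \<Rightarrow>\<^sub>0 'k) \<Rightarrow> ('x \<Rightarrow>\<^sub>0 'k)"
  by unfold_locales (auto intro!: poly_mapping_eqI simp: lookup_add algebra_simps)

lemma pm_scale_single: "pm_scale c (Poly_Mapping.single i a) = Poly_Mapping.single i (c * (a::'k::field))"
  by (rule poly_mapping_eqI) (simp add: lookup_single when_def)

lemma pm_scale_eq_mult_single: "pm_scale c (basis_elem i) = Poly_Mapping.single i (c::'k::field)"
  by (simp add: pm_scale_single)

lemma pm_linearI:
  assumes "\<And>x y. L (x + y) = L x + L y" "\<And>c x. L (pm_scale c x) = pm_scale c (L x)"
  shows "pm_linear (L :: ('x \<Rightarrow>\<^sub>0 'k::field) \<Rightarrow> ('y \<Rightarrow>\<^sub>0 'k))"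
  using assms by (simp add: Vector_Spaces.linear_iff pm.vector_space_axioms)

lemma
  assumes "pm_linear L"
  shows pm_linear_add: "L (x + y) = L x + L y"
    and pm_linear_scale: "L (pm_scale c x) = pm_scale c (L x)"
    and pm_linear_0: "L 0 = 0"
    and pm_linear_diff: "L (x - y) = L x - L y"
    and pm_linear_sum: "L (sum g S) = (\<Sum>a\<in>S. L (g a))"
proof -
  interpret L: Vector_Spaces.linear pm_scale pm_scale L by (rule assms)
  show "L (x + y) = L x + L y" by (rule L.add)
  show "L (pm_scale c x) = pm_scale c (L x)" by (rule L.scale)
  show "L 0 = 0" by (rule L.zero)
  show "L (x - y) = L x - L y" by (rule L.diff)
  show "L (sum g S) = (\<Sum>a\<in>S. L (g a))" by (rule L.sum)
qed

lemma linear_extension_superset: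
  assumes "finite S" "Poly_Mapping.keys x \<subseteq> S"
  shows "linear_extension f x = (\<Sum>i\<in>S. pm_scale (Poly_Mapping.lookup x i) (f i :: 'y \<Rightarrow>\<^sub>0 'k::field))"
  unfolding linear_extension_def
  by (rule sum.mono_neutral_left[OF assms]) (auto simp: in_keys_iff)

lemma pm_linear_linear_extension: "pm_linear (linear_extension (f :: 'x \<Rightarrow> ('y \<Rightarrow>\<^sub>0 'k::field)))"
proof (rule pm_linearI)
  fix x y :: "'x \<Rightarrow>\<^sub>0 'k" and c
  let ?S = "Poly_Mapping.keys x \<union> Poly_Mapping.keys y"
  have "linear_extension f (x + y) = (\<Sum>i\<in>?S. pm_scale (Poly_Mapping.lookup (x + y) i) (f i))"
    by (rule linear_extension_superset) (auto dest: subsetD[OF Poly_Mapping.keys_add])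
  then show "linear_extension f (x + y) = linear_extension f x + linear_extension f y"
    by (simp add: linear_extension_superset[of ?S x] linear_extension_superset[of ?S y]
        lookup_add pm.scale_left_distrib sum.distrib)
  have "linear_extension f (pm_scale c x)
      = (\<Sum>i\<in>Poly_Mapping.keys x. pm_scale (Poly_Mapping.lookup (pm_scale c x) i) (f i))"
    by (rule linear_extension_superset) (auto simp: in_keys_iff)
  then show "linear_extension f (pm_scale c x) = pm_scale c (linear_extension f x)"
    by (simp add: linear_extension_def pm.scale_sum_right)
qed

lemma linear_extension_basis [simp]:
  "linear_extension f (basis_elem i) = (f i :: 'y \<Rightarrow>\<^sub>0 'k::field)"
  by (simp add: linear_extension_def)

lemma linear_extension_single:
  "linear_extension f (Poly_Mapping.single i c) = pm_scale c (f i :: 'y \<Rightarrow>\<^sub>0 'k::field)"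
  using pm_linear_scale[OF pm_linear_linear_extension, of f c "basis_elem i"]
  by (simp add: pm_scale_eq_mult_single)

lemma linear_of_linear_extension:
  assumes "pm_linear L"
  shows "L (linear_extension f x) = linear_extension (\<lambda>i. L (f i)) x"
  unfolding linear_extension_def
  by (simp add: pm_linear_sum[OF assms] pm_linear_scale[OF assms])

lemma linear_extension_cong:
  assumes "\<And>i. i \<in> Poly_Mapping.keys x \<Longrightarrow> f i = g i"
  shows "linear_extension f x = linear_extension g x"
  unfolding linear_extension_def by (rule sum.cong) (auto simp: assms)

lemma linear_extension_zero [simp]: "linear_extension (\<lambda>i. 0) x = (0 :: 'y \<Rightarrow>\<^sub>0 'k::field)"
  by (simp add: linear_extension_def)

lemma linear_extension_add_fun:
  "linear_extension (\<lambda>i. f i + g i) x = linear_extension f x + (linear_extension g x :: 'y \<Rightarrow>\<^sub>0 'k::field)"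
  by (simp add: linear_extension_def pm.scale_right_distrib sum.distrib)

lemma linear_extension_scale_fun:
  "linear_extension (\<lambda>i. pm_scale c (f i)) x = pm_scale c (linear_extension f x :: 'y \<Rightarrow>\<^sub>0 'k::field)"
  by (simp add: linear_extension_def pm.scale_sum_right mult.commute)

lemma pm_eq_linear_extension: "x = linear_extension basis_elem (x :: 'x \<Rightarrow>\<^sub>0 'k::field)"
  unfolding linear_extension_def
  by (rule poly_mapping_eqI)
     (auto simp: lookup_sum lookup_single when_def in_keys_iff if_distrib cong: if_cong)

lemma pm_linear_basis_expansion:
  assumes "pm_linear L" "finite S" "Poly_Mapping.keys x \<subseteq> S"
  shows "L x = (\<Sum>i\<in>S. pm_scale (Poly_Mapping.lookup x i) (L (basis_elem i)))"
proof -
  have "L x = linear_extension (\<lambda>i. L (basis_elem i)) x"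
    by (subst pm_eq_linear_extension[of x], subst linear_of_linear_extension[OF assms(1)]) simp
  then show ?thesis using linear_extension_superset[OF assms(2,3)] by simp
qed

section \<open>Representations of a quiver\<close>

fun walk_act :: "('v \<Rightarrow> 'w \<Rightarrow> 'w) \<Rightarrow> ('a \<Rightarrow> 'w \<Rightarrow> 'w) \<Rightarrow> ('v, 'a) walk \<Rightarrow> 'w \<Rightarrow> 'w" where
  "walk_act U R (Triv u) = U u"
| "walk_act U R (Walk as) = foldr R as"

definition alg_act :: "('v \<Rightarrow> ('x \<Rightarrow>\<^sub>0 'k::field) \<Rightarrow> ('x \<Rightarrow>\<^sub>0 'k)) \<Rightarrow> ('a \<Rightarrow> ('x \<Rightarrow>\<^sub>0 'k) \<Rightarrow> ('x \<Rightarrow>\<^sub>0 'k))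
    \<Rightarrow> (('v, 'a) walk \<Rightarrow>\<^sub>0 'k) \<Rightarrow> ('x \<Rightarrow>\<^sub>0 'k) \<Rightarrow> ('x \<Rightarrow>\<^sub>0 'k)" where
  "alg_act U R x v = linear_extension (\<lambda>p. walk_act U R p v) x"

lemma path_algebra_simps:
  "carrier (path_algebra Q) = {x. Poly_Mapping.keys x \<subseteq> paths Q}"
  "mult (path_algebra Q) x y = linear_extension (\<lambda>p. linear_extension (path_prod Q p) y) x"
  "one (path_algebra Q) = (\<Sum>u\<in>verts Q. basis_elem (Triv u))"
  "zero (path_algebra Q) = 0"
  "add (path_algebra Q) x y = x + y"
  "smult (path_algebra Q) c x = pm_scale c x"
  by (simp_all add: path_algebra_def)

lemma paths_Walk_iff: "Walk as \<in> paths Q \<longleftrightarrow>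
    as \<noteq> [] \<and> set as \<subseteq> arcs Q \<and> successively (\<lambda>\<alpha> \<beta>. tail Q \<alpha> = head Q \<beta>) as"
  by (auto simp: paths_def)

lemma paths_Triv_iff: "Triv u \<in> paths Q \<longleftrightarrow> u \<in> verts Q"
  by (auto simp: paths_def)

text \<open>
  The last three conditions make the operators of paths multiply like the paths themselves, so that
  the representation extends to the path algebra.
\<close>

locale quiver_rep =
  fixes Q :: "('v, 'a) pre_digraph"
    and U :: "'v \<Rightarrow> ('x \<Rightarrow>\<^sub>0 'k::field) \<Rightarrow> ('x \<Rightarrow>\<^sub>0 'k)"
    and R :: "'a \<Rightarrow> ('x \<Rightarrow>\<^sub>0 'k) \<Rightarrow> ('x \<Rightarrow>\<^sub>0 'k)"
  assumes linear_U: "pm_linear (U u)"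
    and linear_R: "pm_linear (R \<eta>)"
    and U_U: "U u (U u' v) = (if u = u' then U u v else 0)"
    and R_U: "R \<eta> (U u v) = (if u = tail Q \<eta> then R \<eta> v else 0)"
    and U_R: "U u (R \<eta> v) = (if u = head Q \<eta> then R \<eta> v else 0)"
begin

lemma linear_foldr: "pm_linear (foldr R as)"
proof (induction as)
  case (Cons a as)
  then show ?case
    by (intro pm_linearI) (simp_all add: pm_linear_add pm_linear_scale linear_R)
qed (simp add: pm_linearI)

lemma linear_walk_act: "pm_linear (walk_act U R p)"
  by (cases p) (simp_all add: linear_U linear_foldr)

lemma linear_alg_act: "pm_linear (alg_act U R x)"
  by (rule pm_linearI)
    (simp_all add: alg_act_def pm_linear_add[OF linear_walk_act] pm_linear_scale[OF linear_walk_act]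
      linear_extension_add_fun linear_extension_scale_fun)

lemma linear_alg_act_left: "pm_linear (\<lambda>x. alg_act U R x v)"
  unfolding alg_act_def by (rule pm_linear_linear_extension)

lemma foldr_U: "as \<noteq> [] \<Longrightarrow> foldr R as (U u v) = (if u = tail Q (last as) then foldr R as v else 0)"
proof (induction as)
  case (Cons a as)
  then show ?case by (cases "as = []") (auto simp: R_U pm_linear_0[OF linear_R])
qed simp

lemma U_foldr: "as \<noteq> [] \<Longrightarrow> U u (foldr R as v) = (if u = head Q (hd as) then foldr R as v else 0)"
  by (cases as) (simp_all add: U_R)

lemma walk_act_mult:
  assumes "p \<in> paths Q" "q \<in> paths Q"
  shows "walk_act U R p (walk_act U R q v)
    = (if walk_source (tail Q) p = walk_target (head Q) q then walk_act U R (walk_append p q) v else 0)"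
proof (cases p)
  case (Triv u)
  then show ?thesis
    using assms by (cases q) (auto simp: U_U U_foldr paths_Walk_iff)
next
  case p: (Walk as)
  show ?thesis
  proof (cases q)
    case (Triv u)
    then show ?thesis using p assms by (auto simp: foldr_U paths_Walk_iff)
  next
    case (Walk bs)
    have "foldr R as (foldr R bs v) = 0" if "tail Q (last as) \<noteq> head Q (hd bs)"
      using that assms p Walk U_foldr[of bs "head Q (hd bs)" v] foldr_U[of as "head Q (hd bs)" "foldr R bs v"]
      by (simp add: paths_Walk_iff)
    then show ?thesis using p Walk by simp
  qed
qed

lemma alg_act_mult:
  assumes "x \<in> carrier (path_algebra Q)" "y \<in> carrier (path_algebra Q)"
  shows "alg_act U R (x \<otimes>\<^bsub>path_algebra Q\<^esub> y) v = alg_act U R x (alg_act U R y v)"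
proof -
  have *: "alg_act U R (path_prod Q p q) v = walk_act U R p (walk_act U R q v)"
    if "p \<in> paths Q" "q \<in> paths Q" for p q
    unfolding path_prod_def alg_act_def walk_act_mult[OF that]
    by (simp add: pm_linear_0[OF pm_linear_linear_extension])
  have "alg_act U R (x \<otimes>\<^bsub>path_algebra Q\<^esub> y) v
      = linear_extension (\<lambda>p. linear_extension (\<lambda>q. alg_act U R (path_prod Q p q) v) y) x"
    unfolding path_algebra_simps
    by (simp add: linear_of_linear_extension[OF linear_alg_act_left])
  also have "\<dots> = linear_extension (\<lambda>p. linear_extension (\<lambda>q. walk_act U R p (walk_act U R q v)) y) x"
    using assms by (intro linear_extension_cong *) (auto simp: path_algebra_simps)
  also have "\<dots> = linear_extension (\<lambda>p. walk_act U R p (alg_act U R y v)) x"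
    unfolding alg_act_def linear_of_linear_extension[OF linear_walk_act] ..
  finally show ?thesis by (simp add: alg_act_def)
qed

lemma alg_act_add: "alg_act U R (x + y) v = alg_act U R x v + alg_act U R y v"
  by (rule pm_linear_add[OF linear_alg_act_left])

lemma alg_act_scale: "alg_act U R (pm_scale c x) v = pm_scale c (alg_act U R x v)"
  by (rule pm_linear_scale[OF linear_alg_act_left])

lemma alg_act_zero: "alg_act U R 0 v = 0"
  by (rule pm_linear_0[OF linear_alg_act_left])

lemma alg_act_basis: "alg_act U R (basis_elem p) v = walk_act U R p v"
  by (simp add: alg_act_def)

text \<open>The elements acting by zero form an ideal.\<close>

lemma alg_act_genideal_eq_0:
  assumes ring: "ring (path_algebra Q :: ('k, ('v, 'a) walk \<Rightarrow>\<^sub>0 'k) module)"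
    and P: "P \<subseteq> paths Q" and kill: "\<And>p v. p \<in> P \<Longrightarrow> walk_act U R p v = 0"
    and x: "x \<in> genideal (path_algebra Q) (basis_elem ` P)"
  shows "alg_act U R x v = 0"
proof -
  let ?A = "path_algebra Q :: ('k, ('v, 'a) walk \<Rightarrow>\<^sub>0 'k) module"
  interpret ring ?A by (rule ring)
  let ?K = "{x \<in> carrier ?A. \<forall>v. alg_act U R x v = 0}"
  have minus: "\<ominus>\<^bsub>?A\<^esub> x = - x" if "x \<in> carrier ?A" for x
    using that by (intro minus_equality) (auto simp: path_algebra_simps)
  have "ideal ?K ?A"
  proof (rule idealI[OF ring])
    show "subgroup ?K (add_monoid ?A)"
    proof
      fix x assume "x \<in> ?K"
      then have x: "x \<in> carrier ?A" "\<And>v. alg_act U R x v = 0" by auto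
      have "inv\<^bsub>add_monoid ?A\<^esub> x = pm_scale (-1) x"
        using minus[OF x(1)] by (simp add: a_inv_def)
      moreover have "alg_act U R (pm_scale (-1) x) v = 0" for v
        unfolding alg_act_scale x(2) by simp
      ultimately show "inv\<^bsub>add_monoid ?A\<^esub> x \<in> ?K"
        using a_inv_closed[OF x(1)] by (simp add: a_inv_def)
    qed (auto simp: alg_act_add alg_act_zero path_algebra_simps dest!: subsetD[OF Poly_Mapping.keys_add])
  next
    fix a x assume "a \<in> ?K" "x \<in> carrier ?A"
    then show "x \<otimes>\<^bsub>?A\<^esub> a \<in> ?K" "a \<otimes>\<^bsub>?A\<^esub> x \<in> ?K"
      by (auto simp: alg_act_mult pm_linear_0[OF linear_alg_act])
  qed
  moreover have "basis_elem ` P \<subseteq> ?K"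
    using P kill by (auto simp: alg_act_basis path_algebra_simps)
  ultimately have "genideal ?A (basis_elem ` P) \<subseteq> ?K"
    by (rule genideal_minimal)
  then show ?thesis using x by auto
qed

end

section \<open>Points of the module variety\<close>

lemma quotient_algebra_simps:
  "carrier (quotient_algebra A I) = a_rcosets\<^bsub>A\<^esub> I"
  "mult (quotient_algebra A I) = rcoset_mult A I"
  "one (quotient_algebra A I) = I +>\<^bsub>A\<^esub> \<one>\<^bsub>A\<^esub>"
  "zero (quotient_algebra A I) = I"
  "add (quotient_algebra A I) = set_add A"
  "smult (quotient_algebra A I) c X = (\<Union>x\<in>X. I +>\<^bsub>A\<^esub> (c \<odot>\<^bsub>A\<^esub> x))"
  by (simp_all add: quotient_algebra_def FactRing_def ring.defs module.defs)

lemma ring_mat_carrier_mult_one_add: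
  "carrier (ring_mat TYPE('k::semiring_1) n ()) = carrier_mat n n"
  "mult (ring_mat TYPE('k::semiring_1) n ()) = (*)"
  "one (ring_mat TYPE('k::semiring_1) n ()) = 1\<^sub>m n"
  "add (ring_mat TYPE('k::semiring_1) n ()) = (+)"
  by (simp_all add: ring_mat_def)

locale path_ideal =
  fixes Q :: "('v, 'a) pre_digraph" and I :: "(('v, 'a) walk \<Rightarrow>\<^sub>0 'k::field) set"
  assumes ideal_I: "ideal I (path_algebra Q)"
begin

abbreviation PA :: "('k, ('v, 'a) walk \<Rightarrow>\<^sub>0 'k) module" where "PA \<equiv> path_algebra Q"
abbreviation A :: "('k, (('v, 'a) walk \<Rightarrow>\<^sub>0 'k) set) module" where "A \<equiv> quotient_algebra PA I"
abbreviation cls :: "(('v, 'a) walk \<Rightarrow>\<^sub>0 'k) \<Rightarrow> (('v, 'a) walk \<Rightarrow>\<^sub>0 'k) set" where "cls x \<equiv> I +>\<^bsub>PA\<^esub> x"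

sublocale ideal I PA by (rule ideal_I)

lemma carrier_PA_iff: "x \<in> carrier PA \<longleftrightarrow> Poly_Mapping.keys x \<subseteq> paths Q"
  by (simp add: path_algebra_simps)

lemma basis_in_carrier: "p \<in> paths Q \<Longrightarrow> basis_elem p \<in> carrier PA"
  by (simp add: carrier_PA_iff)

lemma scale_in_carrier: "x \<in> carrier PA \<Longrightarrow> pm_scale c x \<in> carrier PA"
  by (auto simp: carrier_PA_iff in_keys_iff subset_iff)

lemma plus_in_carrier: "x \<in> carrier PA \<Longrightarrow> y \<in> carrier PA \<Longrightarrow> x + y \<in> carrier PA"
  using a_closed[of x y] add.m_closed[of x y] by (simp add: path_algebra_simps(5))

lemma scale_mult: "pm_scale c x \<otimes>\<^bsub>PA\<^esub> y = pm_scale c (x \<otimes>\<^bsub>PA\<^esub> y)"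
  by (simp add: path_algebra_simps pm_linear_scale[OF pm_linear_linear_extension])

lemma scale_in_I:
  assumes "x \<in> I" shows "pm_scale c x \<in> I"
proof -
  have "pm_scale c \<one>\<^bsub>PA\<^esub> \<otimes>\<^bsub>PA\<^esub> x \<in> I"
    by (rule I_l_closed[OF assms scale_in_carrier]) simp
  then show ?thesis using assms by (simp add: scale_mult)
qed

lemma mem_cls_iff: "y \<in> cls x \<longleftrightarrow> (\<exists>i\<in>I. y = i + x)"
  by (auto simp: a_r_coset_def' path_algebra_simps)

lemma self_mem_cls: "x \<in> cls x"
proof -
  have "(0 :: ('v, 'a) walk \<Rightarrow>\<^sub>0 'k) \<in> I" using additive_subgroup.zero_closed[OF is_additive_subgroup] by (simp add: path_algebra_simps(4))
  then show ?thesis unfolding mem_cls_iff by force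
qed

lemma carrier_A: "carrier A = cls ` carrier PA"
  by (auto simp: quotient_algebra_simps A_RCOSETS_def')

lemma cls_in_A: "x \<in> carrier PA \<Longrightarrow> cls x \<in> carrier A"
  by (simp add: carrier_A)

lemma cls_mult: "x \<in> carrier PA \<Longrightarrow> y \<in> carrier PA \<Longrightarrow> cls x \<otimes>\<^bsub>A\<^esub> cls y = cls (x \<otimes>\<^bsub>PA\<^esub> y)"
  by (simp add: quotient_algebra_simps rcoset_mult_add)

lemma cls_add: "x \<in> carrier PA \<Longrightarrow> y \<in> carrier PA \<Longrightarrow> cls x \<oplus>\<^bsub>A\<^esub> cls y = cls (x + y)"
  by (simp add: quotient_algebra_simps a_rcos_sum path_algebra_simps(5))

lemma cls_one: "\<one>\<^bsub>A\<^esub> = cls \<one>\<^bsub>PA\<^esub>"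
  by (simp add: quotient_algebra_simps)

lemma cls_eqI:
  assumes "x \<in> carrier PA" "i \<in> I" shows "cls (i + x) = cls x"
proof -
  have "i + x \<in> cls x" using assms(2) mem_cls_iff by blast
  then show ?thesis using a_repr_independence'[of "i + x" x] assms(1) by simp
qed

lemma cls_smult:
  assumes "x \<in> carrier PA" shows "c \<odot>\<^bsub>A\<^esub> cls x = cls (pm_scale c x)"
proof -
  have "cls (pm_scale c y) = cls (pm_scale c x)" if "y \<in> cls x" for y
  proof -
    obtain i where "i \<in> I" "y = i + x" using \<open>y \<in> cls x\<close> mem_cls_iff by blast
    then show ?thesis
      using cls_eqI[OF scale_in_carrier[OF assms] scale_in_I] by (simp add: pm.scale_right_distrib)
  qed
  then have "(\<Union>y\<in>cls x. cls (pm_scale c y)) = (\<Union>y\<in>cls x. cls (pm_scale c x))" by simp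
  also have "\<dots> = cls (pm_scale c x)" using self_mem_cls by blast
  finally show ?thesis by (simp add: quotient_algebra_simps path_algebra_simps)
qed

lemma module_variety_iff:
  "\<phi> \<in> module_variety A d \<longleftrightarrow> \<phi> \<in> extensional (carrier A) \<and>
    (\<forall>x\<in>carrier PA. \<phi> (cls x) \<in> carrier_mat d d) \<and>
    (\<forall>x\<in>carrier PA. \<forall>y\<in>carrier PA. \<phi> (cls (x \<otimes>\<^bsub>PA\<^esub> y)) = \<phi> (cls x) * \<phi> (cls y)) \<and>
    (\<forall>x\<in>carrier PA. \<forall>y\<in>carrier PA. \<phi> (cls (x + y)) = \<phi> (cls x) + \<phi> (cls y)) \<and>
    \<phi> (cls \<one>\<^bsub>PA\<^esub>) = 1\<^sub>m d \<and>
    (\<forall>c. \<forall>x\<in>carrier PA. \<phi> (cls (pm_scale c x)) = c \<cdot>\<^sub>m \<phi> (cls x))"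
proof -
  have "\<phi> \<in> ring_hom A (ring_mat TYPE('k) d ()) \<longleftrightarrow>
    (\<forall>x\<in>carrier PA. \<phi> (cls x) \<in> carrier_mat d d) \<and>
    (\<forall>x\<in>carrier PA. \<forall>y\<in>carrier PA. \<phi> (cls x \<otimes>\<^bsub>A\<^esub> cls y) = \<phi> (cls x) * \<phi> (cls y)) \<and>
    (\<forall>x\<in>carrier PA. \<forall>y\<in>carrier PA. \<phi> (cls x \<oplus>\<^bsub>A\<^esub> cls y) = \<phi> (cls x) + \<phi> (cls y)) \<and>
    \<phi> (cls \<one>\<^bsub>PA\<^esub>) = 1\<^sub>m d"
    unfolding ring_hom_def carrier_A ring_mat_carrier_mult_one_add cls_one by blast
  moreover have "(\<forall>c. \<forall>a\<in>carrier A. \<phi> (c \<odot>\<^bsub>A\<^esub> a) = c \<cdot>\<^sub>m \<phi> a) \<longleftrightarrow>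
    (\<forall>c. \<forall>x\<in>carrier PA. \<phi> (cls (pm_scale c x)) = c \<cdot>\<^sub>m \<phi> (cls x))"
    by (auto simp: carrier_A cls_smult)
  ultimately show ?thesis
    unfolding module_variety_def by (auto simp: cls_mult cls_add)
qed

lemma path_Cons:
  assumes "Walk (a # as) \<in> paths Q" "as \<noteq> []"
  shows "basis_elem (Walk (a # as)) = basis_elem (Walk [a]) \<otimes>\<^bsub>PA\<^esub> basis_elem (Walk as)"
    and "Walk [a] \<in> paths Q" "Walk as \<in> paths Q"
  using assms by (cases as; simp add: path_algebra_simps path_prod_def paths_Walk_iff)+

text \<open>Vertices and arrows generate the algebra.\<close>

lemma module_variety_eqI:
  assumes "\<phi> \<in> module_variety A d" "\<psi> \<in> module_variety A d"
    and verts: "\<And>u. u \<in> verts Q \<Longrightarrow> \<phi> (cls (basis_elem (Triv u))) = \<psi> (cls (basis_elem (Triv u)))"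
    and arcs: "\<And>\<eta>. \<eta> \<in> arcs Q \<Longrightarrow> \<phi> (cls (basis_elem (Walk [\<eta>]))) = \<psi> (cls (basis_elem (Walk [\<eta>])))"
  shows "\<phi> = \<psi>"
proof (rule extensionalityI[of _ "carrier A"])
  note \<phi> = assms(1)[unfolded module_variety_iff] and \<psi> = assms(2)[unfolded module_variety_iff]
  show "\<phi> \<in> extensional (carrier A)" "\<psi> \<in> extensional (carrier A)" using \<phi> \<psi> by auto
  have walk: "\<phi> (cls (basis_elem (Walk as))) = \<psi> (cls (basis_elem (Walk as)))"
    if "Walk as \<in> paths Q" for as
    using that
  proof (induction as)
    case (Cons a as)
    show ?case
    proof (cases "as = []")
      case True
      then show ?thesis using Cons.prems arcs by (simp add: paths_Walk_iff)
    next
      case False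
      note p = path_Cons[OF Cons.prems False]
      have "\<phi> (cls (basis_elem (Walk [a]))) = \<psi> (cls (basis_elem (Walk [a])))"
        using p(2) arcs by (simp add: paths_Walk_iff)
      then show ?thesis
        using \<phi> \<psi> basis_in_carrier[OF p(2)] basis_in_carrier[OF p(3)] Cons.IH[OF p(3)]
        unfolding p(1) by simp
    qed
  qed (simp add: paths_Walk_iff)
  have path: "\<phi> (cls (basis_elem p)) = \<psi> (cls (basis_elem p))" if "p \<in> paths Q" for p
    using that verts walk by (cases p) (auto simp: paths_Triv_iff)
  have sum: "(\<Sum>p\<in>S. pm_scale (c p) (basis_elem p)) \<in> carrier PA \<and>
      \<phi> (cls (\<Sum>p\<in>S. pm_scale (c p) (basis_elem p))) = \<psi> (cls (\<Sum>p\<in>S. pm_scale (c p) (basis_elem p)))"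
    if "finite S" "S \<subseteq> paths Q" for S and c :: "('v, 'a) walk \<Rightarrow> 'k"
    using that
  proof (induction S rule: finite_induct)
    case empty
    have "(0 :: ('v, 'a) walk \<Rightarrow>\<^sub>0 'k) \<in> carrier PA" by (simp add: carrier_PA_iff)
    moreover have "\<phi> (cls 0) = \<psi> (cls 0)"
    proof -
      have "\<phi> (cls (pm_scale 0 \<one>\<^bsub>PA\<^esub>)) = 0 \<cdot>\<^sub>m 1\<^sub>m d" "\<psi> (cls (pm_scale 0 \<one>\<^bsub>PA\<^esub>)) = 0 \<cdot>\<^sub>m 1\<^sub>m d"
        using \<phi> \<psi> one_closed by metis+
      then have "\<phi> (cls (pm_scale 0 \<one>\<^bsub>PA\<^esub>)) = \<psi> (cls (pm_scale 0 \<one>\<^bsub>PA\<^esub>))" by (simp only:)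
      then show ?thesis unfolding pm.scale_zero_left .
    qed
    ultimately show ?case by simp
  next
    case (insert p S)
    then have "pm_scale (c p) (basis_elem p) \<in> carrier PA"
      "\<phi> (cls (pm_scale (c p) (basis_elem p))) = \<psi> (cls (pm_scale (c p) (basis_elem p)))"
      using \<phi> \<psi> path[of p] basis_in_carrier[of p] scale_in_carrier by auto
    then show ?case using insert \<phi> \<psi> plus_in_carrier by simp
  qed
  fix X assume "X \<in> carrier A"
  then obtain x where x: "x \<in> carrier PA" "X = cls x" by (auto simp: carrier_A)
  have "x = (\<Sum>p\<in>Poly_Mapping.keys x. pm_scale (Poly_Mapping.lookup x p) (basis_elem p))"
    using pm_eq_linear_extension[of x] by (simp add: linear_extension_def)
  then show "\<phi> X = \<psi> X"
    using sum[of "Poly_Mapping.keys x" "Poly_Mapping.lookup x"] x by (simp add: carrier_PA_iff)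
qed

text \<open>
  The inverse matrix is a separate argument, since along a curve it is given by a formula with
  denominators.
\<close>

definition conj_point :: "'k mat \<Rightarrow> 'k mat \<Rightarrow> ((('v, 'a) walk \<Rightarrow>\<^sub>0 'k) set \<Rightarrow> 'k mat)
    \<Rightarrow> (('v, 'a) walk \<Rightarrow>\<^sub>0 'k) set \<Rightarrow> 'k mat" where
  "conj_point P P' \<phi> = restrict (\<lambda>a. P * \<phi> a * P') (carrier A)"

lemma conj_point_cls: "x \<in> carrier PA \<Longrightarrow> conj_point P P' \<phi> (cls x) = P * \<phi> (cls x) * P'"
  by (simp add: conj_point_def carrier_A)

lemma conj_point_in_module_variety:
  assumes "\<phi> \<in> module_variety A d" and P: "P \<in> carrier_mat d d" "P' \<in> carrier_mat d d"
    and PP: "P * P' = 1\<^sub>m d" "P' * P = 1\<^sub>m d"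
  shows "conj_point P P' \<phi> \<in> module_variety A d"
proof -
  note \<phi> = assms(1)[unfolded module_variety_iff]
  have mult: "P * (X * Y) * P' = (P * X * P') * (P * Y * P')"
    if [simp]: "X \<in> carrier_mat d d" "Y \<in> carrier_mat d d" for X Y
  proof -
    have "(P * X * P') * (P * Y * P') = (P * X * P') * (P * (Y * P'))"
      using P by (simp add: assoc_mult_mat[of P d d Y d P' d])
    also have "\<dots> = (P * X * P') * P * (Y * P')"
      by (rule assoc_mult_mat[symmetric, of _ d d _ d _ d]) (use P that in \<open>auto intro!: mult_carrier_mat\<close>)
    also have "\<dots> = P * X * (P' * P) * (Y * P')"
      using P by (simp add: assoc_mult_mat[of "P * X" d d P' d P d])
    also have "\<dots> = P * X * (Y * P')"
      unfolding PP using P by (simp add: right_mult_one_mat[of "P * X" d d])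
    also have "\<dots> = (P * X) * Y * P'"
      by (rule assoc_mult_mat[symmetric, of _ d d _ d _ d]) (use P that in \<open>auto intro!: mult_carrier_mat\<close>)
    also have "(P * X) * Y = P * (X * Y)"
      by (rule assoc_mult_mat[of _ d d _ d _ d]) (use P that in auto)
    finally show ?thesis ..
  qed
  have add: "P * (X + Y) * P' = P * X * P' + P * Y * P'"
    if [simp]: "X \<in> carrier_mat d d" "Y \<in> carrier_mat d d" for X Y
    using P by (simp add: mult_add_distrib_mat[of _ d d _ d] add_mult_distrib_mat[of _ d d _ _ d])
  have smult: "P * (c \<cdot>\<^sub>m X) * P' = c \<cdot>\<^sub>m (P * X * P')"
    if [simp]: "X \<in> carrier_mat d d" for X c
    using P by (simp add: mult_smult_distrib[of _ d d _ d] mult_smult_assoc_mat[of _ d d _ d])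
  show ?thesis
    unfolding module_variety_iff
    using \<phi> P by (auto simp: conj_point_cls plus_in_carrier scale_in_carrier mult add smult PP)
      (auto simp: conj_point_def)
qed

end

subsection \<open>Points from representations of the quiver\<close>

definition op_mat :: "nat \<Rightarrow> ((int \<Rightarrow>\<^sub>0 'k::field) \<Rightarrow> (int \<Rightarrow>\<^sub>0 'k)) \<Rightarrow> 'k mat" where
  "op_mat d L = mat d d (\<lambda>(i, j). Poly_Mapping.lookup (L (basis_elem (int j))) (int i))"

definition vec_pm :: "nat \<Rightarrow> 'k::field vec \<Rightarrow> (int \<Rightarrow>\<^sub>0 'k)" where
  "vec_pm d x = (\<Sum>j<d. Poly_Mapping.single (int j) (x $ j))"

lemma op_mat_carrier [simp]: "op_mat d L \<in> carrier_mat d d"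
  by (simp add: op_mat_def)

lemma pm_linear_expansion_upt:
  assumes "pm_linear L" "Poly_Mapping.keys x \<subseteq> {0..<int d}"
  shows "L x = (\<Sum>k<d. pm_scale (Poly_Mapping.lookup x (int k)) (L (basis_elem (int k))))"
proof -
  have "L x = (\<Sum>i\<in>int ` {..<d}. pm_scale (Poly_Mapping.lookup x i) (L (basis_elem i)))"
    using assms(2) by (intro pm_linear_basis_expansion[OF assms(1)]) (auto simp: image_iff atLeast0LessThan[symmetric]
        image_int_atLeastLessThan)
  then show ?thesis by (simp add: sum.reindex)
qed

lemma op_mat_mult:
  assumes "pm_linear L" "\<And>j. j < d \<Longrightarrow> Poly_Mapping.keys (L' (basis_elem (int j))) \<subseteq> {0..<int d}"
  shows "op_mat d (\<lambda>v. L (L' v)) = op_mat d L * op_mat d L'"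
proof (rule eq_matI)
  fix i j assume "i < dim_row (op_mat d L * op_mat d L')" "j < dim_col (op_mat d L * op_mat d L')"
  then have [simp]: "i < d" "j < d" by (simp_all add: op_mat_def)
  show "op_mat d (\<lambda>v. L (L' v)) $$ (i, j) = (op_mat d L * op_mat d L') $$ (i, j)"
    using pm_linear_expansion_upt[OF assms(1) assms(2)[of j]]
    by (simp add: op_mat_def scalar_prod_def lookup_sum atLeast0LessThan mult.commute)
qed (simp_all add: op_mat_def)

lemma lookup_vec_pm: "i < d \<Longrightarrow> Poly_Mapping.lookup (vec_pm d x) (int i) = x $ i"
  by (simp add: vec_pm_def lookup_sum lookup_single when_def)

lemma keys_vec_pm: "Poly_Mapping.keys (vec_pm d x) \<subseteq> {0..<int d}"
proof -
  have "Poly_Mapping.keys (vec_pm d x) \<subseteq> (\<Union>j\<in>{..<d}. Poly_Mapping.keys (Poly_Mapping.single (int j) (x $ j)))"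
    unfolding vec_pm_def by (rule keys_sum)
  then show ?thesis by (fastforce split: if_splits)
qed

lemma op_mat_mult_vec:
  assumes "pm_linear L" "x \<in> carrier_vec d" "i < d"
  shows "(op_mat d L *\<^sub>v x) $ i = Poly_Mapping.lookup (L (vec_pm d x)) (int i)"
  using pm_linear_expansion_upt[OF assms(1) keys_vec_pm, of d x] assms(2,3)
  by (simp add: op_mat_def scalar_prod_def lookup_sum atLeast0LessThan mult.commute lookup_vec_pm)

text \<open>
  The conditions under which the matrices of the operators form a point of \<open>mod(kQ/I, d)\<close>. The index
  type is the one of \<open>M(b)\<close>, and the \<open>d\<close>-dimensional space is spanned by the basis vectors
  \<open>0, \<dots>, d - 1\<close>.
\<close>

locale bound_rep = path_ideal Q I + quiver_rep Q U R
  for Q :: "('v, 'a) pre_digraph" and I :: "(('v, 'a) walk \<Rightarrow>\<^sub>0 'k::field) set"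
    and U :: "'v \<Rightarrow> (int \<Rightarrow>\<^sub>0 'k) \<Rightarrow> (int \<Rightarrow>\<^sub>0 'k)" and R +
  fixes d :: nat
  assumes keys_U: "Poly_Mapping.keys (U u v) \<subseteq> {0..<int d}"
    and keys_R: "Poly_Mapping.keys (R \<eta> v) \<subseteq> {0..<int d}"
    and sum_U: "i < d \<Longrightarrow> (\<Sum>u\<in>verts Q. U u (basis_elem (int i))) = basis_elem (int i)"
    and act_I: "x \<in> I \<Longrightarrow> alg_act U R x v = 0"
begin

text \<open>All representatives of a coset have the same matrix, because \<open>I\<close> acts by zero.\<close>

definition rep_point :: "(('v, 'a) walk \<Rightarrow>\<^sub>0 'k) set \<Rightarrow> 'k mat" where
  "rep_point = restrict (\<lambda>X. op_mat d (alg_act U R (SOME x. x \<in> X))) (carrier A)"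

lemma rep_point_cls:
  assumes "x \<in> carrier PA" shows "rep_point (cls x) = op_mat d (alg_act U R x)"
proof -
  have "(SOME y. y \<in> cls x) \<in> cls x" using self_mem_cls by (rule someI)
  then obtain i where "i \<in> I" "(SOME y. y \<in> cls x) = i + x" using mem_cls_iff by blast
  then have "alg_act U R (SOME y. y \<in> cls x) = alg_act U R x"
    by (simp add: alg_act_add act_I fun_eq_iff)
  then show ?thesis using assms by (simp add: rep_point_def carrier_A)
qed

lemma keys_walk_act:
  assumes "p \<in> paths Q" shows "Poly_Mapping.keys (walk_act U R p v) \<subseteq> {0..<int d}"
proof (cases p)
  case (Walk as)
  then obtain a bs where "as = a # bs" using assms by (cases as) (auto simp: paths_Walk_iff)
  then show ?thesis using Walk keys_R by simp
qed (simp add: keys_U)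

lemma keys_alg_act:
  assumes "x \<in> carrier PA" shows "Poly_Mapping.keys (alg_act U R x v) \<subseteq> {0..<int d}"
proof -
  have "Poly_Mapping.keys (pm_scale c w) \<subseteq> Poly_Mapping.keys w" for c and w :: "int \<Rightarrow>\<^sub>0 'k"
    by (auto simp: in_keys_iff)
  moreover have "Poly_Mapping.keys (walk_act U R p v) \<subseteq> {0..<int d}" if "p \<in> Poly_Mapping.keys x" for p
    using keys_walk_act that assms by (auto simp: carrier_PA_iff)
  ultimately show ?thesis
    unfolding alg_act_def linear_extension_def
    by (intro order.trans[OF keys_sum] UN_least) blast
qed

lemma rep_point_in_module_variety: "rep_point \<in> module_variety A d"
proof -
  have one: "op_mat d (alg_act U R \<one>\<^bsub>PA\<^esub>) = 1\<^sub>m d"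
  proof (rule eq_matI)
    fix i j assume "i < dim_row (1\<^sub>m d :: 'k mat)" "j < dim_col (1\<^sub>m d :: 'k mat)"
    then have ij: "i < d" "j < d" by auto
    have "alg_act U R \<one>\<^bsub>PA\<^esub> (basis_elem (int j)) = (\<Sum>u\<in>verts Q. U u (basis_elem (int j)))"
      unfolding path_algebra_simps pm_linear_sum[OF linear_alg_act_left]
      by (simp add: alg_act_basis)
    then show "op_mat d (alg_act U R \<one>\<^bsub>PA\<^esub>) $$ (i, j) = (1\<^sub>m d :: 'k mat) $$ (i, j)"
      using ij sum_U[of j] by (simp add: op_mat_def lookup_single when_def)
  qed (simp_all add: op_mat_def)
  have mult: "op_mat d (alg_act U R (x \<otimes>\<^bsub>PA\<^esub> y)) = op_mat d (alg_act U R x) * op_mat d (alg_act U R y)"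
    if "x \<in> carrier PA" "y \<in> carrier PA" for x y
    unfolding op_mat_mult[OF linear_alg_act keys_alg_act[OF that(2)], symmetric]
    by (simp add: op_mat_def alg_act_mult[OF that])
  show ?thesis
    unfolding module_variety_iff
    by (auto simp: rep_point_cls plus_in_carrier scale_in_carrier one mult)
      (auto simp: rep_point_def op_mat_def alg_act_add alg_act_scale lookup_add)
qed

end

section \<open>Walks along quasi-bands\<close>

lemma quasi_band_string:
  assumes "quasi_band Q I b m" "i \<le> j"
  shows "is_string Q I (Walk (map b [i..j]))"
proof -
  have "is_string Q I (Walk (map b [i..i + int (nat (j - i))]))"
    using assms(1) unfolding quasi_band_def by blast
  then show ?thesis using assms(2) by simp
qed

lemma quasi_band_step:
  assumes "quasi_band Q I b m"
  shows "letter_source Q (b (i - 1)) = letter_target Q (b i)" "b (i - 1) \<noteq> letter_inv (b i)"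
proof -
  have "[i - 1..i] = [i - 1, i]" by (simp add: upto_rec1)
  then have "is_string Q I (Walk [b (i - 1), b i])"
    using quasi_band_string[OF assms, of "i - 1" i] by simp
  then show "letter_source Q (b (i - 1)) = letter_target Q (b i)" "b (i - 1) \<noteq> letter_inv (b i)"
    by (simp_all add: is_string_def)
qed

lemma quasi_band_letter:
  assumes "quasi_band Q I b m"
  shows "b i \<in> Dir ` arcs Q \<union> Inv ` arcs Q"
  using quasi_band_string[OF assms, of i i] by (simp add: is_string_def)

lemma quasi_band_not_inverse:
  assumes "quasi_band Q I b m"
  shows "b i = Dir \<eta> \<Longrightarrow> b (i + 1) \<noteq> Inv \<eta>" "b i = Inv \<eta> \<Longrightarrow> b (i + 1) \<noteq> Dir \<eta>"
  using quasi_band_step(2)[OF assms, of "i + 1"] by auto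

lemma quasi_band_period:
  assumes "quasi_band Q I b m" shows "b (i + k * int m) = b i"
proof -
  have step: "b (j + int m) = b j" for j using assms by (simp add: quasi_band_def)
  show ?thesis
  proof (induction k rule: int_induct[where k = 0])
    case (step1 k)
    then show ?case using step[of "i + k * int m"] by (simp add: algebra_simps)
  next
    case (step2 k)
    then show ?case using step[of "i + (k - 1) * int m"] by (simp add: algebra_simps)
  qed simp
qed

lemma quasi_band_mod: "quasi_band Q I b m \<Longrightarrow> b (i mod int m) = b i"
  using quasi_band_period[of Q I b m "i mod int m" "i div int m"] by simp

lemma quasi_band_pos: "quasi_band Q I b m \<Longrightarrow> 0 < int m"
  by (simp add: quasi_band_def)

lemma letter_inv_inv [simp]: "letter_inv (letter_inv x) = x"
  by (cases x) auto

lemma letter_inv_eq_iff [simp]: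
  "letter_inv x = Dir \<eta> \<longleftrightarrow> x = Inv \<eta>" "letter_inv x = Inv \<eta> \<longleftrightarrow> x = Dir \<eta>"
  by (cases x; auto)+

lemma letter_inv_source_target [simp]:
  "letter_source Q (letter_inv x) = letter_target Q x" "letter_target Q (letter_inv x) = letter_source Q x"
  by (cases x; auto)+

text \<open>
  A sequence of vectors on which the arrows act as they act on the basis of \<open>M(b)\<close>. The zero vector
  is a parameter because vectors of different types occur.
\<close>

definition band_walk :: "('v, 'a) pre_digraph \<Rightarrow> (int \<Rightarrow> 'a letter) \<Rightarrow> ('v \<Rightarrow> 'w \<Rightarrow> 'w) \<Rightarrow> ('a \<Rightarrow> 'w \<Rightarrow> 'w)
    \<Rightarrow> 'w \<Rightarrow> (int \<Rightarrow> 'w) \<Rightarrow> bool" where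
  "band_walk Q b U R nil v \<longleftrightarrow>
    (\<forall>i. \<forall>u\<in>verts Q. U u (v i) = (if u = letter_source Q (b i) then v i else nil)) \<and>
    (\<forall>i. \<forall>\<eta>\<in>arcs Q. R \<eta> (v i)
      = (if b i = Dir \<eta> then v (i - 1) else if b (i + 1) = Inv \<eta> then v (i + 1) else nil))"

lemma band_walk_shift:
  assumes "band_walk Q b U R nil v" "\<And>j. b j = b' (k + j)"
  shows "band_walk Q b' U R nil (\<lambda>j. v (j - k))"
proof -
  have b': "b' j = b (j - k)" for j using assms(2)[of "j - k"] by simp
  show ?thesis
    using assms(1) unfolding band_walk_def b' by (simp add: algebra_simps)
qed

text \<open>
  The letter \<open>b(i)\<close> stands between the positions \<open>i - 1\<close> and \<open>i\<close>. Reading backwards, position \<open>i\<close>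
  therefore becomes \<open>k - i - 1\<close> when letter \<open>i\<close> becomes \<open>k - i\<close>.
\<close>

lemma band_walk_reverse:
  assumes qb: "quasi_band Q I b m" and v: "band_walk Q b U R nil v" "\<And>j. b j = letter_inv (b' (k - j))"
  shows "band_walk Q b' U R nil (\<lambda>j. v (k - j - 1))"
proof -
  have b': "b' j = letter_inv (b (k - j))" for j using v(2)[of "k - j"] by simp
  have src: "letter_source Q (b' j) = letter_source Q (b (k - j - 1))" for j
    using quasi_band_step(1)[OF qb, of "k - j"] by (simp add: b')
  have "R \<eta> (v (k - i - 1)) = (if b' i = Dir \<eta> then v (k - (i - 1) - 1)
      else if b' (i + 1) = Inv \<eta> then v (k - (i + 1) - 1) else nil)" if "\<eta> \<in> arcs Q" for i \<eta>
    using v(1) that quasi_band_not_inverse[OF qb, of "k - i - 1" \<eta>]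
    unfolding band_walk_def b' by (simp add: algebra_simps)
  then show ?thesis
    using v(1) unfolding band_walk_def src by blast
qed

text \<open>A path follows a walk as long as its arrows spell the letters, all in one direction.\<close>

lemma band_walk_foldr:
  assumes v: "band_walk Q b U R nil v"
    and nil: "\<And>\<eta>. \<eta> \<in> arcs Q \<Longrightarrow> R \<eta> nil = nil"
    and "as \<noteq> []" "set as \<subseteq> arcs Q"
  shows "foldr R as (v i) = nil \<or>
    (map b [i - int (length as) + 1..i] = map Dir as \<and> foldr R as (v i) = v (i - int (length as))) \<or>
    (map b [i + 1..i + int (length as)] = rev (map Inv as) \<and> foldr R as (v i) = v (i + int (length as)))"
  using assms(3,4)
proof (induction as)
  case (Cons a as)
  have R: "R a (v j) = (if b j = Dir a then v (j - 1) else if b (j + 1) = Inv a then v (j + 1) else nil)" for j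
    using v Cons.prems unfolding band_walk_def by simp
  show ?case
  proof (cases "as = []")
    case True
    then show ?thesis by (simp add: R)
  next
    case False
    let ?l = "int (length as)"
    have l: "?l \<ge> 1" using False by (cases as) auto
    consider (nil) "foldr R as (v i) = nil"
      | (dir) "map b [i - ?l + 1..i] = map Dir as" "foldr R as (v i) = v (i - ?l)"
      | (inv) "map b [i + 1..i + ?l] = rev (map Inv as)" "foldr R as (v i) = v (i + ?l)"
      using Cons False by auto
    then show ?thesis
    proof cases
      case nil
      then show ?thesis using assms(2) Cons.prems by simp
    next
      case dir
      have "[i - ?l + 1..i] = (i - ?l + 1) # [i - ?l + 2..i]"
        using l upto_rec1[of "i - ?l + 1" i] by (simp add: algebra_simps)
      then have "b (i - ?l + 1) = Dir (hd as)" using dir(1) False by (cases as) auto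
      moreover have "[i - (?l + 1) + 1..i] = (i - ?l) # [i - ?l + 1..i]" using l by (simp add: upto_rec1)
      ultimately show ?thesis using dir R[of "i - ?l"] by (auto simp: algebra_simps)
    next
      case inv
      have "[i + 1..i + ?l] = [i + 1..i + ?l - 1] @ [i + ?l]" using l by (simp add: upto_rec2)
      then have "b (i + ?l) = Inv (hd as)" using inv(1) False by (cases as) auto
      moreover have "[i + 1..i + (?l + 1)] = [i + 1..i + ?l] @ [i + ?l + 1]" using l
        using upto_rec2[of "i + 1" "i + (?l + 1)"] by (simp add: algebra_simps)
      ultimately show ?thesis using inv R[of "i + ?l"] by (auto simp: algebra_simps)
    qed
  qed
qed simp

text \<open>
  A non-zero path spells a subword of a string and is not in \<open>I\<close>. For a trivial path \<open>1\<^sub>u\<close> the reason is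
  that an ideal containing it contains all arrows at \<open>u\<close>.
\<close>

lemma (in path_ideal) band_walk_killed:
  assumes qb: "quasi_band Q I b m" and v: "band_walk Q b U R nil v"
    and nil: "\<And>\<eta>. \<eta> \<in> arcs Q \<Longrightarrow> R \<eta> nil = nil"
    and p: "p \<in> paths Q" "basis_elem p \<in> I"
  shows "walk_act U R p (v i) = nil"
proof (cases p)
  case (Triv u)
  have u: "u \<in> verts Q" using p Triv by (simp add: paths_Triv_iff)
  have "u \<noteq> letter_source Q (b i)"
  proof
    assume src: "u = letter_source Q (b i)"
    obtain \<eta> where \<eta>: "\<eta> \<in> arcs Q" "b i = Dir \<eta> \<or> b i = Inv \<eta>"
      using quasi_band_letter[OF qb, of i] by auto
    have path: "Walk [\<eta>] \<in> paths Q" using \<eta> by (simp add: paths_Walk_iff)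
    have "basis_elem (Walk [\<eta>]) \<in> I"
    proof (cases "b i = Dir \<eta>")
      case True
      then have "basis_elem (Walk [\<eta>]) \<otimes>\<^bsub>PA\<^esub> basis_elem (Triv u) = basis_elem (Walk [\<eta>])"
        using src by (simp add: path_algebra_simps path_prod_def)
      then show ?thesis using I_l_closed[OF p(2)[unfolded Triv] basis_in_carrier[OF path]] by simp
    next
      case False
      then have "basis_elem (Triv u) \<otimes>\<^bsub>PA\<^esub> basis_elem (Walk [\<eta>]) = basis_elem (Walk [\<eta>])"
        using src \<eta> by (simp add: path_algebra_simps path_prod_def)
      then show ?thesis using I_r_closed[OF p(2)[unfolded Triv] basis_in_carrier[OF path]] by simp
    qed
    moreover have "is_string Q I (Walk [b i])" using quasi_band_string[OF qb, of i i] by simp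
    ultimately show False using \<eta>(2) unfolding is_string_def
      by (auto simp: word_inv_def dest!: spec[of _ "[b i]"] spec[of _ "[\<eta>]"])
  qed
  then show ?thesis using v u Triv by (simp add: band_walk_def)
next
  case (Walk as)
  have as: "as \<noteq> []" "set as \<subseteq> arcs Q" using p Walk by (simp_all add: paths_Walk_iff)
  have not_I: "basis_elem (Walk as) \<notin> I"
    if "map b [j..k] = map Dir as \<or> word_inv (map b [j..k]) = map Dir as" for j k
  proof -
    have "j \<le> k"
    proof (rule ccontr)
      assume "\<not> j \<le> k"
      then show False using that as by (auto simp: word_inv_def)
    qed
    then show ?thesis
      using quasi_band_string[OF qb \<open>j \<le> k\<close>] that unfolding is_string_def by fastforce
  qed
  have "map b [i + 1..i + int (length as)] = rev (map Inv as) \<Longrightarrow>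
      word_inv (map b [i + 1..i + int (length as)]) = map Dir as"
    by (simp add: word_inv_def rev_map[symmetric])
  then show ?thesis
    using band_walk_foldr[OF v nil as, of i] not_I[of "i - int (length as) + 1" i]
      not_I[of "i + 1" "i + int (length as)"] p(2) Walk by auto
qed

lemma letter_range [simp]: "Inv \<eta> \<notin> range Dir" "Dir \<eta> \<notin> range Inv"
  by auto

lemma divmod_block:
  fixes r m q :: int assumes "0 \<le> r" "r < m"
  shows "(q * m + r) mod m = r" "(q * m + r) div m = q"
  using assms by simp_all

section \<open>Bending a band at two vertices\<close>

text \<open>
  The \<open>m\<close>-dimensional representations \<open>N(z, s)\<close>. The edge \<open>k\<close> of the cyclic word \<open>b\<close> joins the basis
  vectors \<open>k - 1\<close> and \<open>k\<close> and contributes a rank one operator, mapping \<open>x\<close> to \<open>S(x) T\<close> with a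
  functional \<open>S\<close> and a vector \<open>T\<close>. At \<open>s = 0\<close> this is the band module with parameter \<open>z\<^sup>-\<^sup>1\<close>. For general
  \<open>s\<close>, the edge \<open>m\<close>, which enters the basis vector \<open>0\<close>, also enters the basis vector \<open>f\<close>, and
  the edge \<open>\<kappa>\<close>, which leaves \<open>f\<close>, also leaves \<open>0\<close>.
\<close>

locale bend = path_ideal Q I
  for Q :: "('v, 'a) pre_digraph" and I :: "(('v, 'a) walk \<Rightarrow>\<^sub>0 'k::field) set" +
  fixes b :: "int \<Rightarrow> 'a letter" and m :: nat and f \<kappa> :: int
  assumes qb: "quasi_band Q I b m"
    and fin: "fin_digraph Q"
    and gen: "\<exists>P \<subseteq> paths Q. I = genideal (path_algebra Q) (basis_elem ` P)"
    and f_bounds: "0 < f" "f < int m"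
    and b_m: "b (int m) \<in> range Inv"
    and \<kappa>_cases: "(\<kappa> = f \<and> b \<kappa> \<in> range Dir) \<or> (\<kappa> = f + 1 \<and> b \<kappa> \<in> range Inv)"
    and source_f: "letter_source Q (b f) = letter_source Q (b 0)"
begin

definition src :: "int \<Rightarrow> int" where
  "src k = (if b k \<in> range Dir then k else k - 1)"

definition S :: "'k \<Rightarrow> int \<Rightarrow> (int \<Rightarrow>\<^sub>0 'k) \<Rightarrow> 'k" where
  "S s k x = Poly_Mapping.lookup x (src k) - (if k = \<kappa> then s * Poly_Mapping.lookup x 0 else 0)"

definition T :: "'k \<Rightarrow> 'k \<Rightarrow> int \<Rightarrow> (int \<Rightarrow>\<^sub>0 'k)" where
  "T z s k = (if b k \<in> range Dir then basis_elem (k - 1)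
     else if k = int m then Poly_Mapping.single 0 z + Poly_Mapping.single f (z * s)
     else basis_elem k)"

definition R :: "'k \<Rightarrow> 'k \<Rightarrow> 'a \<Rightarrow> (int \<Rightarrow>\<^sub>0 'k) \<Rightarrow> (int \<Rightarrow>\<^sub>0 'k)" where
  "R z s \<eta> x = (\<Sum>k = 1..int m. if b k = Dir \<eta> \<or> b k = Inv \<eta> then pm_scale (S s k x) (T z s k) else 0)"

definition U :: "'v \<Rightarrow> (int \<Rightarrow>\<^sub>0 'k) \<Rightarrow> (int \<Rightarrow>\<^sub>0 'k)" where
  "U u = linear_extension
     (\<lambda>i. if 0 \<le> i \<and> i < int m \<and> u = letter_source Q (b i) then basis_elem i else 0)"

lemma b_0: "b 0 = b (int m)"
  using quasi_band_period[OF qb, of 0 1] by simp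

lemma b_not_Dir: "b 0 \<noteq> Dir \<eta>" "b (int m) \<noteq> Dir \<eta>"
  using b_m b_0 by auto

lemma m_pos: "0 < int m" using f_bounds by simp

lemma lookup_U: "Poly_Mapping.lookup (U u x) i =
    (if 0 \<le> i \<and> i < int m \<and> u = letter_source Q (b i) then Poly_Mapping.lookup x i else 0)"
proof -
  let ?P = "\<lambda>j. 0 \<le> j \<and> j < int m \<and> u = letter_source Q (b j)"
  have "Poly_Mapping.lookup (U u x) i = (\<Sum>j\<in>Poly_Mapping.keys x.
      Poly_Mapping.lookup x j * Poly_Mapping.lookup (if ?P j then basis_elem j else 0) i)"
    unfolding U_def linear_extension_def lookup_sum lookup_pm_scale ..
  also have "\<dots> = (\<Sum>j\<in>Poly_Mapping.keys x. if j = i then (if ?P i then Poly_Mapping.lookup x i else 0) else 0)"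
  proof (rule sum.cong[OF refl])
    fix j
    show "Poly_Mapping.lookup x j * Poly_Mapping.lookup (if ?P j then basis_elem j else 0) i
        = (if j = i then (if ?P i then Poly_Mapping.lookup x i else 0) else 0)"
      by (cases "?P j"; cases "j = i") (simp_all only: if_True if_False simp_thms lookup_zero mult_zero_right
          lookup_single when_def mult_1_right)
  qed
  also have "\<dots> = (if ?P i then Poly_Mapping.lookup x i else 0)"
    by (simp add: in_keys_iff)
  finally show ?thesis .
qed

lemma S_add: "S s k (x + y) = S s k x + S s k y"
  by (simp add: S_def lookup_add algebra_simps)

lemma S_scale: "S s k (pm_scale c x) = c * S s k x"
  by (simp add: S_def algebra_simps)

lemma R_linear: "pm_linear (R z s \<eta>)"
proof (rule pm_linearI)
  show "R z s \<eta> (x + y) = R z s \<eta> x + R z s \<eta> y" for x y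
    unfolding R_def sum.distrib[symmetric]
    by (rule sum.cong) (simp_all add: S_add pm.scale_left_distrib)
  show "R z s \<eta> (pm_scale c x) = pm_scale c (R z s \<eta> x)" for c x
    unfolding R_def pm.scale_sum_right by (rule sum.cong) (simp_all add: S_scale)
qed

lemma src_bounds: "1 \<le> k \<Longrightarrow> k \<le> int m \<Longrightarrow> 0 \<le> src k \<and> src k < int m"
  using b_m unfolding src_def by (cases "k = int m") auto

lemma src_source:
  assumes "b k = Dir \<eta> \<or> b k = Inv \<eta>" shows "letter_source Q (b (src k)) = tail Q \<eta>"
  using assms quasi_band_step(1)[OF qb, of k] by (auto simp: src_def)

lemma src_\<kappa>: "src \<kappa> = f"
  using \<kappa>_cases by (auto simp: src_def)

lemma quiver_rep_N: "quiver_rep Q U (R z s)"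
proof (rule quiver_rep.intro)
  show "pm_linear (U u)" for u unfolding U_def by (rule pm_linear_linear_extension)
  show "pm_linear (R z s \<eta>)" for \<eta> by (rule R_linear)
  show "U u (U u' v) = (if u = u' then U u v else 0)" for u u' v
    by (rule poly_mapping_eqI) (auto simp: lookup_U)
  show "R z s \<eta> (U u v) = (if u = tail Q \<eta> then R z s \<eta> v else 0)" for \<eta> u v
  proof -
    have "S s k (U u v) = (if u = tail Q \<eta> then S s k v else 0)"
      if "1 \<le> k" "k \<le> int m" "b k = Dir \<eta> \<or> b k = Inv \<eta>" for k
      using src_bounds[OF that(1,2)] src_source[OF that(3)] source_f src_\<kappa> m_pos
      by (auto simp: S_def lookup_U)
    then show ?thesis unfolding R_def by (auto intro!: sum.cong sum.neutral)
  qed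
  show "U u (R z s \<eta> v) = (if u = head Q \<eta> then R z s \<eta> v else 0)" for u \<eta> v
  proof -
    have U_lin: "pm_linear (U w)" for w unfolding U_def by (rule pm_linear_linear_extension)
    have "U u (T z s k) = (if u = head Q \<eta> then T z s k else 0)"
      if k: "1 \<le> k" "k \<le> int m" "b k = Dir \<eta> \<or> b k = Inv \<eta>" for k
    proof (cases "b k = Dir \<eta>")
      case True
      then show ?thesis using k quasi_band_step(1)[OF qb, of k]
        by (intro poly_mapping_eqI) (auto simp: T_def lookup_U lookup_single when_def)
    next
      case False
      then have "letter_source Q (b k) = head Q \<eta>" "b k \<notin> range Dir" using k by auto
      then show ?thesis using k source_f b_0 m_pos f_bounds
        by (intro poly_mapping_eqI) (auto simp: T_def lookup_U lookup_add lookup_single when_def)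
    qed
    then show ?thesis
      unfolding R_def pm_linear_sum[OF U_lin]
      by (auto intro!: sum.cong sum.neutral simp: pm_linear_scale[OF U_lin] pm_linear_0[OF U_lin])
  qed
qed

text \<open>
  The columns of the matrices of \<open>N(z, s)\<close>. The rows in \<open>lookup_R\<close> below serve to compute coordinates of
  homomorphisms.
\<close>

lemma R_basis:
  assumes "0 \<le> i" "i < int m"
  shows "R z s \<eta> (basis_elem i) =
    (if b i = Dir \<eta> then basis_elem (i - 1) else if b (i + 1) = Inv \<eta> then T z s (i + 1) else 0)
    - (if i = 0 \<and> (b \<kappa> = Dir \<eta> \<or> b \<kappa> = Inv \<eta>) then pm_scale s (T z s \<kappa>) else 0)"
proof -
  let ?a = "\<lambda>k. b k = Dir \<eta> \<or> b k = Inv \<eta>"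
  have i_pos: "1 \<le> i" if "b i = Dir \<eta>" using that assms b_not_Dir(1) by (cases "i = 0") auto
  have "R z s \<eta> (basis_elem i) = (\<Sum>k = 1..int m.
      (if k = i then (if b i = Dir \<eta> then T z s i else 0) else 0)
      + (if k = i + 1 then (if b (i + 1) = Inv \<eta> then T z s (i + 1) else 0) else 0)
      - (if k = \<kappa> then (if i = 0 \<and> ?a \<kappa> then pm_scale s (T z s \<kappa>) else 0) else 0))"
    unfolding R_def
    by (intro sum.cong) (auto simp: S_def src_def lookup_single when_def pm.scale_left_diff_distrib)
  also have "\<dots> = (if b i = Dir \<eta> then T z s i else 0)
      + (if b (i + 1) = Inv \<eta> then T z s (i + 1) else 0)
      - (if i = 0 \<and> ?a \<kappa> then pm_scale s (T z s \<kappa>) else 0)"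
    using assms \<kappa>_cases f_bounds i_pos
    by (auto simp: sum.distrib sum_subtractf sum.delta)
  finally show ?thesis
    using quasi_band_not_inverse(1)[OF qb, of i \<eta>] by (auto simp: T_def)
qed

lemma lookup_R:
  assumes "0 \<le> i" "i < int m"
  shows "Poly_Mapping.lookup (R z s \<eta> x) i =
    (if b (i + 1) = Dir \<eta> then S s (i + 1) x else 0)
    + (if b i = Inv \<eta> then if i = 0 then z * S s (int m) x else S s i x else 0)
    + (if i = f \<and> b 0 = Inv \<eta> then z * s * S s (int m) x else 0)"
proof -
  have "Poly_Mapping.lookup (R z s \<eta> x) i = (\<Sum>k = 1..int m.
      (if k = i + 1 then (if b (i + 1) = Dir \<eta> then S s (i + 1) x else 0) else 0)
      + (if k = i then (if b i = Inv \<eta> then S s i x else 0) else 0)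
      + (if k = int m then (if b 0 = Inv \<eta> then (if i = 0 then z * S s (int m) x else 0)
          + (if i = f then z * s * S s (int m) x else 0) else 0) else 0))"
    unfolding R_def lookup_sum
    using assms b_not_Dir b_0 f_bounds
    by (intro sum.cong) (auto simp: T_def lookup_single lookup_add when_def)
  also have "\<dots> = (if b (i + 1) = Dir \<eta> then S s (i + 1) x else 0)
      + (if i = 0 then 0 else if b i = Inv \<eta> then S s i x else 0)
      + (if b 0 = Inv \<eta> then (if i = 0 then z * S s (int m) x else 0)
          + (if i = f then z * s * S s (int m) x else 0) else 0)"
    using assms m_pos by (auto simp: sum.distrib sum.delta)
  finally show ?thesis using f_bounds by auto
qed

lemma U_keys: "Poly_Mapping.keys (U u x) \<subseteq> {0..<int m}"
  by (auto simp: in_keys_iff lookup_U split: if_splits)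

lemma R_keys: "Poly_Mapping.keys (R z s \<eta> x) \<subseteq> {0..<int m}"
proof -
  have "Poly_Mapping.lookup (T z s k) i = 0" if "1 \<le> k" "k \<le> int m" "i \<notin> {0..<int m}" for k i
    using that f_bounds by (auto simp: T_def lookup_add lookup_single when_def)
  then have *: "Poly_Mapping.lookup (R z s \<eta> x) i = 0" if "i \<notin> {0..<int m}" for i
    using that unfolding R_def lookup_sum by (intro sum.neutral) auto
  show ?thesis
  proof
    fix i assume "i \<in> Poly_Mapping.keys (R z s \<eta> x)"
    then have "Poly_Mapping.lookup (R z s \<eta> x) i \<noteq> 0" by (simp add: in_keys_iff)
    then show "i \<in> {0..<int m}" using * by blast
  qed
qed

lemma R_outside:
  assumes "i \<notin> {0..<int m}" shows "R z s \<eta> (basis_elem i) = 0"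
  unfolding R_def
proof (rule sum.neutral, intro ballI)
  fix k assume "k \<in> {1..int m}"
  then have "0 \<le> src k \<and> src k < int m" using src_bounds by simp
  then have "src k \<noteq> i" "i \<noteq> 0" using assms m_pos by auto
  then have "S s k (basis_elem i) = 0" by (simp add: S_def lookup_single)
  then show "(if b k = Dir \<eta> \<or> b k = Inv \<eta> then pm_scale (S s k (basis_elem i)) (T z s k) else 0) = 0"
    by simp
qed

text \<open>Only the vanishing of \<open>I\<close> depends on the words that can be read off in \<open>N(z, s)\<close>.\<close>

lemma bound_rep_N:
  assumes kill: "\<And>p i. p \<in> paths Q \<Longrightarrow> basis_elem p \<in> I \<Longrightarrow> 0 \<le> i \<Longrightarrow> i < int m \<Longrightarrow>
    walk_act U (R z s) p (basis_elem i) = 0"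
  shows "bound_rep Q I U (R z s) m"
proof -
  interpret quiver_rep Q U "R z s" by (rule quiver_rep_N)
  interpret fin: fin_digraph Q by (rule fin)
  obtain P where P: "P \<subseteq> paths Q" "I = genideal PA (basis_elem ` P)" using gen by blast
  have "basis_elem ` P \<subseteq> carrier PA" using P basis_in_carrier by auto
  then have in_I: "basis_elem p \<in> I" if "p \<in> P" for p
    using genideal_self[of "basis_elem ` P"] P(2) that by auto
  have outside: "walk_act U (R z s) p (basis_elem i) = 0" if "p \<in> paths Q" "i \<notin> {0..<int m}" for p i
  proof (cases p)
    case (Triv u)
    then show ?thesis using that by (intro poly_mapping_eqI) (auto simp: lookup_U lookup_single when_def)
  next
    case (Walk as)
    then have "as = butlast as @ [last as]" using that by (simp add: paths_Walk_iff)
    then have "foldr (R z s) as (basis_elem i) = foldr (R z s) (butlast as) (R z s (last as) (basis_elem i))"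
      by (metis foldr_append foldr.simps comp_apply id_apply)
    then show ?thesis using Walk R_outside[OF that(2)] pm_linear_0[OF linear_foldr] by simp
  qed
  have kill': "walk_act U (R z s) p v = 0" if "p \<in> P" for p v
  proof -
    have "walk_act U (R z s) p (basis_elem i) = 0" for i
      using kill[of p i] outside[of p i] in_I[OF that] P(1) that by (cases "i \<in> {0..<int m}") auto
    then show ?thesis
      by (subst pm_linear_basis_expansion[OF linear_walk_act finite_keys order.refl]) simp
  qed
  show ?thesis
  proof
    show "Poly_Mapping.keys (U u v) \<subseteq> {0..<int m}" for u v by (rule U_keys)
    show "Poly_Mapping.keys (R z s \<eta> v) \<subseteq> {0..<int m}" for \<eta> v by (rule R_keys)
    show "alg_act U (R z s) x v = 0" if "x \<in> I" for x v
      using alg_act_genideal_eq_0[OF ring_axioms P(1) kill'] that P(2) by simp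
    fix i assume "i < m"
    have "letter_source Q (b (int i)) \<in> verts Q"
      using quasi_band_letter[OF qb, of "int i"] by (auto simp: fin.tail_in_verts fin.head_in_verts)
    moreover have "U u (basis_elem (int i))
        = (if u = letter_source Q (b (int i)) then basis_elem (int i) else 0)" for u
      using \<open>i < m\<close> by (simp add: U_def)
    ultimately show "(\<Sum>u\<in>verts Q. U u (basis_elem (int i))) = basis_elem (int i)"
      by simp
  qed
qed

text \<open>At \<open>s = 0\<close> the basis is one twisted period of a walk along \<open>b\<close>.\<close>

definition band_basis :: "'k \<Rightarrow> int \<Rightarrow> (int \<Rightarrow>\<^sub>0 'k)" where
  "band_basis z i = Poly_Mapping.single (i mod int m) (z powi (i div int m))"

lemma U_single:
  "U u (Poly_Mapping.single i c) = (if 0 \<le> i \<and> i < int m \<and> u = letter_source Q (b i) then Poly_Mapping.single i c else 0)"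
  by (simp add: U_def linear_extension_single pm_scale_single)

lemma band_walk_at_0:
  assumes "z \<noteq> 0" shows "band_walk Q b U (R z 0) 0 (band_basis z)"
  unfolding band_walk_def
proof (intro conjI allI ballI)
  fix i :: int
  define r q where "r = i mod int m" and "q = i div int m"
  have r: "0 \<le> r" "r < int m" using m_pos by (simp_all add: r_def)
  have i: "i = q * int m + r" by (simp add: r_def q_def)
  have b: "b i = b r" "b (i + 1) = b (r + 1)"
    using quasi_band_period[OF qb, of r q] quasi_band_period[OF qb, of "r + 1" q] by (simp_all add: i algebra_simps)
  have e_i: "band_basis z i = pm_scale (z powi q) (basis_elem r)"
    by (simp add: band_basis_def r_def q_def pm_scale_single)
  show "U u (band_basis z i) = (if u = letter_source Q (b i) then band_basis z i else 0)" for u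
    using r by (simp add: e_i b pm_scale_single U_single)
  fix \<eta>
  have "R z 0 \<eta> (band_basis z i) = pm_scale (z powi q)
      (if b r = Dir \<eta> then basis_elem (r - 1) else if b (r + 1) = Inv \<eta> then T z 0 (r + 1) else 0)"
    using R_basis[OF r, of z 0 \<eta>] by (simp add: e_i pm_linear_scale[OF R_linear])
  moreover have "band_basis z (i - 1) = pm_scale (z powi q) (basis_elem (r - 1))" if "b r = Dir \<eta>"
  proof -
    have "r \<noteq> 0" using that b_not_Dir by auto
    then have "(i - 1) mod int m = r - 1" "(i - 1) div int m = q"
      using r divmod_block[of "r - 1" "int m" q] by (simp_all add: i algebra_simps)
    then show ?thesis by (simp add: band_basis_def pm_scale_single)
  qed
  moreover have "band_basis z (i + 1) = pm_scale (z powi q) (T z 0 (r + 1))" if inv: "b (r + 1) = Inv \<eta>"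
  proof (cases "r + 1 = int m")
    case True
    then have "i + 1 = (q + 1) * int m" by (simp add: i algebra_simps)
    then show ?thesis using m_pos True assms inv
      by (simp add: band_basis_def T_def pm_scale_single power_int_add)
  next
    case False
    then have "(i + 1) mod int m = r + 1" "(i + 1) div int m = q"
      using r divmod_block[of "r + 1" "int m" q] by (simp_all add: i algebra_simps)
    then show ?thesis using False inv by (simp add: band_basis_def pm_scale_single T_def)
  qed
  ultimately show "R z 0 \<eta> (band_basis z i) = (if b i = Dir \<eta> then band_basis z (i - 1)
      else if b (i + 1) = Inv \<eta> then band_basis z (i + 1) else 0)"
    by (simp add: b)
qed

lemma bound_rep_at_0:
  assumes "z \<noteq> 0" shows "bound_rep Q I U (R z 0) m"
proof (rule bound_rep_N)
  fix p i assume *: "p \<in> paths Q" "basis_elem p \<in> I" "0 \<le> i" "i < int m"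
  have "walk_act U (R z 0) p (band_basis z i) = 0"
    by (rule band_walk_killed[OF qb band_walk_at_0[OF assms] pm_linear_0[OF R_linear] *(1,2)])
  then show "walk_act U (R z 0) p (basis_elem i) = 0"
    using * by (simp add: band_basis_def)
qed

end

section \<open>Walks in the bent representation\<close>

context bend
begin

text \<open>
  For \<open>s \<noteq> 0\<close>, adding \<open>s\<^sup>-\<^sup>1\<close> times the submodule copy \<open>E\<^sub>0, \<dots>, E\<^sub>n\<close> of \<open>w\<close> to the factor copy is a change of
  basis after which the exchanged words can be read off. The sequence \<open>F\<close> contains the factor copy
  and follows the exchanged word \<open>c\<close>, whose letters \<open>1, \<dots>, n\<close> are those of \<open>w\<close>. Both sequences obey the rules of \<open>c\<close> up to defects at the left end of \<open>w\<close>: the arrow leaving \<open>F\<^sub>0\<close>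
  also leaves \<open>E\<^sub>0\<close>, and the arrow entering \<open>F\<^sub>0\<close> also enters \<open>E\<^sub>0\<close>. At the right end there is no defect, since
  \<open>c(n + 1)\<close> is inverse and the word followed by \<open>E\<close> continues with a direct letter. Adding
  \<open>s\<^sup>-\<^sup>1 E\<^sub>i\<close> to \<open>F\<^sub>i\<close> cancels the defects. As \<open>w\<close> may be longer than the period \<open>L\<close> of \<open>c\<close>, one
  vector \<open>F\<^sub>j\<close> can belong to several positions of \<open>w\<close>; the sum \<open>G\<^sub>j\<close> runs over all \<open>i \<equiv> j\<close> modulo \<open>L\<close>, with
  the powers of \<open>\<mu>\<close> that compare \<open>F\<^sub>i\<close> with \<open>F\<^sub>j\<close>.
\<close>

lemma corrected_walk:
  fixes c :: "int \<Rightarrow> 'a letter" and E F :: "int \<Rightarrow> (int \<Rightarrow>\<^sub>0 'k)" and n :: int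
  assumes s: "s \<noteq> 0" and \<mu>: "\<mu> \<noteq> 0" and qc: "quasi_band Q I c L"
    and n: "0 \<le> n" and c_0: "c 0 = b 0" and c_n: "c (n + 1) \<in> range Inv"
    and E: "\<And>\<eta> j. \<eta> \<in> arcs Q \<Longrightarrow> 0 \<le> j \<Longrightarrow> j \<le> n \<Longrightarrow> R z s \<eta> (E j) =
      (if 1 \<le> j \<and> c j = Dir \<eta> then E (j - 1) else if j < n \<and> c (j + 1) = Inv \<eta> then E (j + 1) else 0)
      - (if j = 0 \<and> (b \<kappa> = Dir \<eta> \<or> b \<kappa> = Inv \<eta>) then pm_scale s (T z s \<kappa>) else 0)"
    and U_E: "\<And>u j. 0 \<le> j \<Longrightarrow> j \<le> n \<Longrightarrow> U u (E j) = (if u = letter_source Q (c j) then E j else 0)"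
    and F: "\<And>\<eta> j. \<eta> \<in> arcs Q \<Longrightarrow> 0 \<le> j \<Longrightarrow> j < int L \<Longrightarrow> R z s \<eta> (F j) =
      (if c j = Dir \<eta> then F (j - 1) else if c (j + 1) = Inv \<eta> then F (j + 1) else 0)
      + (if j = 0 \<and> (b \<kappa> = Dir \<eta> \<or> b \<kappa> = Inv \<eta>) then T z s \<kappa> else 0)
      + (if j = int L - 1 \<and> b 0 = Inv \<eta> then pm_scale (\<mu> * inverse s) (E 0) else 0)"
    and U_F: "\<And>u j. 0 \<le> j \<Longrightarrow> j < int L \<Longrightarrow> U u (F j) = (if u = letter_source Q (c j) then F j else 0)"
    and F_period: "\<And>j k. F (j + k * int L) = pm_scale (\<mu> powi k) (F j)"
  defines "G \<equiv> \<lambda>j. \<Sum>i = 0..n. pm_scale (if int L dvd i - j then \<mu> powi ((j - i) div int L) else 0) (E i)"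
  shows "band_walk Q c U (R z s) 0 (\<lambda>j. F j + pm_scale (inverse s) (G j))"
proof -
  let ?L = "int L"
  let ?arr = "\<lambda>\<eta>. b \<kappa> = Dir \<eta> \<or> b \<kappa> = Inv \<eta>"
  define \<chi> where "\<chi> = (\<lambda>j i. if ?L dvd i - j then \<mu> powi ((j - i) div ?L) else 0)"
  have G: "G j = (\<Sum>i = 0..n. pm_scale (\<chi> j i) (E i))" for j by (simp add: G_def \<chi>_def)
  have L: "0 < ?L" using quasi_band_pos[OF qc] .
  have \<chi>_shift: "\<chi> (j - 1) (i - 1) = \<chi> j i" "\<chi> (j + 1) (i + 1) = \<chi> j i" for j i by (simp_all add: \<chi>_def)
  have c_dvd: "c i = c j" if dv: "?L dvd i - j" for i j
  proof -
    obtain k where "i - j = ?L * k" using dv unfolding dvd_def by blast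
    then have "i = j + k * ?L" by (simp add: algebra_simps)
    then show ?thesis using quasi_band_period[OF qc] by simp
  qed
  have c_eq: "c i = c j" "c (i + 1) = c (j + 1)" if "\<chi> j i \<noteq> 0" for i j
    using that c_dvd[of i j] c_dvd[of "i + 1" "j + 1"] by (auto simp: \<chi>_def split: if_splits)
  have lin: "pm_linear (R z s \<eta>)" for \<eta> by (rule R_linear)
  have linU: "pm_linear (U u)" for u unfolding U_def by (rule pm_linear_linear_extension)

  have R_G: "R z s \<eta> (G j) = (if c j = Dir \<eta> then G (j - 1) else 0)
      + (if c (j + 1) = Inv \<eta> then G (j + 1) - pm_scale (\<chi> (j + 1) 0) (E 0) else 0)
      - (if ?arr \<eta> then pm_scale (\<chi> j 0 * s) (T z s \<kappa>) else 0)" if \<eta>: "\<eta> \<in> arcs Q" for \<eta> j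
  proof -
    have "R z s \<eta> (G j) = (\<Sum>i = 0..n. pm_scale (\<chi> j i) (R z s \<eta> (E i)))"
      by (simp add: G pm_linear_sum[OF lin] pm_linear_scale[OF lin])
    also have "\<dots> = (\<Sum>i = 0..n. (if 1 \<le> i \<and> c j = Dir \<eta> then pm_scale (\<chi> j i) (E (i - 1)) else 0)
        + (if i < n \<and> c (j + 1) = Inv \<eta> then pm_scale (\<chi> j i) (E (i + 1)) else 0)
        - (if i = 0 then (if ?arr \<eta> then pm_scale (\<chi> j 0 * s) (T z s \<kappa>) else 0) else 0))"
    proof (rule sum.cong[OF refl])
      fix i assume i: "i \<in> {0..n}"
      show "pm_scale (\<chi> j i) (R z s \<eta> (E i)) =
        (if 1 \<le> i \<and> c j = Dir \<eta> then pm_scale (\<chi> j i) (E (i - 1)) else 0)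
        + (if i < n \<and> c (j + 1) = Inv \<eta> then pm_scale (\<chi> j i) (E (i + 1)) else 0)
        - (if i = 0 then (if ?arr \<eta> then pm_scale (\<chi> j 0 * s) (T z s \<kappa>) else 0) else 0)"
      proof (cases "\<chi> j i = 0")
        case False
        have "c j = Dir \<eta> \<Longrightarrow> c (j + 1) \<noteq> Inv \<eta>" using quasi_band_not_inverse(1)[OF qc] .
        then show ?thesis using i E[OF \<eta>, of i] c_eq[OF False]
          by (auto simp: pm.scale_right_diff_distrib)
      qed auto
    qed
    also have "\<dots> = (if c j = Dir \<eta> then (\<Sum>i = 0..n. if 1 \<le> i then pm_scale (\<chi> j i) (E (i - 1)) else 0) else 0)
        + (if c (j + 1) = Inv \<eta> then (\<Sum>i = 0..n. if i < n then pm_scale (\<chi> j i) (E (i + 1)) else 0) else 0)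
        - (if ?arr \<eta> then pm_scale (\<chi> j 0 * s) (T z s \<kappa>) else 0)"
      unfolding sum.distrib sum_subtractf using n by (simp add: sum.delta)
    also have "(\<Sum>i = 0..n. if 1 \<le> i then pm_scale (\<chi> j i) (E (i - 1)) else 0)
        = G (j - 1) - pm_scale (\<chi> (j - 1) n) (E n)"
    proof -
      have "(\<Sum>i = 0..n. if 1 \<le> i then pm_scale (\<chi> j i) (E (i - 1)) else 0)
          = (\<Sum>i = 1..n. pm_scale (\<chi> j i) (E (i - 1)))"
        by (rule sum.mono_neutral_cong_right) auto
      also have "\<dots> = (\<Sum>i = 0..n - 1. pm_scale (\<chi> (j - 1) i) (E i))"
        by (rule sum.reindex_bij_witness[of _ "\<lambda>i. i + 1" "\<lambda>i. i - 1"]) (auto simp: \<chi>_shift)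
      also have "\<dots> = G (j - 1) - pm_scale (\<chi> (j - 1) n) (E n)"
      proof -
        have "{0..n} = insert n {0..n - 1}" using n by auto
        then show ?thesis by (simp add: G)
      qed
      finally show ?thesis .
    qed
    also have "(\<Sum>i = 0..n. if i < n then pm_scale (\<chi> j i) (E (i + 1)) else 0)
        = G (j + 1) - pm_scale (\<chi> (j + 1) 0) (E 0)"
    proof -
      have "(\<Sum>i = 0..n. if i < n then pm_scale (\<chi> j i) (E (i + 1)) else 0)
          = (\<Sum>i = 0..n - 1. pm_scale (\<chi> j i) (E (i + 1)))"
        by (rule sum.mono_neutral_cong_right) auto
      also have "\<dots> = (\<Sum>i = 1..n. pm_scale (\<chi> (j + 1) i) (E i))"
        by (rule sum.reindex_bij_witness[of _ "\<lambda>i. i - 1" "\<lambda>i. i + 1"]) (auto simp: \<chi>_shift)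
      also have "\<dots> = G (j + 1) - pm_scale (\<chi> (j + 1) 0) (E 0)"
      proof -
        have "{0..n} = insert 0 {1..n}" using n by auto
        then show ?thesis by (simp add: G)
      qed
      finally show ?thesis .
    qed
    also have "(if c j = Dir \<eta> then G (j - 1) - pm_scale (\<chi> (j - 1) n) (E n) else 0)
        = (if c j = Dir \<eta> then G (j - 1) else 0)"
    proof (cases "c j = Dir \<eta>")
      case True
      then have "\<chi> (j - 1) n = 0" using c_eq(2)[of "j - 1" n] c_n by fastforce
      then show ?thesis by simp
    qed simp
    finally show ?thesis .
  qed

  have R_F: "R z s \<eta> (F j) = (if c j = Dir \<eta> then F (j - 1) else 0)
      + (if c (j + 1) = Inv \<eta> then F (j + 1) + pm_scale (\<chi> (j + 1) 0 * inverse s) (E 0) else 0)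
      + (if ?arr \<eta> then pm_scale (\<chi> j 0) (T z s \<kappa>) else 0)" if \<eta>: "\<eta> \<in> arcs Q" for \<eta> j
  proof -
    define r q where "r = j mod ?L" and "q = j div ?L"
    have r: "0 \<le> r" "r < ?L" using L by (simp_all add: r_def)
    have j: "j = r + q * ?L" by (simp add: r_def q_def)
    have c: "c j = c r" "c (j + 1) = c (r + 1)"
      using quasi_band_period[OF qc, of r q] quasi_band_period[OF qc, of "r + 1" q] by (simp_all add: j algebra_simps)
    have F_j: "F j = pm_scale (\<mu> powi q) (F r)" "F (j - 1) = pm_scale (\<mu> powi q) (F (r - 1))"
      "F (j + 1) = pm_scale (\<mu> powi q) (F (r + 1))"
      using F_period[of r q] F_period[of "r - 1" q] F_period[of "r + 1" q] by (simp_all add: j algebra_simps)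
    have \<chi>_j: "\<chi> j 0 = (if r = 0 then \<mu> powi q else 0)"
    proof (cases "r = 0")
      case False
      then have "\<not> ?L dvd j" by (simp add: r_def dvd_eq_mod_eq_0)
      then show ?thesis using False by (simp add: \<chi>_def)
    qed (use L in \<open>simp add: \<chi>_def j\<close>)
    have \<chi>_j1: "\<chi> (j + 1) 0 = (if r = ?L - 1 then \<mu> powi q * \<mu> else 0)"
    proof (cases "r = ?L - 1")
      case True
      then have "j + 1 = (q + 1) * ?L" by (simp add: j algebra_simps)
      then show ?thesis using True L \<mu> by (simp add: \<chi>_def power_int_add)
    next
      case False
      then have "(q * ?L + (r + 1)) mod ?L = r + 1" using r by (intro divmod_block) auto
      then have "\<not> ?L dvd j + 1" using r by (simp add: j dvd_eq_mod_eq_0 algebra_simps)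
      then have "\<not> ?L dvd 0 - (j + 1)" by (metis diff_0 dvd_minus_iff)
      then show ?thesis using False by (simp add: \<chi>_def)
    qed
    have last: "c (r + 1) = b 0" if "r = ?L - 1"
      using that c_0 quasi_band_period[OF qc, of 0 1] by simp
    have excl: "c r = Dir \<eta> \<Longrightarrow> c (r + 1) \<noteq> Inv \<eta>" using quasi_band_not_inverse(1)[OF qc] .
    have "R z s \<eta> (F j) = pm_scale (\<mu> powi q) (R z s \<eta> (F r))" by (simp add: F_j pm_linear_scale[OF lin])
    also have "\<dots> = pm_scale (\<mu> powi q) ((if c r = Dir \<eta> then F (r - 1) else 0)
      + (if c (r + 1) = Inv \<eta> then F (r + 1) + (if r = ?L - 1 then pm_scale (\<mu> * inverse s) (E 0) else 0) else 0)
      + (if r = 0 \<and> ?arr \<eta> then T z s \<kappa> else 0))"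
      using F[OF \<eta> r] excl last by (auto simp: add.assoc)
    finally show ?thesis
      by (auto simp: \<chi>_j \<chi>_j1 c F_j pm.scale_right_distrib mult.assoc)
  qed

  have U_G: "U u (G j) = (if u = letter_source Q (c j) then G j else 0)" for u j
  proof -
    have "U u (G j) = (\<Sum>i = 0..n. pm_scale (\<chi> j i) (U u (E i)))"
      by (simp add: G pm_linear_sum[OF linU] pm_linear_scale[OF linU])
    also have "\<dots> = (\<Sum>i = 0..n. if u = letter_source Q (c j) then pm_scale (\<chi> j i) (E i) else 0)"
    proof (rule sum.cong[OF refl])
      fix i assume "i \<in> {0..n}"
      then show "pm_scale (\<chi> j i) (U u (E i)) = (if u = letter_source Q (c j) then pm_scale (\<chi> j i) (E i) else 0)"
        using U_E[of i u] c_eq(1)[of j i] by (cases "\<chi> j i = 0") auto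
    qed
    finally show ?thesis by (auto simp: G)
  qed
  have U_F': "U u (F j) = (if u = letter_source Q (c j) then F j else 0)" for u j
  proof -
    have "F j = pm_scale (\<mu> powi (j div ?L)) (F (j mod ?L))"
      using F_period[of "j mod ?L" "j div ?L"] by simp
    then show ?thesis
      using U_F[of "j mod ?L" u] L quasi_band_mod[OF qc, of j] by (auto simp: pm_linear_scale[OF linU])
  qed
  show ?thesis
    unfolding band_walk_def
  proof (intro conjI allI ballI)
    fix j
    show "U u (F j + pm_scale (inverse s) (G j))
        = (if u = letter_source Q (c j) then F j + pm_scale (inverse s) (G j) else 0)" for u
      by (simp add: pm_linear_add[OF linU] pm_linear_scale[OF linU] U_G U_F')
    fix \<eta> assume \<eta>: "\<eta> \<in> arcs Q"
    have excl: "c j = Dir \<eta> \<Longrightarrow> c (j + 1) \<noteq> Inv \<eta>" using quasi_band_not_inverse(1)[OF qc] .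
    show "R z s \<eta> (F j + pm_scale (inverse s) (G j)) =
        (if c j = Dir \<eta> then F (j - 1) + pm_scale (inverse s) (G (j - 1))
         else if c (j + 1) = Inv \<eta> then F (j + 1) + pm_scale (inverse s) (G (j + 1)) else 0)"
      unfolding pm_linear_add[OF lin] pm_linear_scale[OF lin] R_F[OF \<eta>] R_G[OF \<eta>]
      using excl s
      by (auto simp: pm.scale_right_distrib pm.scale_right_diff_distrib mult.commute mult.left_commute)
  qed
qed


text \<open>
  A path in \<open>I\<close> kills the vector \<open>F\<^sub>j + s\<^sup>-\<^sup>1 G\<^sub>j\<close> of the walk, and hence \<open>F\<^sub>j\<close> as soon as it kills the \<open>E\<^sub>i\<close>.
\<close>

lemma walk_act_eq_0_if_corrected:
  fixes c :: "int \<Rightarrow> 'a letter" and E F :: "int \<Rightarrow> (int \<Rightarrow>\<^sub>0 'k)" and n :: int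
  assumes qc: "quasi_band Q I c L"
    and walk: "band_walk Q c U (R z s) 0 (\<lambda>j. F j + pm_scale (inverse s)
      (\<Sum>i = 0..n. pm_scale (if int L dvd i - j then \<mu> powi ((j - i) div int L) else 0) (E i)))"
    and E_kill: "\<And>p i. p \<in> paths Q \<Longrightarrow> basis_elem p \<in> I \<Longrightarrow> 0 \<le> i \<Longrightarrow> i \<le> n \<Longrightarrow> walk_act U (R z s) p (E i) = 0"
    and p: "p \<in> paths Q" "basis_elem p \<in> I"
  shows "walk_act U (R z s) p (F j) = 0"
proof -
  interpret quiver_rep Q U "R z s" by (rule quiver_rep_N)
  let ?\<chi> = "\<lambda>i. if int L dvd i - j then \<mu> powi ((j - i) div int L) else 0"
  have "walk_act U (R z s) p (F j + pm_scale (inverse s) (\<Sum>i = 0..n. pm_scale (?\<chi> i) (E i))) = 0"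
    by (rule band_walk_killed[OF qc walk pm_linear_0[OF linear_R] p])
  moreover have "walk_act U (R z s) p (\<Sum>i = 0..n. pm_scale (?\<chi> i) (E i)) = 0"
    unfolding pm_linear_sum[OF linear_walk_act] pm_linear_scale[OF linear_walk_act]
    by (rule sum.neutral) (simp add: E_kill[OF p])
  ultimately show ?thesis
    by (simp add: pm_linear_add[OF linear_walk_act] pm_linear_scale[OF linear_walk_act])
qed

text \<open>
  The first kind of negligible band. The vectors \<open>e\<^sub>0, \<dots>, e\<^bsub>f-1\<^esub>\<close> span a submodule, the band module
  of \<open>c\<^sub>1 = u\<gamma>\<close>: the edge \<open>\<kappa> = f\<close> sends \<open>e\<^sub>0\<close> to \<open>- s e\<^bsub>f-1\<^esub>\<close>, which closes the cycle, with the factor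
  \<open>- s\<^sup>-\<^sup>1\<close> per period. The edge \<open>m\<close> sends \<open>e\<^bsub>m-1\<^esub>\<close> to \<open>z s e\<^sub>f\<close> up to the defect in \<open>e\<^sub>0\<close>, so the corrected
  vectors \<open>e\<^sub>f, \<dots>, e\<^bsub>m-1\<^esub>\<close> form the band module of \<open>c\<^sub>2 = v\<alpha>\<^sup>-\<^sup>1\<close> with the factor \<open>z s\<close> per
  period.
\<close>

lemma bound_rep_two_bands:
  fixes n :: int
  assumes zs: "z \<noteq> 0" "s \<noteq> 0" and \<kappa>: "\<kappa> = f" "b f = Dir \<gamma>"
    and q1: "quasi_band Q I c1 (nat f)" "\<And>j. 1 \<le> j \<Longrightarrow> j \<le> f \<Longrightarrow> c1 j = b j"
    and q2: "quasi_band Q I c2 (nat (int m - f))" "\<And>j. 1 \<le> j \<Longrightarrow> j \<le> int m - f \<Longrightarrow> c2 j = b (f + j)"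
    and n: "0 \<le> n" and w: "\<And>j. 1 \<le> j \<Longrightarrow> j \<le> n \<Longrightarrow> b (f + j) = b j"
    and b_n: "b (n + 1) \<in> range Dir" "b (f + n + 1) \<in> range Inv"
  shows "bound_rep Q I U (R z s) m"
proof -
  interpret quiver_rep Q U "R z s" by (rule quiver_rep_N)
  let ?L1 = "int (nat f)" and ?L2 = "int (nat (int m - f))"
  have L: "?L1 = f" "?L2 = int m - f" using f_bounds by simp_all
  define L2 where "L2 = int m - f"
  have L2: "0 < L2" "L2 < int m" using f_bounds by (simp_all add: L2_def)
  have per: "b (j - int m) = b j" for j using quasi_band_period[OF qb, of j "-1"] by simp
  have c1_per: "c1 (j - f) = c1 j" for j using quasi_band_period[OF q1(1), of j "-1"] L by simp
  have c2_per: "c2 (j - L2) = c2 j" for j using quasi_band_period[OF q2(1), of j "-1"] L by (simp add: L2_def algebra_simps)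
  have c1: "c1 j = b j" if "1 \<le> j" "j \<le> n + 1" for j
  proof (cases "j \<le> f")
    case False
    have "j \<le> f + n \<Longrightarrow> c1 j = b j" if "1 \<le> j" for j
      using that
    proof (induction "nat j" arbitrary: j rule: less_induct)
      case less
      show ?case
      proof (cases "j \<le> f")
        case False
        then have "c1 (j - f) = b (j - f)" using less f_bounds by (intro less(1)) auto
        then show ?thesis using w[of "j - f"] c1_per[of j] False less by simp
      qed (use q1 less in auto)
    qed
    then show ?thesis using that f_bounds by simp
  qed (use q1 that in auto)
  have c2: "c2 j = b (f + j)" if "1 \<le> j" "j \<le> n + 1" for j
  proof -
    have "j \<le> L2 + n \<Longrightarrow> c2 j = b (f + j)" if "1 \<le> j" for j
      using that
    proof (induction "nat j" arbitrary: j rule: less_induct)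
      case less
      show ?case
      proof (cases "j \<le> L2")
        case False
        then have "c2 (j - L2) = b (f + (j - L2))" using less L2 by (intro less(1)) auto
        also have "\<dots> = b (j - L2)" using False less by (intro w) auto
        also have "\<dots> = b (f + j)" using per[of "f + j"] by (simp add: L2_def algebra_simps)
        finally show ?thesis using c2_per[of j] by simp
      qed (use q2 less in \<open>auto simp: L2_def\<close>)
    qed
    then show ?thesis using that L2 by simp
  qed
  have c12: "c1 j = c2 j" if "1 \<le> j" "j \<le> n" for j using c1 c2 w that by simp
  have c1_n: "c1 (n + 1) \<in> range Dir" using c1[of "n + 1"] b_n n by simp
  have c2_n: "c2 (n + 1) \<in> range Inv" using c2[of "n + 1"] b_n n by (simp add: add.assoc)
  have c1_0: "c1 0 = Dir \<gamma>" using c1_per[of f] q1(2)[of f] f_bounds \<kappa> by simp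
  have c2_0: "c2 0 = b 0" using c2_per[of L2] q2(2)[of L2] f_bounds b_0 by (simp add: L2_def)
  have arr_\<kappa>: "(b \<kappa> = Dir \<eta> \<or> b \<kappa> = Inv \<eta>) \<longleftrightarrow> \<eta> = \<gamma>" for \<eta> using \<kappa> by auto
  have T_\<kappa>: "T z s \<kappa> = basis_elem (f - 1)" using \<kappa> by (simp add: T_def)

  define E where "E = (\<lambda>j. Poly_Mapping.single (j mod f) ((- inverse s) powi (j div f)) :: int \<Rightarrow>\<^sub>0 'k)"
  define F where "F = (\<lambda>j. Poly_Mapping.single (f + j mod L2) ((z * s) powi (j div L2)) :: int \<Rightarrow>\<^sub>0 'k)"
  have source_1: "letter_source Q (c1 j) = letter_source Q (b j)" if "0 \<le> j" "j < f" for j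
    using that q1(2)[of j] c1_0 \<kappa> source_f by (cases "j = 0") auto

  have U_E: "U u (E j) = (if u = letter_source Q (c1 j) then E j else 0)" for u j
  proof -
    have r: "0 \<le> j mod f" "j mod f < f" using f_bounds by simp_all
    then have "letter_source Q (c1 j) = letter_source Q (b (j mod f))"
      using source_1[OF r] quasi_band_mod[OF q1(1), of j] L by simp
    moreover have "j mod f < int m" using r f_bounds by linarith
    ultimately show ?thesis using r by (simp add: E_def U_single)
  qed
  have walk_E: "band_walk Q c1 U (R z s) 0 E"
    unfolding band_walk_def
  proof (intro conjI allI ballI)
    fix j
    define r q where "r = j mod f" and "q = j div f"
    have r: "0 \<le> r" "r < f" using f_bounds by (simp_all add: r_def)
    then have r_m: "r < int m" using f_bounds by simp
    have j: "j = q * f + r" by (simp add: r_def q_def)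
    have c: "c1 j = c1 r" "c1 (j + 1) = c1 (r + 1)"
      using quasi_band_period[OF q1(1), of r q] quasi_band_period[OF q1(1), of "r + 1" q] L
      by (simp_all add: j algebra_simps)
    have E_j: "E j = pm_scale ((- inverse s) powi q) (basis_elem r)"
      by (simp add: E_def r_def q_def pm_scale_single)
    show "U u (E j) = (if u = letter_source Q (c1 j) then E j else 0)" for u by (rule U_E)
    fix \<eta>
    have "R z s \<eta> (E j) = pm_scale ((- inverse s) powi q)
        ((if b r = Dir \<eta> then basis_elem (r - 1) else if b (r + 1) = Inv \<eta> then T z s (r + 1) else 0)
        - (if r = 0 \<and> \<eta> = \<gamma> then pm_scale s (basis_elem (f - 1)) else 0))"
      using R_basis[OF r(1) r_m, of z s \<eta>] by (simp add: E_j pm_linear_scale[OF linear_R] arr_\<kappa> T_\<kappa>)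
    moreover have "E (j - 1) = (if r = 0 then pm_scale ((- inverse s) powi q * (- s)) (basis_elem (f - 1))
        else pm_scale ((- inverse s) powi q) (basis_elem (r - 1)))"
    proof (cases "r = 0")
      case True
      then have eq: "j - 1 = (q - 1) * f + (f - 1)" by (simp add: j algebra_simps)
      have "(j - 1) mod f = f - 1" "(j - 1) div f = q - 1"
        unfolding eq using f_bounds by (intro divmod_block; simp)+
      moreover have "(- inverse s) powi (q - 1) = (- inverse s) powi q * (- s)"
        using zs power_int_diff[of "- inverse s" q 1] by (simp add: field_simps)
      ultimately show ?thesis using True by (simp add: E_def pm_scale_single)
    next
      case False
      then have "(j - 1) mod f = r - 1" "(j - 1) div f = q"
        using r divmod_block[of "r - 1" f q] by (simp_all add: j algebra_simps)
      then show ?thesis using False by (simp add: E_def pm_scale_single)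
    qed
    moreover have "r + 1 < f \<and> E (j + 1) = pm_scale ((- inverse s) powi q) (T z s (r + 1))"
      if "c1 (r + 1) = Inv \<eta>"
    proof -
      have b: "b (r + 1) = Inv \<eta>" using that q1(2)[of "r + 1"] r by simp
      then have lt: "r + 1 < f" using r \<kappa> by (cases "r + 1 = f") auto
      then have "(j + 1) mod f = r + 1" "(j + 1) div f = q"
        using r divmod_block[of "r + 1" f q] by (simp_all add: j algebra_simps)
      then show ?thesis using b lt f_bounds by (simp add: E_def T_def pm_scale_single)
    qed
    moreover have "c1 (r + 1) = b (r + 1)" using q1(2)[of "r + 1"] r by simp
    moreover have "c1 r = b r" if "r \<noteq> 0" using q1(2)[of r] r that by simp
    moreover have "b 1 \<noteq> Inv \<gamma>"
      using quasi_band_not_inverse(1)[OF q1(1), of 0 \<gamma>] c1_0 q1(2)[of 1] f_bounds by simp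
    ultimately show "R z s \<eta> (E j) = (if c1 j = Dir \<eta> then E (j - 1)
        else if c1 (j + 1) = Inv \<eta> then E (j + 1) else 0)"
      unfolding c using b_not_Dir(1)[of \<eta>] c1_0
      by (cases "r = 0") (auto simp flip: pm.scale_minus_left)
  qed

  have walk: "band_walk Q c2 U (R z s) 0 (\<lambda>j. F j + pm_scale (inverse s)
      (\<Sum>i = 0..n. pm_scale (if ?L2 dvd i - j then (z * s) powi ((j - i) div ?L2) else 0) (E i)))"
  proof (rule corrected_walk[OF zs(2) _ q2(1) n c2_0 c2_n])
    show "z * s \<noteq> 0" using zs by simp
    fix j :: int
    show "U u (E j) = (if u = letter_source Q (c2 j) then E j else 0)" if "0 \<le> j" "j \<le> n" for u
    proof -
      have "letter_source Q (c1 j) = letter_source Q (c2 j)"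
        using that c12[of j] c1_0 c2_0 source_f \<kappa> by (cases "j = 0") auto
      then show ?thesis using U_E by simp
    qed
    show "F (j + k * ?L2) = pm_scale ((z * s) powi k) (F j)" for k
    proof -
      have "(j + k * L2) mod L2 = j mod L2" "(j + k * L2) div L2 = j div L2 + k" using L2 by simp_all
      then show ?thesis using zs L by (simp add: F_def pm_scale_single power_int_add L2_def mult.commute)
    qed
    show "U u (F j) = (if u = letter_source Q (c2 j) then F j else 0)" if "0 \<le> j" "j < ?L2" for u
    proof -
      have "letter_source Q (c2 j) = letter_source Q (b (f + j))"
        using that q2(2)[of j] c2_0 source_f L f_bounds by (cases "j = 0") auto
      then show ?thesis using that f_bounds by (simp add: F_def U_single L2_def)
    qed
    fix \<eta> assume \<eta>: "\<eta> \<in> arcs Q"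
    show "R z s \<eta> (E j) =
      (if 1 \<le> j \<and> c2 j = Dir \<eta> then E (j - 1) else if j < n \<and> c2 (j + 1) = Inv \<eta> then E (j + 1) else 0)
      - (if j = 0 \<and> (b \<kappa> = Dir \<eta> \<or> b \<kappa> = Inv \<eta>) then pm_scale s (T z s \<kappa>) else 0)"
      if j: "0 \<le> j" "j \<le> n"
    proof -
      have R: "R z s \<eta> (E j) = (if c1 j = Dir \<eta> then E (j - 1) else if c1 (j + 1) = Inv \<eta> then E (j + 1) else 0)"
        using walk_E \<eta> unfolding band_walk_def by blast
      have nxt: "c1 (j + 1) = Inv \<eta> \<longleftrightarrow> j < n \<and> c2 (j + 1) = Inv \<eta>"
        using c12[of "j + 1"] c1_n j by (cases "j = n") auto
      show ?thesis
      proof (cases "j = 0")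
        case True
        have "E (- 1) = pm_scale (- s) (basis_elem (f - 1))"
        proof -
          have "(-1) mod f = f - 1" "(-1) div f = -1"
            using divmod_block[of "f - 1" f "-1"] f_bounds by simp_all
          then have "E (- 1) = Poly_Mapping.single (f - 1) ((- inverse s) powi (- 1))"
            unfolding E_def by (simp only:)
          then show ?thesis using zs by (simp add: pm_scale_single power_int_minus)
        qed
        moreover have "c1 1 \<noteq> Inv \<gamma>" using quasi_band_not_inverse(1)[OF q1(1), of 0 \<gamma>] c1_0 by simp
        ultimately show ?thesis
          using R nxt True c1_0 by (auto simp: arr_\<kappa> T_\<kappa>)
      next
        case False
        then show ?thesis using R nxt c12[of j] j by auto
      qed
    qed
    show "R z s \<eta> (F j) =
      (if c2 j = Dir \<eta> then F (j - 1) else if c2 (j + 1) = Inv \<eta> then F (j + 1) else 0)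
      + (if j = 0 \<and> (b \<kappa> = Dir \<eta> \<or> b \<kappa> = Inv \<eta>) then T z s \<kappa> else 0)
      + (if j = ?L2 - 1 \<and> b 0 = Inv \<eta> then pm_scale (z * s * inverse s) (E 0) else 0)"
      if "0 \<le> j" "j < ?L2"
    proof -
      have j: "0 \<le> j" "j < L2" using that unfolding L2_def L(2) by simp_all
      then have fj: "0 \<le> f + j" "f + j < int m" "f + j \<noteq> 0" using f_bounds by (simp_all add: L2_def)
      have F_j: "F j = basis_elem (f + j)" using j by (simp add: F_def)
      have E_0: "E 0 = basis_elem 0" by (simp add: E_def)
      define D where "D = pm_scale (z * s * inverse s) (E 0)"
      have L2_eq: "?L2 = L2" using L by (simp add: L2_def)
      have R: "R z s \<eta> (F j) = (if b (f + j) = Dir \<eta> then basis_elem (f + j - 1)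
          else if b (f + j + 1) = Inv \<eta> then T z s (f + j + 1) else 0)"
        using R_basis[OF fj(1,2), of z s \<eta>] fj(3) unfolding F_j by simp
      have c_next: "c2 (j + 1) = b (f + j + 1)" using q2(2)[of "j + 1"] j by (simp add: L2_def add.assoc)
      have T_next: "T z s (f + j + 1) = F (j + 1)
          + (if j = L2 - 1 then D else 0)" if "b (f + j + 1) = Inv \<eta>"
      proof (cases "j = L2 - 1")
        case True
        then have "f + j + 1 = int m" by (simp add: L2_def)
        moreover have "F (j + 1) = Poly_Mapping.single f (z * s)" using True L2 by (simp add: F_def)
        moreover have "D = Poly_Mapping.single 0 z"
        proof -
          have "z * s * inverse s = z" using zs by simp
          then show ?thesis by (simp only: D_def E_0 pm_scale_eq_mult_single)
        qed
        ultimately show ?thesis using True that by (simp add: T_def add.commute)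
      next
        case False
        then show ?thesis using that j by (simp add: T_def F_def L2_def algebra_simps)
      qed
      have last: "b (f + j + 1) = b 0" if "j = L2 - 1"
        using that b_0 by (simp add: L2_def)
      have "R z s \<eta> (F j) = (if c2 j = Dir \<eta> then F (j - 1) else if c2 (j + 1) = Inv \<eta> then F (j + 1) else 0)
        + (if j = 0 \<and> \<eta> = \<gamma> then basis_elem (f - 1) else 0)
        + (if j = L2 - 1 \<and> b 0 = Inv \<eta> then D else 0)"
      proof (cases "j = 0")
        case True
        then show ?thesis
          using R c_next T_next last \<kappa>(2) quasi_band_not_inverse(1)[OF qb, of f \<gamma>] c2_0 b_not_Dir(1)[of \<eta>]
          by auto
      next
        case False
        have "c2 j = b (f + j)" using q2(2)[of j] False j by (simp add: L2_def)
        moreover have "F (j - 1) = basis_elem (f + j - 1)" using False j by (simp add: F_def algebra_simps)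
        moreover have "b (f + j) = Dir \<eta> \<Longrightarrow> b (f + j + 1) \<noteq> Inv \<eta>"
          using quasi_band_not_inverse(1)[OF qb] .
        ultimately show ?thesis
          using False R c_next T_next last by auto
      qed
      then show ?thesis unfolding L2_eq D_def arr_\<kappa> T_\<kappa> .
    qed
  qed
  show ?thesis
  proof (rule bound_rep_N)
    fix p i assume p: "p \<in> paths Q" "basis_elem p \<in> I" and i: "0 \<le> i" "i < int m"
    have kill_E: "walk_act U (R z s) p (E j) = 0" if p: "p \<in> paths Q" "basis_elem p \<in> I" for p j
      by (rule band_walk_killed[OF q1(1) walk_E pm_linear_0[OF linear_R] p])
    show "walk_act U (R z s) p (basis_elem i) = 0"
    proof (cases "i < f")
      case True
      then show ?thesis using kill_E[OF p, of i] i by (simp add: E_def)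
    next
      case False
      then have "F (i - f) = basis_elem i" using i by (simp add: F_def L2_def)
      then show ?thesis using walk_act_eq_0_if_corrected[OF q2(1) walk kill_E p, of "i - f"] by simp
    qed
  qed
qed

text \<open>
  The second kind of negligible band, with \<open>f\<close> the length of \<open>w u w\<^sup>-\<^sup>1\<close>. The exchanged word \<open>c\<close> passes
  \<open>e\<^sub>f, e\<^bsub>f-1\<^esub>, \<dots>, e\<^sub>0\<close>, reading \<open>w u w\<^sup>-\<^sup>1\<close> backwards, and then \<open>e\<^bsub>f+1\<^esub>, \<dots>, e\<^bsub>m-1\<^esub>\<close>, reading \<open>v\<close>.
  The step from \<open>e\<^sub>0\<close> to \<open>e\<^bsub>f+1\<^esub>\<close> costs the factor \<open>- s\<close> and the step from \<open>e\<^bsub>m-1\<^esub>\<close> back to \<open>e\<^sub>f\<close> the factor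
  \<open>z s\<close>, whence \<open>\<mu> = - z s\<^sup>2\<close>.
\<close>

lemma bound_rep_one_band:
  fixes n :: int
  assumes zs: "z \<noteq> 0" "s \<noteq> 0" and \<kappa>: "\<kappa> = f + 1" "b (f + 1) = Inv \<gamma>"
    and qc: "quasi_band Q I c m" and c_low: "\<And>j. 1 \<le> j \<Longrightarrow> j \<le> f \<Longrightarrow> c j = letter_inv (b (f + 1 - j))"
    and c_high: "\<And>j. f < j \<Longrightarrow> j \<le> int m \<Longrightarrow> c j = b j"
    and n: "0 \<le> n" "2 * n < f" and w: "\<And>j. 1 \<le> j \<Longrightarrow> j \<le> n \<Longrightarrow> c j = b j"
    and b_n: "b (n + 1) \<in> range Dir" "c (n + 1) \<in> range Inv"
  shows "bound_rep Q I U (R z s) m"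
proof -
  interpret quiver_rep Q U "R z s" by (rule quiver_rep_N)
  define \<mu> where "\<mu> = - (z * s * s)"
  define E where "E = (\<lambda>j. basis_elem j :: int \<Rightarrow>\<^sub>0 'k)"
  define F0 where "F0 = (\<lambda>r. if r \<le> f then basis_elem (f - r) else pm_scale (- s) (basis_elem r) :: int \<Rightarrow>\<^sub>0 'k)"
  define F where "F = (\<lambda>j. pm_scale (\<mu> powi (j div int m)) (F0 (j mod int m)))"
  have \<mu>: "\<mu> \<noteq> 0" using zs by (simp add: \<mu>_def)
  have c_0: "c 0 = b 0" using quasi_band_period[OF qc, of 0 1] c_high[of "int m"] f_bounds b_0 by simp
  have arr_\<kappa>: "(b \<kappa> = Dir \<eta> \<or> b \<kappa> = Inv \<eta>) \<longleftrightarrow> \<eta> = \<gamma>" for \<eta> using \<kappa> by auto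
  have F_eq: "F j = F0 j" if "0 \<le> j" "j < int m" for j using that by (simp add: F_def)
  have F_m: "F (int m) = pm_scale \<mu> (basis_elem f)" using m_pos f_bounds by (simp add: F_def F0_def)
  have T_Inv: "T z s k = (if k = int m then pm_scale z (basis_elem 0) + pm_scale (z * s) (basis_elem f) else basis_elem k)"
    if "b k = Inv \<eta>" for k \<eta> using that by (simp add: T_def pm_scale_eq_mult_single del: single_one)
  have walk: "band_walk Q c U (R z s) 0 (\<lambda>j. F j + pm_scale (inverse s)
      (\<Sum>i = 0..n. pm_scale (if int m dvd i - j then \<mu> powi ((j - i) div int m) else 0) (E i)))"
  proof (rule corrected_walk[OF zs(2) \<mu> qc n(1) c_0 b_n(2)])
    fix j :: int
    show "U u (E j) = (if u = letter_source Q (c j) then E j else 0)" if "0 \<le> j" "j \<le> n" for u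
    proof -
      have "c j = b j" using that w[of j] c_0 by (cases "j = 0") auto
      then show ?thesis using that n f_bounds by (simp add: E_def U_single)
    qed
    show "F (j + k * int m) = pm_scale (\<mu> powi k) (F j)" for k
    proof -
      have "(j + k * int m) mod int m = j mod int m" "(j + k * int m) div int m = j div int m + k"
        using m_pos by simp_all
      then show ?thesis using \<mu> by (simp add: F_def power_int_add mult.commute)
    qed
    show "U u (F j) = (if u = letter_source Q (c j) then F j else 0)" if j: "0 \<le> j" "j < int m" for u
    proof (cases "j \<le> f")
      case True
      have "letter_source Q (c j) = letter_source Q (b (f - j))"
        using c_low[of j] j True c_0 source_f quasi_band_step(1)[OF qb, of "f + 1 - j"]
        by (cases "j = 0") (auto simp: algebra_simps)
      then show ?thesis using j True f_bounds by (simp add: F_eq F0_def U_single)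
    next
      case False
      then show ?thesis using c_high[of j] j by (simp add: F_eq F0_def U_single pm_scale_single)
    qed
    fix \<eta> assume \<eta>: "\<eta> \<in> arcs Q"
    show "R z s \<eta> (E j) =
      (if 1 \<le> j \<and> c j = Dir \<eta> then E (j - 1) else if j < n \<and> c (j + 1) = Inv \<eta> then E (j + 1) else 0)
      - (if j = 0 \<and> (b \<kappa> = Dir \<eta> \<or> b \<kappa> = Inv \<eta>) then pm_scale s (T z s \<kappa>) else 0)"
      if j: "0 \<le> j" "j \<le> n"
    proof -
      have "b j = Dir \<eta> \<longleftrightarrow> 1 \<le> j \<and> c j = Dir \<eta>"
        using w[of j] j b_not_Dir(1)[of \<eta>] by (cases "j = 0") auto
      moreover have "b (j + 1) = Inv \<eta> \<longleftrightarrow> j < n \<and> c (j + 1) = Inv \<eta>"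
        using w[of "j + 1"] j b_n(1) by (cases "j = n") auto
      moreover have "T z s (j + 1) = E (j + 1)" if "b (j + 1) = Inv \<eta>"
        using T_Inv[OF that] j n f_bounds by (simp add: E_def)
      moreover have "b (n + 1) \<noteq> Inv \<eta>" using b_n(1) by auto
      ultimately show ?thesis
        using R_basis[of j z s \<eta>] j n f_bounds by (auto simp: E_def)
    qed
    show "R z s \<eta> (F j) =
      (if c j = Dir \<eta> then F (j - 1) else if c (j + 1) = Inv \<eta> then F (j + 1) else 0)
      + (if j = 0 \<and> (b \<kappa> = Dir \<eta> \<or> b \<kappa> = Inv \<eta>) then T z s \<kappa> else 0)
      + (if j = int m - 1 \<and> b 0 = Inv \<eta> then pm_scale (\<mu> * inverse s) (E 0) else 0)"
      if j: "0 \<le> j" "j < int m"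
    proof -
      have T_m: "pm_scale (- s) (T z s (int m)) = F (int m) + pm_scale (\<mu> * inverse s) (E 0)"
      proof -
        obtain \<alpha> where "b (int m) = Inv \<alpha>" using b_m by auto
        then show ?thesis using zs
          by (simp add: T_Inv F_m E_def \<mu>_def pm.scale_right_distrib mult.commute mult.left_commute add.commute)
      qed
      have next_high: "pm_scale (- s) (T z s (j' + 1)) = F (j' + 1)
          + (if j' = int m - 1 then pm_scale (\<mu> * inverse s) (E 0) else 0)"
        if "b (j' + 1) = Inv \<eta>'" "f \<le> j'" "j' < int m" for j' \<eta>'
      proof (cases "j' = int m - 1")
        case True
        then show ?thesis using T_m by simp
      next
        case False
        then show ?thesis using that T_Inv[OF that(1)] F_eq[of "j' + 1"] f_bounds by (simp add: F0_def)
      qed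
      have last: "b (j + 1) = b 0" if "j = int m - 1" using that b_0 by simp
      have \<kappa>_next: "b (f + 1) = Inv \<eta> \<longleftrightarrow> \<eta> = \<gamma>" using \<kappa> by auto
      consider "j < f" | "j = f" | "f < j" by linarith
      then show ?thesis
      proof cases
        case 1
        have F_j: "F j = basis_elem (f - j)" using 1 j by (simp add: F_eq F0_def)
        have R: "R z s \<eta> (F j) = (if b (f - j) = Dir \<eta> then basis_elem (f - j - 1)
            else if b (f - j + 1) = Inv \<eta> then T z s (f - j + 1) else 0)"
          using R_basis[of "f - j" z s \<eta>] 1 j f_bounds unfolding F_j by simp
        have c_next: "c (j + 1) = Inv \<eta> \<longleftrightarrow> b (f - j) = Dir \<eta>" using c_low[of "j + 1"] 1 j by simp
        have F_next: "F (j + 1) = basis_elem (f - j - 1)" using 1 j f_bounds by (simp add: F_eq F0_def algebra_simps)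
        have excl: "b (f - j) = Dir \<eta> \<Longrightarrow> b (f - j + 1) \<noteq> Inv \<eta>" using quasi_band_not_inverse(1)[OF qb] .
        show ?thesis
        proof (cases "j = 0")
          case True
          then show ?thesis using R c_next F_next excl 1 f_bounds c_0 b_not_Dir(1)[of \<eta>] \<kappa>
            by auto
        next
          case False
          have "c j = Dir \<eta> \<longleftrightarrow> b (f - j + 1) = Inv \<eta>" using c_low[of j] 1 j False by (simp add: algebra_simps)
          moreover have "T z s (f - j + 1) = F (j - 1)" if "b (f - j + 1) = Inv \<eta>"
            using T_Inv[OF that] False 1 j f_bounds by (simp add: F_eq F0_def algebra_simps)
          ultimately show ?thesis using R c_next F_next excl False 1 f_bounds by auto
        qed
      next
        case 2
        have F_j: "F j = basis_elem 0" using 2 f_bounds by (simp add: F_eq F0_def)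
        have R: "R z s \<eta> (F j) = (if b 1 = Inv \<eta> then T z s 1 else 0)
            - (if \<eta> = \<gamma> then pm_scale s (T z s (f + 1)) else 0)"
          using R_basis[of 0 z s \<eta>, unfolded arr_\<kappa>] m_pos b_not_Dir(1)[of \<eta>] \<kappa>(1)
          unfolding F_j by (simp del: single_one)
        have c_f: "c f = Dir \<eta> \<longleftrightarrow> b 1 = Inv \<eta>" using c_low[of f] f_bounds by simp
        have c_next: "c (f + 1) = b (f + 1)" using c_high[of "f + 1"] f_bounds by simp
        have F_prev: "T z s 1 = F (f - 1)" if "b 1 = Inv \<eta>"
          using T_Inv[OF that] f_bounds by (simp add: F_eq F0_def)
        have excl: "c f = Dir \<eta> \<Longrightarrow> c (f + 1) \<noteq> Inv \<eta>" using quasi_band_not_inverse(1)[OF qc] .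
        show ?thesis
          using R c_f c_next F_prev excl next_high[of f \<eta>] 2 \<kappa>_next f_bounds last
          by (auto simp flip: pm.scale_minus_left)
      next
        case 3
        have F_j: "F j = pm_scale (- s) (basis_elem j)" using 3 j by (simp add: F_eq F0_def)
        have R: "R z s \<eta> (F j) = pm_scale (- s) (if b j = Dir \<eta> then basis_elem (j - 1)
            else if b (j + 1) = Inv \<eta> then T z s (j + 1) else 0)"
          using R_basis[of j z s \<eta>] 3 j f_bounds unfolding F_j pm_linear_scale[OF linear_R] by simp
        have c_j: "c j = b j" using c_high 3 j by simp
        have c_next: "c (j + 1) = b (j + 1)" using c_high[of "j + 1"] 3 j by simp
        have F_prev: "F (j - 1) = pm_scale (- s) (basis_elem (j - 1))" if "b j = Dir \<eta>"
        proof -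
          have "j \<noteq> f + 1" using that \<kappa> by auto
          then show ?thesis using 3 j F_eq[of "j - 1"] f_bounds by (simp add: F0_def)
        qed
        have excl: "b j = Dir \<eta> \<Longrightarrow> b (j + 1) \<noteq> Inv \<eta>" using quasi_band_not_inverse(1)[OF qb] .
        show ?thesis
          using R c_j c_next F_prev excl next_high[of j \<eta>] 3 f_bounds last j by auto
      qed
    qed
  qed
  \<comment> \<open>The vector \<open>e\<^sub>i\<close> with \<open>i \<le> n\<close> is \<open>F\<^bsub>f-i\<^esub>\<close>, whose correction is zero because \<open>n < f - i < m\<close>.\<close>
  have kill_low: "walk_act U (R z s) p (E i) = 0"
    if p: "p \<in> paths Q" "basis_elem p \<in> I" and i: "0 \<le> i" "i \<le> n" for p i
  proof -
    have j: "n < f - i" "f - i < int m" using i n f_bounds by simp_all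
    have "\<not> int m dvd i' - (f - i)" if "i' \<in> {0..n}" for i'
    proof -
      have "0 < \<bar>i' - (f - i)\<bar>" "\<bar>i' - (f - i)\<bar> < int m" using that j by auto
      then show ?thesis using zdvd_not_zless by (metis dvd_abs_iff)
    qed
    then have "(\<Sum>i' = 0..n. pm_scale (if int m dvd i' - (f - i) then \<mu> powi ((f - i - i') div int m) else 0) (E i')) = 0"
      by (intro sum.neutral) simp
    then have "walk_act U (R z s) p (F (f - i)) = 0"
      using band_walk_killed[OF qc walk pm_linear_0[OF linear_R] p, of "f - i"] by simp
    then show ?thesis using i j n by (simp add: F_eq F0_def E_def)
  qed
  show ?thesis
  proof (rule bound_rep_N)
    fix p i assume p: "p \<in> paths Q" "basis_elem p \<in> I" and i: "0 \<le> i" "i < int m"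
    have kill_F: "walk_act U (R z s) p (F j) = 0" for j
      by (rule walk_act_eq_0_if_corrected[OF qc walk kill_low p])
    show "walk_act U (R z s) p (basis_elem i) = 0"
    proof (cases "i \<le> f")
      case True
      then show ?thesis using kill_F[of "f - i"] i f_bounds by (simp add: F_eq F0_def)
    next
      case False
      then have "pm_scale (- s) (walk_act U (R z s) p (basis_elem i)) = 0"
        using kill_F[of i] i by (simp add: F_eq F0_def del: pm.scale_minus_left flip: pm_linear_scale[OF linear_walk_act])
      then show ?thesis using zs by simp
    qed
  qed
qed

end

section \<open>Irreducibility by rational curves\<close>

lemma infinite_UNIV_alg_closed: "infinite (UNIV :: 'k::alg_closed_field set)"
proof
  assume fin: "finite (UNIV :: 'k set)"
  let ?p = "(\<Prod>a\<in>UNIV. [:- a, 1:]) + 1 :: 'k poly"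
  have "degree (\<Prod>a\<in>UNIV. [:- a, 1 :: 'k:]) = card (UNIV :: 'k set)"
    by (subst degree_prod_eq_sum_degree) auto
  moreover have "card (UNIV :: 'k set) > 0" using fin by (simp add: card_gt_0_iff)
  ultimately have "degree ?p > 0"
    by (subst degree_add_eq_left) auto
  then obtain x where "poly ?p x = 0" using alg_closed_imp_poly_has_root by blast
  moreover have "poly (\<Prod>a\<in>UNIV. [:- a, 1 :: 'k:]) x = 0"
    using fin by (simp add: poly_prod)
  ultimately show False by simp
qed

text \<open>Rational functions whose denominator is a power of \<open>D\<close>.\<close>

definition regular_off :: "'k::field poly \<Rightarrow> ('k \<Rightarrow> 'k) \<Rightarrow> bool" where
  "regular_off D r \<longleftrightarrow> (\<exists>n p. \<forall>t. poly D t \<noteq> 0 \<longrightarrow> r t * poly D t ^ n = poly p t)"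

lemma regular_off_poly: "regular_off D (poly p)"
  unfolding regular_off_def by (rule exI[of _ 0]) auto

lemma regular_off_const: "regular_off D (\<lambda>_. c)"
  using regular_off_poly[of D "[:c:]"] by (simp add: fun_eq_iff regular_off_def)

lemma regular_off_ident: "regular_off D (\<lambda>t. t)"
  using regular_off_poly[of D "[:0, 1:]"] by (simp add: regular_off_def)

lemma regular_off_add:
  assumes "regular_off D r" "regular_off D q" shows "regular_off D (\<lambda>t. r t + q t)"
proof -
  obtain n p where p: "\<And>t. poly D t \<noteq> 0 \<Longrightarrow> r t * poly D t ^ n = poly p t"
    using assms(1) unfolding regular_off_def by blast
  obtain n' p' where p': "\<And>t. poly D t \<noteq> 0 \<Longrightarrow> q t * poly D t ^ n' = poly p' t"
    using assms(2) unfolding regular_off_def by blast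
  have "(r t + q t) * poly D t ^ (n + n') = poly (p * D ^ n' + p' * D ^ n) t" if "poly D t \<noteq> 0" for t
  proof -
    have "(r t + q t) * poly D t ^ (n + n')
        = (r t * poly D t ^ n) * poly D t ^ n' + (q t * poly D t ^ n') * poly D t ^ n"
      by (simp add: power_add algebra_simps)
    then show ?thesis unfolding p[OF that] p'[OF that] by simp
  qed
  then show ?thesis unfolding regular_off_def by blast
qed

lemma regular_off_mult:
  assumes "regular_off D r" "regular_off D q" shows "regular_off D (\<lambda>t. r t * q t)"
proof -
  obtain n p where p: "\<And>t. poly D t \<noteq> 0 \<Longrightarrow> r t * poly D t ^ n = poly p t"
    using assms(1) unfolding regular_off_def by blast
  obtain n' p' where p': "\<And>t. poly D t \<noteq> 0 \<Longrightarrow> q t * poly D t ^ n' = poly p' t"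
    using assms(2) unfolding regular_off_def by blast
  have "(r t * q t) * poly D t ^ (n + n') = poly (p * p') t" if "poly D t \<noteq> 0" for t
  proof -
    have "(r t * q t) * poly D t ^ (n + n') = (r t * poly D t ^ n) * (q t * poly D t ^ n')"
      by (simp add: power_add algebra_simps)
    then show ?thesis unfolding p[OF that] p'[OF that] by simp
  qed
  then show ?thesis unfolding regular_off_def by blast
qed

lemma regular_off_minus: "regular_off D r \<Longrightarrow> regular_off D (\<lambda>t. - r t)"
  using regular_off_mult[OF regular_off_const[of D "-1"], of r] by simp

lemma regular_off_diff: "regular_off D r \<Longrightarrow> regular_off D q \<Longrightarrow> regular_off D (\<lambda>t. r t - q t)"
  using regular_off_add[OF _ regular_off_minus, of D r q] by simp

lemma regular_off_if:
  "(P \<Longrightarrow> regular_off D r) \<Longrightarrow> (\<not> P \<Longrightarrow> regular_off D q) \<Longrightarrow> regular_off D (\<lambda>t. if P then r t else q t)"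
  by (cases P) simp_all

lemma regular_off_sum:
  assumes "\<And>i. i \<in> S \<Longrightarrow> regular_off D (r i)" shows "regular_off D (\<lambda>t. \<Sum>i\<in>S. r i t)"
  using assms
  by (induction S rule: infinite_finite_induct) (auto intro: regular_off_const regular_off_add)

lemma regular_off_prod:
  assumes "\<And>i. i \<in> S \<Longrightarrow> regular_off D (r i)" shows "regular_off D (\<lambda>t. \<Prod>i\<in>S. r i t)"
  using assms
  by (induction S rule: infinite_finite_induct) (auto intro: regular_off_const regular_off_mult)

lemma regular_off_inverse_factor: "D = E * F \<Longrightarrow> regular_off D (\<lambda>t. inverse (poly E t))"
  unfolding regular_off_def by (intro exI[of _ 1] exI[of _ F]) auto

lemma regular_off_cong:
  assumes "\<And>t. poly D t \<noteq> 0 \<Longrightarrow> r t = q t" "regular_off D q" shows "regular_off D r"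
proof -
  obtain n p where "\<And>t. poly D t \<noteq> 0 \<Longrightarrow> q t * poly D t ^ n = poly p t"
    using assms(2) unfolding regular_off_def by blast
  then have "\<And>t. poly D t \<noteq> 0 \<Longrightarrow> r t * poly D t ^ n = poly p t" using assms(1) by simp
  then show ?thesis unfolding regular_off_def by blast
qed

lemma permutes_nth_less: "p permutes {0..<n::nat} \<Longrightarrow> i < n \<Longrightarrow> p i < n"
  using permutes_in_image[of p "{0..<n}" i] by simp

lemma regular_off_det:
  assumes "\<And>t. M t \<in> carrier_mat n n"
    and "\<And>i j. i < n \<Longrightarrow> j < n \<Longrightarrow> regular_off D (\<lambda>t. M t $$ (i, j))"
  shows "regular_off D (\<lambda>t. det (M t))"
proof -
  have "(\<lambda>t. det (M t)) = (\<lambda>t. \<Sum>p | p permutes {0..<n}. signof p * (\<Prod>i = 0..<n. M t $$ (i, p i)))"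
    by (rule ext) (rule det_def'[OF assms(1)])
  moreover have "regular_off D \<dots>"
    by (intro regular_off_sum regular_off_mult regular_off_const regular_off_prod assms(2))
       (simp_all add: permutes_nth_less)
  ultimately show ?thesis by (simp only:)
qed

lemma poly_zero_if_zero_off:
  fixes p D :: "'k::alg_closed_field poly"
  assumes "D \<noteq> 0" "\<And>t. poly D t \<noteq> 0 \<Longrightarrow> poly p t = 0"
  shows "p = 0"
proof (rule ccontr)
  assume "p \<noteq> 0"
  then have "finite {t. poly (p * D) t = 0}" using assms(1) poly_roots_finite[of "p * D"] by simp
  moreover have "{t. poly (p * D) t = 0} = UNIV" using assms(2) by auto
  ultimately show False using infinite_UNIV_alg_closed by metis
qed

lemma regular_off_product_zero:
  fixes r q :: "'k::alg_closed_field \<Rightarrow> 'k"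
  assumes reg: "regular_off D r" "regular_off D q"
    and zero: "\<And>t. poly D t \<noteq> 0 \<Longrightarrow> r t = 0 \<or> q t = 0"
    and "poly D a \<noteq> 0" "poly D c \<noteq> 0" "q c \<noteq> 0"
  shows "r a = 0"
proof -
  obtain n p where p: "\<And>t. poly D t \<noteq> 0 \<Longrightarrow> r t * poly D t ^ n = poly p t"
    using reg(1) unfolding regular_off_def by blast
  obtain n' p' where p': "\<And>t. poly D t \<noteq> 0 \<Longrightarrow> q t * poly D t ^ n' = poly p' t"
    using reg(2) unfolding regular_off_def by blast
  have "poly (p * p') t = 0" if "poly D t \<noteq> 0" for t
    using p[OF that] p'[OF that] zero[OF that] by (metis mult_eq_0_iff poly_mult)
  moreover have "D \<noteq> 0" using assms(4) by auto
  ultimately have "p * p' = 0" using poly_zero_if_zero_off[of D "p * p'"] by blast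
  moreover have "poly p' c \<noteq> 0" using p'[of c] assms(5,6) by (metis mult_eq_0_iff power_not_zero)
  ultimately have "p = 0" by auto
  then show ?thesis using p[of a] assms(4) by simp
qed

lemma regular_off_nonzero_avoiding_0:
  fixes r :: "'k::alg_closed_field \<Rightarrow> 'k"
  assumes "regular_off D r" "poly D a \<noteq> 0" "r a \<noteq> 0"
  shows "\<exists>t. poly D t \<noteq> 0 \<and> t \<noteq> 0 \<and> r t \<noteq> 0"
proof (rule ccontr)
  assume "\<not> ?thesis"
  then have *: "poly D t \<noteq> 0 \<Longrightarrow> t = 0 \<or> r t = 0" for t by blast
  obtain n p where p: "\<And>t. poly D t \<noteq> 0 \<Longrightarrow> r t * poly D t ^ n = poly p t"
    using assms(1) unfolding regular_off_def by blast
  have "D \<noteq> 0" using assms(2) by auto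
  moreover have "poly ([:0, 1:] * p) t = 0" if "poly D t \<noteq> 0" for t
    using *[OF that] p[OF that] by auto
  ultimately have "[:0, 1:] * p = 0"
    by (rule poly_zero_if_zero_off)
  then have "p = 0" by simp
  then show False using p[of a] assms by simp
qed

lemma polynomial_function_regular_off:
  assumes "f \<in> polynomial_functions A d"
    and "\<And>a i j. a \<in> carrier A \<Longrightarrow> i < d \<Longrightarrow> j < d \<Longrightarrow> regular_off D (\<lambda>t. \<gamma> t a $$ (i, j))"
  shows "regular_off D (\<lambda>t. f (\<gamma> t))"
  using assms(1)
  by induction (auto intro: regular_off_const regular_off_add regular_off_mult assms(2))

lemma closedin_zariski_topology:
  "closedin (zariski_topology A d) C \<longleftrightarrow> (\<exists>S \<subseteq> polynomial_functions A d. C = zero_locus A d S)"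
proof -
  have sub: "zero_locus A d S \<subseteq> module_variety A d" for S by (auto simp: zero_locus_def)
  show ?thesis
    unfolding closedin_def openin_zariski_topology topspace_zariski_topology
    using sub by (metis Diff_subset double_diff order_refl)
qed

text \<open>
  On a curve a product of two polynomial functions is a rational function of one variable, so it
  vanishes only if one of the factors does.
\<close>

lemma irreducible_in_zariski_if_curves:
  fixes S :: "('x \<Rightarrow> 'k::alg_closed_field mat) set"
  assumes S: "S \<subseteq> module_variety A d" "S \<noteq> {}"
    and curve: "\<And>\<phi> \<psi>. \<phi> \<in> S \<Longrightarrow> \<psi> \<in> S \<Longrightarrow> \<exists>D \<gamma>. poly D 0 \<noteq> 0 \<and> poly D 1 \<noteq> 0 \<and> \<gamma> 0 = \<phi> \<and> \<gamma> 1 = \<psi> \<and>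
      (\<forall>a\<in>carrier A. \<forall>i<d. \<forall>j<d. regular_off D (\<lambda>t. \<gamma> t a $$ (i, j))) \<and>
      (\<forall>t. poly D t \<noteq> 0 \<longrightarrow> \<gamma> t \<in> S)"
  shows "irreducible_in (zariski_topology A d) S"
  unfolding irreducible_in_def topspace_zariski_topology
proof (intro conjI allI impI S)
  fix C E assume "closedin (zariski_topology A d) C \<and> closedin (zariski_topology A d) E \<and> S \<subseteq> C \<union> E"
  then obtain F G where F: "F \<subseteq> polynomial_functions A d" "C = zero_locus A d F"
    and G: "G \<subseteq> polynomial_functions A d" "E = zero_locus A d G" and CE: "S \<subseteq> C \<union> E"
    unfolding closedin_zariski_topology by auto
  show "S \<subseteq> C \<or> S \<subseteq> E"
  proof (rule ccontr)
    assume "\<not> ?thesis"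
    then obtain \<phi> \<psi> where "\<phi> \<in> S" "\<phi> \<notin> C" "\<psi> \<in> S" "\<psi> \<notin> E" by blast
    then obtain f g where fg: "f \<in> F" "f \<phi> \<noteq> 0" "g \<in> G" "g \<psi> \<noteq> 0"
      using F G S by (auto simp: zero_locus_def)
    from curve[OF \<open>\<phi> \<in> S\<close> \<open>\<psi> \<in> S\<close>]
    obtain D \<gamma> where *: "poly D 0 \<noteq> 0 \<and> poly D 1 \<noteq> 0 \<and> \<gamma> 0 = \<phi> \<and> \<gamma> 1 = \<psi> \<and>
      (\<forall>a\<in>carrier A. \<forall>i<d. \<forall>j<d. regular_off D (\<lambda>t. \<gamma> t a $$ (i, j))) \<and>
      (\<forall>t. poly D t \<noteq> 0 \<longrightarrow> \<gamma> t \<in> S)" by (elim exE)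
    have D: "poly D 0 \<noteq> 0" "poly D 1 \<noteq> 0" "\<gamma> 0 = \<phi>" "\<gamma> 1 = \<psi>" using * by simp_all
    have reg: "regular_off D (\<lambda>t. \<gamma> t a $$ (i, j))" if "a \<in> carrier A" "i < d" "j < d" for a i j
      using * that by simp
    have in_S: "\<gamma> t \<in> S" if "poly D t \<noteq> 0" for t using * that by simp
    have "f (\<gamma> 0) = 0"
    proof (rule regular_off_product_zero[of D "\<lambda>t. f (\<gamma> t)" "\<lambda>t. g (\<gamma> t)" 0 1])
      show "regular_off D (\<lambda>t. f (\<gamma> t))" "regular_off D (\<lambda>t. g (\<gamma> t))"
        by (rule polynomial_function_regular_off[where A = A and d = d]; use fg F G reg in blast)+
      show "f (\<gamma> t) = 0 \<or> g (\<gamma> t) = 0" if "poly D t \<noteq> 0" for t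
        using in_S[OF that] CE F G fg by (auto simp: zero_locus_def)
    qed (use D fg in auto)
    then show False using D fg by simp
  qed
qed

lemma irreducible_in_closure_of:
  assumes "irreducible_in X S" shows "irreducible_in X (X closure_of S)"
  unfolding irreducible_in_def
proof (intro conjI allI impI)
  show "X closure_of S \<subseteq> topspace X" by (rule closure_of_subset_topspace)
  have S: "S \<subseteq> topspace X" "S \<noteq> {}" using assms by (auto simp: irreducible_in_def)
  then show "X closure_of S \<noteq> {}" using closure_of_subset[of S X] by auto
  fix C D assume *: "closedin X C \<and> closedin X D \<and> X closure_of S \<subseteq> C \<union> D"
  then have "S \<subseteq> C \<union> D" using closure_of_subset[OF S(1)] by blast
  then have "S \<subseteq> C \<or> S \<subseteq> D" using assms * unfolding irreducible_in_def by blast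
  then show "X closure_of S \<subseteq> C \<or> X closure_of S \<subseteq> D"
    using * closure_of_minimal by blast
qed

lemma polynomial_function_zero_on_closure:
  assumes f: "f \<in> polynomial_functions A d" and zero: "\<And>\<phi>. \<phi> \<in> S \<Longrightarrow> f \<phi> = 0"
    and S: "S \<subseteq> module_variety A d"
    and "\<phi> \<in> zariski_topology A d closure_of S"
  shows "f \<phi> = 0"
proof -
  have "closedin (zariski_topology A d) (zero_locus A d {f})"
    unfolding closedin_zariski_topology using f by blast
  moreover have "S \<subseteq> zero_locus A d {f}" using zero S by (auto simp: zero_locus_def)
  ultimately have "zariski_topology A d closure_of S \<subseteq> zero_locus A d {f}"
    by (rule closure_of_minimal[rotated])
  then show ?thesis using assms(4) by (auto simp: zero_locus_def)
qed

lemma polynomial_functions_sum: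
  assumes "finite S" "\<And>i. i \<in> S \<Longrightarrow> f i \<in> polynomial_functions A d"
  shows "(\<lambda>\<phi>. \<Sum>i\<in>S. f i \<phi>) \<in> polynomial_functions A d"
  using assms by (induction rule: finite_induct)
    (auto intro: polynomial_functions.const polynomial_functions.add)

lemma polynomial_functions_prod:
  assumes "finite S" "\<And>i. i \<in> S \<Longrightarrow> f i \<in> polynomial_functions A d"
  shows "(\<lambda>\<phi>. \<Prod>i\<in>S. f i \<phi>) \<in> polynomial_functions A d"
  using assms by (induction rule: finite_induct)
    (auto intro: polynomial_functions.const polynomial_functions.mult)

lemma polynomial_functions_diff:
  assumes "f \<in> polynomial_functions A d" "g \<in> polynomial_functions A d"
  shows "(\<lambda>\<phi>. f \<phi> - g \<phi>) \<in> polynomial_functions A d"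
  using polynomial_functions.add[OF assms(1) polynomial_functions.mult[OF polynomial_functions.const[of "-1"] assms(2)]]
  by simp

lemma polynomial_functions_det:
  assumes "\<And>\<phi>. M \<phi> \<in> carrier_mat n n"
    and "\<And>i j. i < n \<Longrightarrow> j < n \<Longrightarrow> (\<lambda>\<phi>. M \<phi> $$ (i, j)) \<in> polynomial_functions A d"
  shows "(\<lambda>\<phi>. det (M \<phi>)) \<in> polynomial_functions A d"
proof -
  have "(\<lambda>\<phi>. det (M \<phi>)) = (\<lambda>\<phi>. \<Sum>p | p permutes {0..<n}. signof p * (\<Prod>i = 0..<n. M \<phi> $$ (i, p i)))"
    by (rule ext) (rule det_def'[OF assms(1)])
  moreover have "\<dots> \<in> polynomial_functions A d"
    by (intro polynomial_functions_sum polynomial_functions.mult polynomial_functions.const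
        polynomial_functions_prod assms(2)) (simp_all add: permutes_nth_less finite_permutations)
  ultimately show ?thesis by (simp only:)
qed

section \<open>The rank of a bilinear pairing\<close>

text \<open>
  The rank is expressed by non-vanishing minors, because these are polynomial in the entries of the
  pairing, which makes semicontinuity immediate.
\<close>

definition minor :: "('y \<Rightarrow> 'x \<Rightarrow> 'k::field) \<Rightarrow> nat \<Rightarrow> (nat \<Rightarrow> 'y) \<Rightarrow> (nat \<Rightarrow> 'x) \<Rightarrow> 'k mat" where
  "minor B r y x = mat r r (\<lambda>(i, j). B (y i) (x j))"

definition rank_at_least :: "'x set \<Rightarrow> ('y \<Rightarrow> 'x \<Rightarrow> 'k::field) \<Rightarrow> nat \<Rightarrow> bool" where
  "rank_at_least X B r \<longleftrightarrow> (\<exists>y x. (\<forall>j<r. x j \<in> X) \<and> det (minor B r y x) \<noteq> 0)"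

lemma minor_carrier [simp]: "minor B r y x \<in> carrier_mat r r"
  by (simp add: minor_def)

lemma rank_at_least_0: "rank_at_least X B 0"
  unfolding rank_at_least_def minor_def by (auto simp: det_def)

text \<open>A larger minor factors through a matrix with a zero column.\<close>

lemma rank_at_least_bound:
  fixes B :: "'y \<Rightarrow> 'x \<Rightarrow> 'k::field"
  assumes K: "finite K" and B: "\<And>y x. B y x = (\<Sum>q\<in>K. h q y * g q x)" and "rank_at_least X B r"
  shows "r \<le> card K"
proof (rule ccontr)
  assume "\<not> r \<le> card K"
  then have N: "card K < r" by simp
  obtain e where e: "bij_betw e {0..<card K} K" using ex_bij_betw_nat_finite[OF K] by blast
  obtain y x where nz: "det (minor B r y x) \<noteq> 0" using assms(3) by (auto simp: rank_at_least_def)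
  define H where "H = mat r r (\<lambda>(i, q). if q < card K then h (e q) (y i) else 0)"
  define G where "G = mat r r (\<lambda>(q, j). g (e q) (x j))"
  have "minor B r y x = H * G"
  proof (rule eq_matI)
    fix i j assume "i < dim_row (H * G)" "j < dim_col (H * G)"
    then have ij: "i < r" "j < r" by (simp_all add: H_def G_def)
    have "(H * G) $$ (i, j) = (\<Sum>q = 0..<r. (if q < card K then h (e q) (y i) else 0) * g (e q) (x j))"
      using ij by (simp add: H_def G_def scalar_prod_def)
    also have "\<dots> = (\<Sum>q = 0..<card K. h (e q) (y i) * g (e q) (x j))"
      using N by (intro sum.mono_neutral_cong_right) auto
    also have "\<dots> = B (y i) (x j)"
      unfolding B by (rule sum.reindex_bij_betw[OF e])
    finally show "minor B r y x $$ (i, j) = (H * G) $$ (i, j)"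
      using ij by (simp add: minor_def)
  qed (simp_all add: minor_def H_def G_def)
  moreover have "det H = 0"
  proof -
    have "H \<in> carrier_mat r r" by (simp add: H_def)
    then have "det H = (\<Sum>i<r. H $$ (i, card K) * cofactor H i (card K))"
      using laplace_expansion_column N by blast
    also have "\<dots> = 0" using N by (intro sum.neutral) (simp add: H_def)
    finally show ?thesis .
  qed
  moreover have "det (H * G) = det H * det G" by (rule det_mult[of _ r]) (simp_all add: H_def G_def)
  ultimately show False using nz by simp
qed

text \<open>The new column is zero above its last entry.\<close>

lemma det_minor_extend:
  fixes B :: "'y \<Rightarrow> 'x \<Rightarrow> 'k::field"
  assumes kernel: "\<And>i. B (y i) \<iota> = 0" and one: "l \<iota> = 1"
  shows "det (mat (Suc r) (Suc r) (\<lambda>(i, j). (if i = r then l else B (y i)) (if j = r then \<iota> else x j)))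
    = det (minor B r y x)"
proof -
  let ?M = "mat (Suc r) (Suc r) (\<lambda>(i, j). (if i = r then l else B (y i)) (if j = r then \<iota> else x j))"
  have M: "?M \<in> carrier_mat (Suc r) (Suc r)" by simp
  have "det ?M = (\<Sum>i<Suc r. ?M $$ (i, r) * cofactor ?M i r)"
    by (rule laplace_expansion_column[OF M]) simp
  also have "\<dots> = ?M $$ (r, r) * cofactor ?M r r"
    by (simp add: kernel)
  also have "\<dots> = det (mat_delete ?M r r)" by (simp add: one cofactor_def)
  also have "mat_delete ?M r r = minor B r y x"
    by (rule eq_matI) (auto simp: mat_delete_def minor_def)
  finally show ?thesis .
qed


text \<open>
  At \<open>s = 0\<close> the vector \<open>\<iota>\<close> is in the kernel and \<open>l(\<iota>) = 1\<close>, so adding \<open>l\<close> to the rows raises the rank. By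
  semicontinuity the extended rank is not smaller for some \<open>s \<noteq> 0\<close>, where \<open>l\<close> is already a combination of
  the rows.
\<close>

lemma rank_jump:
  fixes B :: "'k::alg_closed_field \<Rightarrow> 'y \<Rightarrow> 'x \<Rightarrow> 'k"
  assumes reg: "\<And>y x. x \<in> X \<Longrightarrow> regular_off 1 (\<lambda>s. B s y x)"
    and l: "\<And>s. s \<noteq> 0 \<Longrightarrow> \<exists>y. \<forall>x\<in>X. B s y x = l x"
    and \<iota>: "\<iota> \<in> X" "\<And>y. B 0 y \<iota> = 0" "l \<iota> = 1"
    and rank: "rank_at_least X (B 0) r"
  shows "\<exists>s. s \<noteq> 0 \<and> rank_at_least X (B s) (Suc r)"
proof -
  obtain y x where x: "\<forall>j<r. x j \<in> X" and nz: "det (minor (B 0) r y x) \<noteq> 0"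
    using rank by (auto simp: rank_at_least_def)
  define M where "M = (\<lambda>s. mat (Suc r) (Suc r)
    (\<lambda>(i, j). (if i = r then l else B s (y i)) (if j = r then \<iota> else x j)))"
  have "det (M 0) \<noteq> 0"
    using nz det_minor_extend[where B = "B 0" and y = y and \<iota> = \<iota> and l = l and r = r and x = x] \<iota>
    by (simp add: M_def)
  moreover have "regular_off 1 (\<lambda>s. det (M s))"
  proof (rule regular_off_det)
    show "M s \<in> carrier_mat (Suc r) (Suc r)" for s by (simp add: M_def)
    fix i j assume "i < Suc r" "j < Suc r"
    then show "regular_off 1 (\<lambda>s. M s $$ (i, j))"
      using x \<iota>(1) by (cases "i = r"; cases "j = r") (simp_all add: M_def regular_off_const reg)
  qed
  ultimately obtain s where s: "s \<noteq> 0" "det (M s) \<noteq> 0"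
    using regular_off_nonzero_avoiding_0[of 1 "\<lambda>s. det (M s)" 0] by auto
  obtain y0 where y0: "\<forall>x\<in>X. B s y0 x = l x" using l[OF s(1)] by blast
  have "M s = minor (B s) (Suc r) (y(r := y0)) (x(r := \<iota>))"
    using x \<iota>(1) y0 by (intro eq_matI) (auto simp: M_def minor_def less_Suc_eq)
  then have "rank_at_least X (B s) (Suc r)"
    using s(2) x \<iota>(1) unfolding rank_at_least_def
    by (intro exI[of _ "y(r := y0)"] exI[of _ "x(r := \<iota>)"]) (auto simp: less_Suc_eq)
  then show ?thesis using s(1) by blast
qed

lemma regular_off_1: "regular_off 1 r \<Longrightarrow> \<exists>p. \<forall>t. r t = poly p t"
  by (auto simp: regular_off_def)

section \<open>Homomorphisms from a string module\<close>

text \<open>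
  A homomorphism from \<open>M(w)\<close> to the module with arrow matrices \<open>M\<close> is a tuple \<open>x\<^sub>0, \<dots>, x\<^sub>n\<close> of vectors
  that are related by the letters \<open>c(1), \<dots>, c(n)\<close> of \<open>w\<close> and killed by the arrows of the letters \<open>c(0)\<close> and
  \<open>c(n + 1)\<close> around \<open>w\<close>. With \<open>x\<^bsub>-1\<^esub> = x\<^bsub>n+1\<^esub> = 0\<close> all these conditions have the same form. The pairing
  \<open>word_pairing\<close> tests the tuple of their defects against arbitrary functionals.
\<close>

definition trunc :: "nat \<Rightarrow> int \<Rightarrow> (int \<Rightarrow> 'k::field vec) \<Rightarrow> int \<Rightarrow> 'k vec" where
  "trunc m n x j = (if 0 \<le> j \<and> j \<le> n then x j else 0\<^sub>v m)"

definition word_defect :: "(int \<Rightarrow> 'a letter) \<Rightarrow> nat \<Rightarrow> int \<Rightarrow> ('a \<Rightarrow> 'k::field mat) \<Rightarrow> (int \<Rightarrow> 'k vec) \<Rightarrow> int \<Rightarrow> 'k vec" where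
  "word_defect c m n M x j = (case c j of
     Dir \<eta> \<Rightarrow> trunc m n x (j - 1) - M \<eta> *\<^sub>v trunc m n x j
   | Inv \<eta> \<Rightarrow> trunc m n x j - M \<eta> *\<^sub>v trunc m n x (j - 1))"

definition word_pairing :: "(int \<Rightarrow> 'a letter) \<Rightarrow> nat \<Rightarrow> int \<Rightarrow> ('a \<Rightarrow> 'k::field mat)
    \<Rightarrow> (int \<times> nat \<Rightarrow> 'k) \<Rightarrow> (int \<Rightarrow> 'k vec) \<Rightarrow> 'k" where
  "word_pairing c m n M y x = (\<Sum>q \<in> {0..n + 1} \<times> {..<m}. y q * word_defect c m n M x (fst q) $ snd q)"

abbreviation word_rank_at_least :: "(int \<Rightarrow> 'a letter) \<Rightarrow> nat \<Rightarrow> int \<Rightarrow> ('a \<Rightarrow> 'k::field mat) \<Rightarrow> nat \<Rightarrow> bool" where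
  "word_rank_at_least c m n M \<equiv> rank_at_least {x. \<forall>j. x j \<in> carrier_vec m} (word_pairing c m n M)"

lemma trunc_carrier: "\<forall>j. x j \<in> carrier_vec m \<Longrightarrow> trunc m n x j \<in> carrier_vec m"
  by (simp add: trunc_def)

lemma word_rank_bound: "word_rank_at_least c m n M r \<Longrightarrow> r \<le> card ({0..n + 1} \<times> {..<m})"
  by (rule rank_at_least_bound[where h = "\<lambda>q y. y q" and g = "\<lambda>q x. word_defect c m n M x (fst q) $ snd q"])
    (simp_all add: word_pairing_def)

lemma word_rank_cong:
  assumes "\<And>j \<eta>. j \<in> {0..n + 1} \<Longrightarrow> c j = Dir \<eta> \<or> c j = Inv \<eta> \<Longrightarrow> M \<eta> = M' \<eta>"
  shows "word_rank_at_least c m n M r \<longleftrightarrow> word_rank_at_least c m n M' r"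
proof -
  have "word_pairing c m n M = word_pairing c m n M'"
    unfolding word_pairing_def fun_eq_iff
    by (intro allI sum.cong) (auto simp: word_defect_def assms split: letter.split)
  then show ?thesis by simp
qed

lemma word_defect_conj:
  assumes P: "P \<in> carrier_mat m m" "P' \<in> carrier_mat m m" "P * P' = 1\<^sub>m m"
    and M: "\<And>\<eta>. c j = Dir \<eta> \<or> c j = Inv \<eta> \<Longrightarrow> M \<eta> \<in> carrier_mat m m"
    and x: "\<forall>j. x j \<in> carrier_vec m"
  shows "word_defect c m n (\<lambda>\<eta>. P * M \<eta> * P') x j = P *\<^sub>v word_defect c m n M (\<lambda>j. P' *\<^sub>v x j) j"
proof -
  have cancel: "P *\<^sub>v (P' *\<^sub>v v) = v" if "v \<in> carrier_vec m" for v
    using assoc_mult_mat_vec[OF P(1,2) that] P(3) that by simp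
  have tr: "trunc m n (\<lambda>j. P' *\<^sub>v x j) k = P' *\<^sub>v trunc m n x k" for k
    using P by (auto simp: trunc_def)
  have "v - (P * X * P') *\<^sub>v w = P *\<^sub>v (P' *\<^sub>v v - X *\<^sub>v (P' *\<^sub>v w))"
    if "v \<in> carrier_vec m" "w \<in> carrier_vec m" "X \<in> carrier_mat m m" for v w X
  proof -
    have "(P * X * P') *\<^sub>v w = P *\<^sub>v (X *\<^sub>v (P' *\<^sub>v w))"
      using that P by (simp add: assoc_mult_mat_vec[of _ m m _ m])
    moreover have "P *\<^sub>v (P' *\<^sub>v v - X *\<^sub>v (P' *\<^sub>v w)) = P *\<^sub>v (P' *\<^sub>v v) - P *\<^sub>v (X *\<^sub>v (P' *\<^sub>v w))"
      by (rule mult_minus_distrib_mat_vec[of _ m m]) (use that P in auto)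
    ultimately show ?thesis using cancel that by simp
  qed
  then show ?thesis
    using trunc_carrier[OF x, of n] M by (auto simp: word_defect_def tr split: letter.split)
qed

lemma word_defect_carrier:
  assumes "\<And>\<eta>. c j = Dir \<eta> \<or> c j = Inv \<eta> \<Longrightarrow> M \<eta> \<in> carrier_mat m m" "\<forall>j. x j \<in> carrier_vec m"
  shows "word_defect c m n M x j \<in> carrier_vec m"
proof (cases "c j")
  case (Dir \<eta>)
  then have "M \<eta> \<in> carrier_mat m m" using assms(1) by simp
  then show ?thesis using Dir using trunc_carrier[OF assms(2), of n]
    by (auto simp: word_defect_def intro!: minus_carrier_vec mult_mat_vec_carrier)
next
  case (Inv \<eta>)
  then have "M \<eta> \<in> carrier_mat m m" using assms(1) by simp
  then show ?thesis using Inv using trunc_carrier[OF assms(2), of n]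
    by (auto simp: word_defect_def intro!: minus_carrier_vec mult_mat_vec_carrier)
qed

text \<open>Conjugating the matrices amounts to linear substitutions in both arguments of the pairing.\<close>

lemma word_rank_conj:
  assumes P: "P \<in> carrier_mat m m" "P' \<in> carrier_mat m m" "P * P' = 1\<^sub>m m"
    and M: "\<And>j \<eta>. c j = Dir \<eta> \<or> c j = Inv \<eta> \<Longrightarrow> M \<eta> \<in> carrier_mat m m"
    and rank: "word_rank_at_least c m n (\<lambda>\<eta>. P * M \<eta> * P') r"
  shows "word_rank_at_least c m n M r"
proof -
  let ?y = "\<lambda>(y :: int \<times> nat \<Rightarrow> 'a) (j, l). \<Sum>i<m. y (j, i) * P $$ (i, l)"
  have pairing: "word_pairing c m n (\<lambda>\<eta>. P * M \<eta> * P') y x = word_pairing c m n M (?y y) (\<lambda>j. P' *\<^sub>v x j)"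
    if x: "\<forall>j. x j \<in> carrier_vec m" for y x
  proof -
    have x': "\<forall>j. P' *\<^sub>v x j \<in> carrier_vec m" using P x by auto
    have entry: "(P *\<^sub>v v) $ i = (\<Sum>l<m. P $$ (i, l) * v $ l)" if "v \<in> carrier_vec m" "i < m" for v i
      using that P by (simp add: scalar_prod_def atLeast0LessThan)
    have "(\<Sum>i<m. y (j, i) * word_defect c m n (\<lambda>\<eta>. P * M \<eta> * P') x j $ i)
        = (\<Sum>l<m. ?y y (j, l) * word_defect c m n M (\<lambda>j. P' *\<^sub>v x j) j $ l)" for j
    proof -
      let ?d = "word_defect c m n M (\<lambda>j. P' *\<^sub>v x j) j"
      have d: "?d \<in> carrier_vec m" by (rule word_defect_carrier[OF M x'])
      have "(\<Sum>i<m. y (j, i) * (P *\<^sub>v ?d) $ i) = (\<Sum>i<m. \<Sum>l<m. y (j, i) * P $$ (i, l) * ?d $ l)"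
        using d by (intro sum.cong) (simp_all add: entry sum_distrib_left mult.assoc)
      also have "\<dots> = (\<Sum>l<m. ?y y (j, l) * ?d $ l)"
        by (subst sum.swap) (simp add: sum_distrib_right)
      also have "P *\<^sub>v ?d = word_defect c m n (\<lambda>\<eta>. P * M \<eta> * P') x j"
        by (rule word_defect_conj[OF P M x, symmetric])
      finally show ?thesis .
    qed
    then show ?thesis
      unfolding word_pairing_def sum.cartesian_product' by simp
  qed
  obtain y x where x: "\<forall>j<r. \<forall>i. x j i \<in> carrier_vec m"
    and nz: "det (minor (word_pairing c m n (\<lambda>\<eta>. P * M \<eta> * P')) r y x) \<noteq> 0"
    using rank by (auto simp: rank_at_least_def)
  have "minor (word_pairing c m n (\<lambda>\<eta>. P * M \<eta> * P')) r y x
      = minor (word_pairing c m n M) r (\<lambda>i. ?y (y i)) (\<lambda>j i. P' *\<^sub>v x j i)"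
    using x by (intro eq_matI) (auto simp: minor_def pairing)
  moreover have "\<forall>j<r. \<forall>i. P' *\<^sub>v x j i \<in> carrier_vec m" using x P by auto
  ultimately show ?thesis
    using nz unfolding rank_at_least_def
    by (intro exI[of _ "\<lambda>i. ?y (y i)"] exI[of _ "\<lambda>j i. P' *\<^sub>v x j i"]) auto
qed

locale closed_bend = bend Q I b m f \<kappa>
  for Q :: "('v, 'a) pre_digraph" and I :: "(('v, 'a) walk \<Rightarrow>\<^sub>0 'k::alg_closed_field) set"
    and b :: "int \<Rightarrow> 'a letter" and m :: nat and f \<kappa> :: int
begin

definition mats :: "'k \<Rightarrow> 'k \<Rightarrow> 'a \<Rightarrow> 'k mat" where
  "mats z s \<eta> = op_mat m (R z s \<eta>)"

lemma regular_off_S: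
  assumes "regular_off D s" "\<And>i. regular_off D (\<lambda>t. Poly_Mapping.lookup (v t) i)"
  shows "regular_off D (\<lambda>t. S (s t) k (v t))"
  unfolding S_def using assms
  by (auto intro!: regular_off_diff regular_off_mult regular_off_const regular_off_if)

lemma regular_off_T:
  assumes "regular_off D s" "regular_off D z"
  shows "regular_off D (\<lambda>t. Poly_Mapping.lookup (T (z t) (s t) k) i)"
proof -
  have "(\<lambda>t. Poly_Mapping.lookup (T (z t) (s t) k) i) =
    (\<lambda>t. if b k \<in> range Dir then Poly_Mapping.lookup (basis_elem (k - 1)) i
     else if k = int m then (if i = 0 then z t else 0) + (if i = f then z t * s t else 0)
     else Poly_Mapping.lookup (basis_elem k) i)"
    by (auto simp: T_def lookup_add lookup_single when_def fun_eq_iff)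
  moreover have "regular_off D \<dots>"
    using assms by (auto intro!: regular_off_if regular_off_add regular_off_mult regular_off_const)
  ultimately show ?thesis by (simp only:)
qed

lemma regular_off_R:
  assumes "regular_off D s" "regular_off D z" "\<And>i. regular_off D (\<lambda>t. Poly_Mapping.lookup (v t) i)"
  shows "regular_off D (\<lambda>t. Poly_Mapping.lookup (R (z t) (s t) \<eta> (v t)) i)"
proof -
  have "(\<lambda>t. Poly_Mapping.lookup (R (z t) (s t) \<eta> (v t)) i) = (\<lambda>t. \<Sum>k = 1..int m.
      if b k = Dir \<eta> \<or> b k = Inv \<eta> then S (s t) k (v t) * Poly_Mapping.lookup (T (z t) (s t) k) i else 0)"
    unfolding R_def lookup_sum by (intro ext sum.cong) auto
  moreover have "regular_off D \<dots>"
    using regular_off_S[OF assms(1,3)] regular_off_T[OF assms(1,2)]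
    by (auto intro!: regular_off_sum regular_off_if regular_off_mult regular_off_const)
  ultimately show ?thesis by (simp only:)
qed

lemma regular_off_U:
  assumes "\<And>i. regular_off D (\<lambda>t. Poly_Mapping.lookup (v t) i)"
  shows "regular_off D (\<lambda>t. Poly_Mapping.lookup (U u (v t)) i)"
  unfolding lookup_U using assms by (auto intro!: regular_off_if regular_off_const)

lemma regular_off_walk_act:
  assumes "regular_off D s" "regular_off D z" "\<And>i. regular_off D (\<lambda>t. Poly_Mapping.lookup (v t) i)"
  shows "regular_off D (\<lambda>t. Poly_Mapping.lookup (walk_act U (R (z t) (s t)) p (v t)) i)"
proof (cases p)
  case (Triv u)
  then show ?thesis using regular_off_U[OF assms(3)] by simp
next
  case (Walk as)
  have "regular_off D (\<lambda>t. Poly_Mapping.lookup (foldr (R (z t) (s t)) as (v t)) i)" for i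
    by (induction as arbitrary: i) (simp_all add: assms regular_off_R)
  then show ?thesis using Walk by simp
qed

lemma regular_off_alg_act:
  assumes "regular_off D s" "regular_off D z"
  shows "regular_off D (\<lambda>t. Poly_Mapping.lookup (alg_act U (R (z t) (s t)) x v) i)"
  unfolding alg_act_def linear_extension_def lookup_sum lookup_pm_scale
  by (intro regular_off_sum regular_off_mult regular_off_const regular_off_walk_act assms)

lemma mats_carrier [simp]: "mats z s \<eta> \<in> carrier_mat m m"
  by (simp add: mats_def)

lemma mats_mult_vec:
  "x \<in> carrier_vec m \<Longrightarrow> i < m \<Longrightarrow> (mats z s \<eta> *\<^sub>v x) $ i = Poly_Mapping.lookup (R z s \<eta> (vec_pm m x)) (int i)"
  unfolding mats_def by (rule op_mat_mult_vec[OF R_linear])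

lemma regular_off_word_pairing:
  assumes "\<forall>j. x j \<in> carrier_vec m"
  shows "regular_off 1 (\<lambda>s. word_pairing c m n (mats z s) y x)"
proof -
  have "regular_off 1 (\<lambda>s. word_defect c m n (mats z s) x j $ i)" if "i < m" for i j
  proof -
    have mv: "regular_off 1 (\<lambda>s. (v - mats z s \<eta> *\<^sub>v w) $ i)" if w: "w \<in> carrier_vec m" for v w \<eta>
    proof -
      have "(\<lambda>s. (v - mats z s \<eta> *\<^sub>v w) $ i)
          = (\<lambda>s. v $ i - Poly_Mapping.lookup (R z s \<eta> (vec_pm m w)) (int i))"
      proof
        fix s
        have "dim_vec (mats z s \<eta> *\<^sub>v w) = m" by (simp add: mats_def op_mat_def)
        then show "(v - mats z s \<eta> *\<^sub>v w) $ i = v $ i - Poly_Mapping.lookup (R z s \<eta> (vec_pm m w)) (int i)"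
          using \<open>i < m\<close> mats_mult_vec[OF w \<open>i < m\<close>] by simp
      qed
      moreover have "regular_off 1 \<dots>"
        by (intro regular_off_diff regular_off_const regular_off_R regular_off_ident)
      ultimately show ?thesis by (simp only:)
    qed
    show ?thesis
      using trunc_carrier[OF assms, of n] mv by (cases "c j") (simp_all add: word_defect_def)
  qed
  then show ?thesis
    unfolding word_pairing_def
    by (intro regular_off_sum regular_off_mult regular_off_const) auto
qed

definition trunc_pm :: "int \<Rightarrow> (int \<Rightarrow> 'k vec) \<Rightarrow> int \<Rightarrow> (int \<Rightarrow>\<^sub>0 'k)" where
  "trunc_pm n x j = vec_pm m (trunc m n x j)"

lemma trunc_pm_outside: "j < 0 \<or> n < j \<Longrightarrow> trunc_pm n x j = 0"
  by (auto simp: trunc_pm_def trunc_def vec_pm_def)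

lemma word_defect_entry:
  assumes x: "\<forall>j. x j \<in> carrier_vec m" and i: "i < m"
  shows "word_defect c m n (mats z s) x j $ i = Poly_Mapping.lookup (case c j of
      Dir \<eta> \<Rightarrow> trunc_pm n x (j - 1) - R z s \<eta> (trunc_pm n x j)
    | Inv \<eta> \<Rightarrow> trunc_pm n x j - R z s \<eta> (trunc_pm n x (j - 1))) (int i)"
proof -
  have "(v - mats z s \<eta> *\<^sub>v w) $ i
      = Poly_Mapping.lookup (vec_pm m v - R z s \<eta> (vec_pm m w)) (int i)"
    if "w \<in> carrier_vec m" for v w \<eta>
  proof -
    have "dim_vec (mats z s \<eta> *\<^sub>v w) = m" by (simp add: mats_def op_mat_def)
    then show ?thesis using i mats_mult_vec[OF that i] by (simp add: lookup_minus lookup_vec_pm)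
  qed
  then show ?thesis
    using trunc_carrier[OF x, of n] by (simp add: word_defect_def trunc_pm_def split: letter.split)
qed

text \<open>
  The functional of \<open>rank_jump\<close> is the coordinate of \<open>x\<^sub>0\<close> at \<open>e\<^sub>0\<close>. The factor copy of \<open>w\<close> occupies the
  positions \<open>pos(0), \<dots>, pos(n)\<close>, and \<open>co\<close> accounts for the factor \<open>z\<close> picked up when it passes the edge \<open>m\<close>.
  Up to the defects, the coordinate of \<open>x\<^sub>j\<close> at \<open>pos(j)\<close> is independent of \<open>j\<close>; it vanishes at the right
  end, where the arrow of \<open>c(n + 1)\<close> leaves the factor copy, and hence at the left end. There the arrow
  \<open>\<gamma>\<close> reads the difference of this coordinate and \<open>s\<close> times the one at \<open>e\<^sub>0\<close>.
\<close>

lemma word_rank_jump: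
  fixes c :: "int \<Rightarrow> 'a letter" and n :: int and pos :: "int \<Rightarrow> int" and co :: "int \<Rightarrow> 'k"
  assumes n: "0 \<le> n" "n < int m"
    and c_0: "c 0 = Dir \<gamma>" and c_n: "c (n + 1) = Inv \<delta>" and w: "\<And>j. 1 \<le> j \<Longrightarrow> j \<le> n \<Longrightarrow> c j = b j"
    and b_1: "b 1 \<noteq> Inv \<gamma>" and b_n: "b (n + 1) \<in> range Dir" "1 \<le> n \<Longrightarrow> b n \<noteq> Dir \<delta>"
    and pos: "\<And>j. 0 \<le> j \<Longrightarrow> j \<le> n + 1 \<Longrightarrow> 0 \<le> pos j \<and> pos j < int m"
    and dir_row: "\<And>s \<eta> j x. 1 \<le> j \<Longrightarrow> j \<le> n \<Longrightarrow> c j = Dir \<eta> \<Longrightarrow>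
      co (j - 1) * Poly_Mapping.lookup (R z s \<eta> x) (pos (j - 1)) = co j * Poly_Mapping.lookup x (pos j)"
    and inv_row: "\<And>s \<eta> j x. 1 \<le> j \<Longrightarrow> j \<le> n + 1 \<Longrightarrow> c j = Inv \<eta> \<Longrightarrow>
      co j * Poly_Mapping.lookup (R z s \<eta> x) (pos j) = co (j - 1) * Poly_Mapping.lookup x (pos (j - 1))"
    and g: "0 \<le> g" "g < int m" "\<nu> \<noteq> 0"
    and start: "\<And>s x. Poly_Mapping.lookup (R z s \<gamma> x) g
      = \<nu> * (co 0 * Poly_Mapping.lookup x (pos 0) - s * Poly_Mapping.lookup x 0)"
    and rank: "word_rank_at_least c m n (mats z 0) r"
  shows "\<exists>s. s \<noteq> 0 \<and> word_rank_at_least c m n (mats z s) (Suc r)"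
proof (rule rank_jump[where l = "\<lambda>x. x 0 $ 0" and \<iota> = "\<lambda>j. unit_vec m (nat j)"])
  let ?X = "{x. \<forall>j. x j \<in> carrier_vec m} :: (int \<Rightarrow> 'k vec) set"
  let ?B = "\<lambda>s. word_pairing c m n (mats z s)"
  let ?\<iota> = "\<lambda>j. unit_vec m (nat j) :: 'k vec"
  show "rank_at_least ?X (?B 0) r" by (rule rank)
  show "?\<iota> \<in> ?X" by simp
  show "?\<iota> 0 $ 0 = 1" using m_pos by simp
  show "?B 0 y ?\<iota> = 0" for y
  proof -
    have uX: "\<forall>j. ?\<iota> j \<in> carrier_vec m" by simp
    have e: "trunc_pm n ?\<iota> j = basis_elem j" if "0 \<le> j" "j \<le> n" for j
    proof -
      have "vec_pm m (unit_vec m (nat j)) = (\<Sum>i<m. if i = nat j then basis_elem j else 0 :: int \<Rightarrow>\<^sub>0 'k)"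
        using that n unfolding vec_pm_def by (intro sum.cong) auto
      then show ?thesis using that n by (simp add: trunc_pm_def trunc_def nat_less_iff)
    qed
    have R0: "R z 0 \<eta> (trunc_pm n ?\<iota> j) = (if b j = Dir \<eta> then basis_elem (j - 1)
        else if b (j + 1) = Inv \<eta> then T z 0 (j + 1) else 0)" if "0 \<le> j" "j \<le> n" for j \<eta>
      using R_basis[of j z 0 \<eta>] that n e by simp
    have "word_defect c m n (mats z 0) ?\<iota> j $ i = 0" if j: "j \<in> {0..n + 1}" and i: "i < m" for i j
    proof -
      consider "j = 0" | "1 \<le> j" "j \<le> n" | "j = n + 1" using j n by force
      then show ?thesis
      proof cases
        case 1
        then show ?thesis
          using word_defect_entry[OF uX i, of c n z 0 j] c_0 R0[of 0 \<gamma>] b_not_Dir(1)[of \<gamma>] b_1 n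
          by (simp add: trunc_pm_outside)
      next
        case 2
        have "T z 0 j = basis_elem j" if "b j = Inv \<eta>" for \<eta> using 2 n that by (simp add: T_def)
        moreover have "b (j - 1) \<noteq> Dir \<eta>" if "b j = Inv \<eta>" for \<eta>
          using quasi_band_not_inverse(1)[OF qb, of "j - 1" \<eta>] that by auto
        ultimately show ?thesis
          using word_defect_entry[OF uX i, of c n z 0 j] w[OF 2] R0[of j] R0[of "j - 1"] e[of j] e[of "j - 1"] 2
          by (auto split: letter.split)
      next
        case 3
        have "b n \<noteq> Dir \<delta>" using b_n(2) b_not_Dir(1) n(1) by (cases "n = 0") auto
        then show ?thesis
          using word_defect_entry[OF uX i, of c n z 0 j] c_n 3 R0[of n \<delta>] b_n(1) n
          by (auto simp: trunc_pm_outside)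
      qed
    qed
    then show ?thesis unfolding word_pairing_def by (intro sum.neutral) auto
  qed
  fix s :: 'k assume s: "s \<noteq> 0"
  \<comment> \<open>functionals that are combinations of the defects\<close>
  define rep where "rep = (\<lambda>l. \<exists>y. \<forall>x\<in>?X. ?B s y x = l x)"
  have rep_entry: "rep (\<lambda>x. a * word_defect c m n (mats z s) x j $ i)" if "j \<in> {0..n + 1}" "i < m" for a i j
  proof -
    let ?y = "\<lambda>q. if q = (j, i) then a else 0"
    have "?B s ?y x = a * word_defect c m n (mats z s) x j $ i" for x
    proof -
      have "?B s ?y x = (\<Sum>q \<in> {0..n + 1} \<times> {..<m}.
          if q = (j, i) then a * word_defect c m n (mats z s) x j $ i else 0)"
        unfolding word_pairing_def by (rule sum.cong) auto
      also have "\<dots> = a * word_defect c m n (mats z s) x j $ i"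
        using that by (subst sum.delta) auto
      finally show ?thesis .
    qed
    then show ?thesis unfolding rep_def by blast
  qed
  have rep_0: "rep (\<lambda>x. 0)"
    unfolding rep_def by (rule exI[of _ "\<lambda>_. 0"]) (simp add: word_pairing_def)
  have rep_add: "rep (\<lambda>x. l x + l' x)" if "rep l" "rep l'" for l l'
  proof -
    obtain y y' where y: "\<forall>x\<in>?X. ?B s y x = l x" "\<forall>x\<in>?X. ?B s y' x = l' x"
      using \<open>rep l\<close> \<open>rep l'\<close> unfolding rep_def by blast
    have "?B s (\<lambda>q. y q + y' q) x = ?B s y x + ?B s y' x" for x
      by (simp add: word_pairing_def distrib_right sum.distrib)
    then show ?thesis unfolding rep_def using y by (intro exI[of _ "\<lambda>q. y q + y' q"]) simp
  qed
  have rep_scale: "rep (\<lambda>x. a * l x)" if "rep l" for a l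
  proof -
    obtain y where y: "\<forall>x\<in>?X. ?B s y x = l x" using \<open>rep l\<close> unfolding rep_def by blast
    have "?B s (\<lambda>q. a * y q) x = a * ?B s y x" for x
      by (simp add: word_pairing_def sum_distrib_left mult.assoc)
    then show ?thesis unfolding rep_def using y by (intro exI[of _ "\<lambda>q. a * y q"]) simp
  qed
  have rep_cong: "rep l" if "rep l'" "\<And>x. \<forall>j. x j \<in> carrier_vec m \<Longrightarrow> l x = l' x" for l l'
    using that unfolding rep_def by simp
  define l where "l = (\<lambda>j x. co j * Poly_Mapping.lookup (trunc_pm n x j) (pos j))"
  have chain: "int k \<le> n + 1 \<Longrightarrow> rep (l (n + 1 - int k))" for k
  proof (induction k)
    case 0
    then show ?case by (simp add: l_def trunc_pm_outside rep_0)
  next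
    case (Suc k)
    define j where "j = n + 1 - int k"
    have j: "1 \<le> j" "j \<le> n + 1" using Suc.prems by (simp_all add: j_def)
    have IH: "rep (l j)" using Suc by (simp add: j_def)
    have "rep (l (j - 1))"
    proof (cases "c j")
      case (Dir \<eta>)
      then have "j \<le> n" using j c_n by (cases "j = n + 1") auto
      have p: "0 \<le> pos (j - 1)" "pos (j - 1) < int m" using pos[of "j - 1"] j by simp_all
      have "rep (\<lambda>x. co (j - 1) * word_defect c m n (mats z s) x j $ nat (pos (j - 1)) + l j x)"
        using j p by (intro rep_add IH rep_entry) auto
      then show ?thesis
      proof (rule rep_cong)
        fix x :: "int \<Rightarrow> 'k vec" assume x: "\<forall>j. x j \<in> carrier_vec m"
        have "word_defect c m n (mats z s) x j $ nat (pos (j - 1))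
            = Poly_Mapping.lookup (trunc_pm n x (j - 1)) (pos (j - 1))
              - Poly_Mapping.lookup (R z s \<eta> (trunc_pm n x j)) (pos (j - 1))"
          using word_defect_entry[OF x, of "nat (pos (j - 1))" c n z s j] p Dir by (simp add: lookup_minus nat_less_iff)
        then show "l (j - 1) x = co (j - 1) * word_defect c m n (mats z s) x j $ nat (pos (j - 1)) + l j x"
          unfolding l_def dir_row[OF j(1) \<open>j \<le> n\<close> Dir, of s "trunc_pm n x j", symmetric]
          by (simp add: right_diff_distrib)
      qed
    next
      case (Inv \<eta>)
      have p: "0 \<le> pos j" "pos j < int m" using pos[of j] j by simp_all
      have "rep (\<lambda>x. - co j * word_defect c m n (mats z s) x j $ nat (pos j) + l j x)"
        using j p by (intro rep_add IH rep_entry) auto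
      then show ?thesis
      proof (rule rep_cong)
        fix x :: "int \<Rightarrow> 'k vec" assume x: "\<forall>j. x j \<in> carrier_vec m"
        have "word_defect c m n (mats z s) x j $ nat (pos j)
            = Poly_Mapping.lookup (trunc_pm n x j) (pos j)
              - Poly_Mapping.lookup (R z s \<eta> (trunc_pm n x (j - 1))) (pos j)"
          using word_defect_entry[OF x, of "nat (pos j)" c n z s j] p Inv by (simp add: lookup_minus nat_less_iff)
        then show "l (j - 1) x = - co j * word_defect c m n (mats z s) x j $ nat (pos j) + l j x"
          unfolding l_def inv_row[OF j Inv, of s "trunc_pm n x (j - 1)", symmetric]
          by (simp add: right_diff_distrib)
      qed
    qed
    then show ?case by (simp add: j_def algebra_simps)
  qed
  have "rep (l 0)" using chain[of "nat (n + 1)"] n by simp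
  then have "rep (\<lambda>x. inverse s * (l 0 x + inverse \<nu> * word_defect c m n (mats z s) x 0 $ nat g))"
    using n g by (intro rep_scale rep_add rep_entry) (auto simp: nat_less_iff)
  then have "rep (\<lambda>x. x 0 $ 0)"
  proof (rule rep_cong)
    fix x :: "int \<Rightarrow> 'k vec" assume x: "\<forall>j. x j \<in> carrier_vec m"
    have x0: "x 0 $ 0 = Poly_Mapping.lookup (trunc_pm n x 0) 0"
      using n m_pos lookup_vec_pm[of 0 m "x 0"] by (simp add: trunc_pm_def trunc_def)
    have defect: "word_defect c m n (mats z s) x 0 $ nat g
        = - Poly_Mapping.lookup (R z s \<gamma> (trunc_pm n x 0)) g"
      using word_defect_entry[OF x, of "nat g" c n z s 0] g c_0
      by (simp add: lookup_minus trunc_pm_outside nat_less_iff)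
    have cancel: "inverse \<nu> * (\<nu> * a) = a" for a
      using g(3) by (simp add: mult.assoc[symmetric])
    have "inverse \<nu> * word_defect c m n (mats z s) x 0 $ nat g
        = - (l 0 x - s * Poly_Mapping.lookup (trunc_pm n x 0) 0)"
      unfolding defect start l_def mult_minus_right cancel ..
    then show "x 0 $ 0 = inverse s * (l 0 x + inverse \<nu> * word_defect c m n (mats z s) x 0 $ nat g)"
      using s x0 by simp
  qed
  then show "\<exists>y. \<forall>x\<in>?X. ?B s y x = x 0 $ 0" unfolding rep_def .
next
qed (use regular_off_word_pairing in simp)

end

section \<open>The family of bent representations\<close>

context closed_bend
begin

lemma S_off:
  "k \<noteq> \<kappa> \<Longrightarrow> b k = Dir \<eta> \<Longrightarrow> S s k x = Poly_Mapping.lookup x k"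
  "k \<noteq> \<kappa> \<Longrightarrow> b k = Inv \<eta> \<Longrightarrow> S s k x = Poly_Mapping.lookup x (k - 1)"
  by (simp_all add: S_def src_def)

lemma S_\<kappa>: "S s \<kappa> x = Poly_Mapping.lookup x f - s * Poly_Mapping.lookup x 0"
  by (simp add: S_def src_\<kappa>)

text \<open>
  The factor copy starts at \<open>f\<close> and may pass the edge \<open>m\<close>, but not more than once: if \<open>w\<close> had \<open>m\<close>
  letters, the inverse letter \<open>b(m)\<close> would be equal to \<open>b(f + m) = b(f)\<close>, which is direct.
\<close>

lemma word_rank_jump_two_bands:
  fixes n :: int
  assumes z: "z \<noteq> 0" and \<kappa>: "\<kappa> = f" "b f = Dir \<gamma>" and b_1: "b 1 \<noteq> Inv \<gamma>"
    and n: "0 \<le> n" and w: "\<And>j. 1 \<le> j \<Longrightarrow> j \<le> n \<Longrightarrow> b (f + j) = b j"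
    and b_n: "b (n + 1) \<in> range Dir" "b (f + n + 1) = Inv \<delta>"
    and rank: "word_rank_at_least (\<lambda>j. b (f + j)) m n (mats z 0) r"
  shows "\<exists>s. s \<noteq> 0 \<and> word_rank_at_least (\<lambda>j. b (f + j)) m n (mats z s) (Suc r)"
proof -
  define pos where "pos = (\<lambda>j. if f + j < int m then f + j else f + j - int m)"
  define co where "co = (\<lambda>j. if f + j < int m then 1 else inverse z)"
  have per: "b (f + int m) = b f" using quasi_band_period[OF qb, of f 1] by simp
  have n_m: "n < int m"
  proof (rule ccontr)
    assume "\<not> n < int m"
    then have "b (f + int m) = b (int m)" using w[of "int m"] m_pos by simp
    then show False using per \<kappa> b_m by auto
  qed
  have n1_m: "n + 1 < int m"
  proof (rule ccontr)
    assume "\<not> n + 1 < int m"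
    then have "f + n + 1 = f + int m" using n_m by simp
    then have "b (f + int m) = Inv \<delta>" using b_n(2) by (simp only:)
    then show False using per \<kappa>(2) by simp
  qed
  have b_pos: "b (pos j) = b (f + j)" for j
    using quasi_band_period[OF qb, of "f + j" "-1"] by (simp add: pos_def)
  show ?thesis
  proof (rule word_rank_jump[where pos = pos and co = co and g = "f - 1" and \<nu> = 1 and \<delta> = \<delta>])
    show "b (f + 0) = Dir \<gamma>" "b (f + (n + 1)) = Inv \<delta>" using \<kappa> b_n by (simp_all add: add.assoc)
    show "b n \<noteq> Dir \<delta>" if "1 \<le> n"
      using w[of n] that b_n(2) quasi_band_not_inverse(1)[OF qb, of "f + n" \<delta>] by (auto simp: add.assoc)
    show "0 \<le> pos j \<and> pos j < int m" if "0 \<le> j" "j \<le> n + 1" for j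
      using that n1_m f_bounds by (auto simp: pos_def)
    show "co (j - 1) * Poly_Mapping.lookup (R z s \<eta> x) (pos (j - 1)) = co j * Poly_Mapping.lookup x (pos j)"
      if j: "1 \<le> j" "j \<le> n" "b (f + j) = Dir \<eta>" for s \<eta> j x
    proof -
      have ne: "f + j \<noteq> int m" using j(3) b_m by auto
      then have p: "pos (j - 1) = pos j - 1" "co (j - 1) = co j" "0 \<le> pos j - 1" "pos j - 1 < int m"
        using j n1_m f_bounds by (auto simp: pos_def co_def)
      have b_j: "b (pos j) = Dir \<eta>" using b_pos j by simp
      then have "b (pos j - 1) \<noteq> Inv \<eta>"
        using quasi_band_not_inverse(2)[OF qb, of "pos j - 1" \<eta>] by auto
      moreover have "\<not> (pos j - 1 = f \<and> b 0 = Inv \<eta>)"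
      proof
        assume *: "pos j - 1 = f \<and> b 0 = Inv \<eta>"
        then have "j = 1" using j n1_m by (auto simp: pos_def split: if_splits)
        then show False using * w[of 1] j quasi_band_not_inverse(2)[OF qb, of 0 \<eta>] by auto
      qed
      moreover have "pos j \<noteq> f" using j n1_m by (auto simp: pos_def)
      then have "S s (pos j) x = Poly_Mapping.lookup x (pos j)"
        using b_j \<kappa>(1) by (intro S_off) auto
      ultimately show ?thesis
        using lookup_R[OF p(3,4), of z s \<eta> x] b_j p(1,2) by auto
    qed
    show "co j * Poly_Mapping.lookup (R z s \<eta> x) (pos j) = co (j - 1) * Poly_Mapping.lookup x (pos (j - 1))"
      if j: "1 \<le> j" "j \<le> n + 1" "b (f + j) = Inv \<eta>" for s \<eta> j x
    proof -
      have p: "0 \<le> pos j" "pos j < int m" using j n1_m f_bounds by (auto simp: pos_def)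
      have b_j: "b (pos j) = Inv \<eta>" using b_pos j by simp
      have ne: "pos j \<noteq> f" using j n1_m by (auto simp: pos_def)
      have "b (pos j + 1) \<noteq> Dir \<eta>" using quasi_band_not_inverse(2)[OF qb b_j] .
      then have R: "Poly_Mapping.lookup (R z s \<eta> x) (pos j)
          = (if pos j = 0 then z * S s (int m) x else S s (pos j) x)"
        using lookup_R[OF p, of z s \<eta> x] b_j ne by simp
      show ?thesis
      proof (cases "pos j = 0")
        case True
        then have fj: "f + j = int m" using j f_bounds by (auto simp: pos_def split: if_splits)
        have "S s (int m) x = Poly_Mapping.lookup x (int m - 1)"
        proof -
          obtain \<alpha> where "b (int m) = Inv \<alpha>" using b_m by auto
          moreover have "int m \<noteq> \<kappa>" using \<kappa>(1) f_bounds by simp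
          ultimately show ?thesis by (rule S_off(2)[rotated])
        qed
        moreover have "pos (j - 1) = int m - 1" "co (j - 1) = 1" "co j = inverse z"
          using fj by (simp_all add: pos_def co_def)
        ultimately show ?thesis using R True z by simp
      next
        case False
        then have "f + j \<noteq> int m" by (auto simp: pos_def)
        then have "pos (j - 1) = pos j - 1" "co (j - 1) = co j" by (auto simp: pos_def co_def)
        moreover have "S s (pos j) x = Poly_Mapping.lookup x (pos j - 1)"
          using b_j ne \<kappa>(1) by (intro S_off) auto
        ultimately show ?thesis using R False by simp
      qed
    qed
    show "0 \<le> f - 1" "f - 1 < int m" using f_bounds by simp_all
    show "Poly_Mapping.lookup (R z s \<gamma> x) (f - 1)
        = 1 * (co 0 * Poly_Mapping.lookup x (pos 0) - s * Poly_Mapping.lookup x 0)" for s x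
    proof -
      have "b (f - 1) \<noteq> Inv \<gamma>" using quasi_band_not_inverse(2)[OF qb, of "f - 1" \<gamma>] \<kappa> by auto
      moreover have "S s f x = Poly_Mapping.lookup x f - s * Poly_Mapping.lookup x 0"
        using S_\<kappa>[of s x] \<kappa>(1) by simp
      ultimately show ?thesis
        using lookup_R[of "f - 1" z s \<gamma> x] f_bounds \<kappa> by (simp add: co_def pos_def)
    qed
  qed (use n n_m w b_1 b_n rank in auto)
qed

text \<open>
  The factor copy is read backwards from \<open>f\<close>. The arrow \<open>\<gamma>\<close> maps \<open>e\<^sub>f\<close> to \<open>e\<^bsub>f+1\<^esub>\<close>, unless \<open>f + 1 = m\<close> and
  the edges \<open>\<kappa>\<close> and \<open>m\<close> coincide.
\<close>

lemma word_rank_jump_one_band: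
  fixes n :: int
  defines "c \<equiv> \<lambda>j. letter_inv (b (f + 1 - j))"
  assumes z: "z \<noteq> 0" and \<kappa>: "\<kappa> = f + 1" "b (f + 1) = Inv \<gamma>" and b_1: "b 1 \<noteq> Inv \<gamma>"
    and n: "0 \<le> n" "n < f" and w: "\<And>j. 1 \<le> j \<Longrightarrow> j \<le> n \<Longrightarrow> c j = b j"
    and b_n: "b (n + 1) \<in> range Dir" "c (n + 1) = Inv \<delta>"
    and rank: "word_rank_at_least c m n (mats z 0) r"
  shows "\<exists>s. s \<noteq> 0 \<and> word_rank_at_least c m n (mats z s) (Suc r)"
proof (rule word_rank_jump[where pos = "\<lambda>j. f - j" and co = "\<lambda>_. 1" and \<delta> = \<delta>
      and g = "if f + 1 = int m then 0 else f + 1" and \<nu> = "if f + 1 = int m then z else 1"])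
  show "c 0 = Dir \<gamma>" using \<kappa> by (simp add: c_def)
  have not_inv: "c j = Dir \<eta> \<Longrightarrow> c (j + 1) \<noteq> Inv \<eta>" for j \<eta>
    using quasi_band_not_inverse(2)[OF qb, of "f - j" \<eta>] quasi_band_not_inverse(1)[OF qb, of "f - j" \<eta>]
    by (auto simp: c_def algebra_simps)
  show "b n \<noteq> Dir \<delta>" if "1 \<le> n" using w[of n] that b_n(2) not_inv[of n \<delta>] by auto
  show "1 * Poly_Mapping.lookup (R z s \<eta> x) (f - (j - 1)) = 1 * Poly_Mapping.lookup x (f - j)"
    if j: "1 \<le> j" "j \<le> n" "c j = Dir \<eta>" for s \<eta> j x
  proof -
    define i where "i = f - (j - 1)"
    have i: "1 \<le> i" "i < int m" "b i = Inv \<eta>"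
      using j n f_bounds by (simp_all add: i_def c_def algebra_simps)
    have "b (i + 1) \<noteq> Dir \<eta>" using quasi_band_not_inverse(2)[OF qb i(3)] .
    moreover have "\<not> (i = f \<and> b 0 = Inv \<eta>)"
    proof
      assume *: "i = f \<and> b 0 = Inv \<eta>"
      then have "j = 1" by (simp add: i_def)
      then show False using * w[of 1] j quasi_band_not_inverse(2)[OF qb, of 0 \<eta>] by auto
    qed
    moreover have "i \<noteq> \<kappa>" using \<kappa>(1) j by (simp add: i_def)
    then have "S s i x = Poly_Mapping.lookup x (i - 1)"
      using i(3) by (simp add: S_def src_def)
    ultimately have "Poly_Mapping.lookup (R z s \<eta> x) i = Poly_Mapping.lookup x (i - 1)"
      using lookup_R[of i z s \<eta> x] i by auto
    then show ?thesis by (simp add: i_def)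
  qed
  show "1 * Poly_Mapping.lookup (R z s \<eta> x) (f - j) = 1 * Poly_Mapping.lookup x (f - (j - 1))"
    if j: "1 \<le> j" "j \<le> n + 1" "c j = Inv \<eta>" for s \<eta> j x
  proof -
    define i where "i = f - j"
    have i: "0 \<le> i" "i < int m" "b (i + 1) = Dir \<eta>" "i \<noteq> f"
      using j n f_bounds by (simp_all add: i_def c_def algebra_simps)
    have "b i \<noteq> Inv \<eta>" using quasi_band_not_inverse(2)[OF qb, of i \<eta>] i(3) by auto
    moreover have "i + 1 \<noteq> \<kappa>" using \<kappa>(1) j by (simp add: i_def)
    then have "S s (i + 1) x = Poly_Mapping.lookup x (i + 1)"
      using i(3) by (simp add: S_def src_def)
    ultimately have "Poly_Mapping.lookup (R z s \<eta> x) i = Poly_Mapping.lookup x (i + 1)"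
      using lookup_R[of i z s \<eta> x] i by simp
    then show ?thesis by (simp add: i_def algebra_simps)
  qed
  show "Poly_Mapping.lookup (R z s \<gamma> x) (if f + 1 = int m then 0 else f + 1)
      = (if f + 1 = int m then z else 1) * (1 * Poly_Mapping.lookup x (f - 0) - s * Poly_Mapping.lookup x 0)" for s x
  proof -
    have S: "S s (f + 1) x = Poly_Mapping.lookup x f - s * Poly_Mapping.lookup x 0"
      using S_\<kappa>[of s x] \<kappa>(1) by simp
    show ?thesis
    proof (cases "f + 1 = int m")
      case True
      then have "b 0 = Inv \<gamma>" using \<kappa> b_0 by simp
      then have "b 1 \<noteq> Dir \<gamma>" using quasi_band_not_inverse(2)[OF qb, of 0 \<gamma>] by simp
      then show ?thesis
        using lookup_R[of 0 z s \<gamma> x] m_pos True \<open>b 0 = Inv \<gamma>\<close> S f_bounds by simp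
    next
      case False
      have "b (f + 1 + 1) \<noteq> Dir \<gamma>" using quasi_band_not_inverse(2)[OF qb \<kappa>(2)] .
      then show ?thesis
        using lookup_R[of "f + 1" z s \<gamma> x] False \<kappa> S f_bounds by (simp add: add.assoc)
    qed
  qed
qed (use n w b_1 b_n rank z f_bounds in auto)

definition point :: "'k \<Rightarrow> 'k \<Rightarrow> (('v, 'a) walk \<Rightarrow>\<^sub>0 'k) set \<Rightarrow> 'k mat" where
  "point z s = bound_rep.rep_point Q I U (R z s) m"

definition bent_family :: "((('v, 'a) walk \<Rightarrow>\<^sub>0 'k) set \<Rightarrow> 'k mat) set" where
  "bent_family = {conj_point P P' (point z s) | P P' z s. P \<in> carrier_mat m m \<and> P' \<in> carrier_mat m m \<and>
     P * P' = 1\<^sub>m m \<and> P' * P = 1\<^sub>m m \<and> z \<noteq> 0}"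

lemma point_cls:
  assumes "bound_rep Q I U (R z s) m" "x \<in> carrier PA"
  shows "point z s (cls x) = op_mat m (alg_act U (R z s) x)"
  unfolding point_def by (rule bound_rep.rep_point_cls[OF assms])

lemma point_arrow:
  assumes "bound_rep Q I U (R z s) m" "\<eta> \<in> arcs Q"
  shows "point z s (cls (basis_elem (Walk [\<eta>]))) = mats z s \<eta>"
proof -
  interpret bound_rep Q I U "R z s" m by (rule assms)
  have "Walk [\<eta>] \<in> paths Q" using assms(2) by (simp add: paths_Walk_iff)
  then show ?thesis
    using point_cls[OF assms(1) basis_in_carrier] by (simp add: mats_def op_mat_def alg_act_basis)
qed

lemma point_in_module_variety:
  assumes "bound_rep Q I U (R z s) m" shows "point z s \<in> module_variety A m"
  unfolding point_def by (rule bound_rep.rep_point_in_module_variety[OF assms])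

lemma adj_mat_entry: "i < m \<Longrightarrow> j < m \<Longrightarrow> P \<in> carrier_mat m m \<Longrightarrow> adj_mat P $$ (i, j) = cofactor P j i"
  by (simp add: adj_mat_def)

text \<open>
  Two points are joined by interpolating \<open>P\<close>, \<open>z\<close> and \<open>s\<close> linearly; the parameters to be avoided are
  the zeros of \<open>det P\<close> and \<open>z\<close>.
\<close>

lemma bent_family_irreducible:
  assumes ok: "\<And>z s. z \<noteq> 0 \<Longrightarrow> bound_rep Q I U (R z s) m"
  shows "irreducible_in (zariski_topology A m) bent_family"
proof (rule irreducible_in_zariski_if_curves)
  show "bent_family \<subseteq> module_variety A m"
    using ok point_in_module_variety conj_point_in_module_variety by (auto simp: bent_family_def)
  have "conj_point (1\<^sub>m m) (1\<^sub>m m) (point 1 0) \<in> bent_family"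
    unfolding bent_family_def by (rule CollectI, intro exI conjI refl) auto
  then show "bent_family \<noteq> {}" by blast
  fix \<phi> \<psi> assume "\<phi> \<in> bent_family" "\<psi> \<in> bent_family"
  then obtain P0 P0' z0 s0 P1 P1' z1 s1
    where \<phi>: "\<phi> = conj_point P0 P0' (point z0 s0)" "z0 \<noteq> 0"
      and P0: "P0 \<in> carrier_mat m m" "P0' \<in> carrier_mat m m" "P0 * P0' = 1\<^sub>m m" "P0' * P0 = 1\<^sub>m m"
      and \<psi>: "\<psi> = conj_point P1 P1' (point z1 s1)" "z1 \<noteq> 0"
      and P1: "P1 \<in> carrier_mat m m" "P1' \<in> carrier_mat m m" "P1 * P1' = 1\<^sub>m m" "P1' * P1 = 1\<^sub>m m"
    unfolding bent_family_def by auto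
  define P where "P = (\<lambda>t. mat m m (\<lambda>(i, j). (1 - t) * P0 $$ (i, j) + t * P1 $$ (i, j)))"
  have P: "P t \<in> carrier_mat m m" for t by (simp add: P_def)
  have P_reg: "regular_off D (\<lambda>t. P t $$ (i, j))" if "i < m" "j < m" for D i j
    using that unfolding P_def
    by (auto intro!: regular_off_add regular_off_mult regular_off_diff regular_off_const regular_off_ident)
  have P_ends: "P 0 = P0" "P 1 = P1" using P0 P1 by (auto simp: P_def intro!: eq_matI)
  obtain dp where dp: "\<And>t. det (P t) = poly dp t"
    using regular_off_1[OF regular_off_det[OF P P_reg]] by blast
  define zp where "zp = [:z0, z1 - z0:]"
  define sp where "sp = [:s0, s1 - s0:]"
  define D where "D = dp * zp"
  define P' where "P' = (\<lambda>t. inverse (poly dp t) \<cdot>\<^sub>m adj_mat (P t))"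
  define \<gamma> where "\<gamma> = (\<lambda>t. conj_point (P t) (P' t) (point (poly zp t) (poly sp t)))"
  have P': "P' t \<in> carrier_mat m m" for t using adj_mat(1)[OF P] by (simp add: P'_def)
  have scale_one: "inverse a \<cdot>\<^sub>m (a \<cdot>\<^sub>m 1\<^sub>m m) = 1\<^sub>m m" if "a \<noteq> 0" for a :: 'k
    by (rule eq_matI) (use that in auto)
  have inv: "P t * P' t = 1\<^sub>m m" "P' t * P t = 1\<^sub>m m" if "poly dp t \<noteq> 0" for t
    using adj_mat[OF P[of t]] that P[of t] scale_one[OF that]
    by (simp_all add: P'_def dp mult_smult_distrib[of _ m m _ m] mult_smult_assoc_mat[of _ m m _ m])
  have inv_unique: "X' = Y'" if "X \<in> carrier_mat m m" "X' \<in> carrier_mat m m" "Y' \<in> carrier_mat m m"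
    "X * Y' = 1\<^sub>m m" "X' * X = 1\<^sub>m m" for X X' Y' :: "'k mat"
  proof -
    have "X' = X' * (X * Y')" using that by simp
    also have "\<dots> = (X' * X) * Y'" by (rule assoc_mult_mat[symmetric, of _ m m _ m _ m]) (use that in auto)
    finally show ?thesis using that by simp
  qed
  have det_nz: "det X \<noteq> 0" if "X \<in> carrier_mat m m" "X' \<in> carrier_mat m m" "X * X' = 1\<^sub>m m" for X X' :: "'k mat"
  proof -
    have "det X * det X' = 1" using det_mult[OF that(1,2)] that(3) by simp
    then show ?thesis by auto
  qed
  have ends: "poly dp 0 \<noteq> 0" "poly dp 1 \<noteq> 0"
    using det_nz[OF P0(1-3)] det_nz[OF P1(1-3)] dp[of 0] dp[of 1] P_ends by simp_all
  show "\<exists>D \<gamma>. poly D 0 \<noteq> 0 \<and> poly D 1 \<noteq> 0 \<and> \<gamma> 0 = \<phi> \<and> \<gamma> 1 = \<psi> \<and>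
      (\<forall>a\<in>carrier A. \<forall>i<m. \<forall>j<m. regular_off D (\<lambda>t. \<gamma> t a $$ (i, j))) \<and>
      (\<forall>t. poly D t \<noteq> 0 \<longrightarrow> \<gamma> t \<in> bent_family)"
  proof (intro exI[of _ D] exI[of _ \<gamma>] conjI ballI allI impI)
    show "poly D 0 \<noteq> 0" "poly D 1 \<noteq> 0" using ends \<phi>(2) \<psi>(2) by (simp_all add: D_def zp_def flip: distrib_right)
    have "P' 0 = P0'" "P' 1 = P1'"
      using inv_unique[OF P0(1) P'[of 0] P0(2)] inv_unique[OF P1(1) P'[of 1] P1(2)] inv(2)[of 0] inv(2)[of 1]
        ends P_ends P0 P1 by simp_all
    then show "\<gamma> 0 = \<phi>" "\<gamma> 1 = \<psi>" using P_ends \<phi>(1) \<psi>(1) by (simp_all add: \<gamma>_def zp_def sp_def)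
    show "\<gamma> t \<in> bent_family" if "poly D t \<noteq> 0" for t
    proof -
      have "poly dp t \<noteq> 0" "poly zp t \<noteq> 0" using that by (simp_all add: D_def)
      then show ?thesis unfolding bent_family_def \<gamma>_def using P P' inv by blast
    qed
    fix a i j assume a: "a \<in> carrier A" and ij: "i < m" "j < m"
    obtain x where x: "x \<in> carrier PA" "a = cls x" using a by (auto simp: carrier_A)
    let ?N = "\<lambda>t. op_mat m (alg_act U (R (poly zp t) (poly sp t)) x)"
    have eq: "\<gamma> t a $$ (i, j) = (\<Sum>k<m. (\<Sum>l<m. P t $$ (i, l) * ?N t $$ (l, k)) * P' t $$ (k, j))"
      if "poly D t \<noteq> 0" for t
    proof -
      have "poly zp t \<noteq> 0" using that by (simp add: D_def)
      then have \<gamma>_eq: "\<gamma> t a = P t * ?N t * P' t"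
        using ok x by (simp add: \<gamma>_def conj_point_cls point_cls)
      have entry: "(X * Y) $$ (i', j') = (\<Sum>k<m. X $$ (i', k) * Y $$ (k, j'))"
        if "X \<in> carrier_mat m m" "Y \<in> carrier_mat m m" "i' < m" "j' < m" for X Y :: "'k mat" and i' j'
        using that by (simp add: scalar_prod_def atLeast0LessThan)
      have PN: "P t * ?N t \<in> carrier_mat m m" by (rule mult_carrier_mat[OF P op_mat_carrier])
      show ?thesis
        unfolding \<gamma>_eq entry[OF PN P' ij]
        by (rule sum.cong[OF refl]) (simp only: lessThan_iff entry[OF P op_mat_carrier ij(1)])
    qed
    have N_reg: "regular_off D (\<lambda>t. ?N t $$ (l, k))" if "l < m" "k < m" for l k
      using that by (simp add: op_mat_def regular_off_alg_act regular_off_poly)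
    have P'_reg: "regular_off D (\<lambda>t. P' t $$ (k, j))" if "k < m" for k
    proof -
      have "regular_off D (\<lambda>t. det (mat_delete (P t) j k))"
      proof (rule regular_off_det[where n = "m - 1"])
        show "mat_delete (P t) j k \<in> carrier_mat (m - 1) (m - 1)" for t
          using P[of t] by (simp add: mat_delete_def)
        fix i' j' assume "i' < m - 1" "j' < m - 1"
        then show "regular_off D (\<lambda>t. mat_delete (P t) j k $$ (i', j'))"
          using P by (simp add: mat_delete_def carrier_matD[OF P] P_reg)
      qed
      then have "regular_off D (\<lambda>t. inverse (poly dp t) * ((- 1) ^ (j + k) * det (mat_delete (P t) j k)))"
        by (intro regular_off_mult regular_off_const regular_off_inverse_factor[OF D_def])
      moreover have "P' t $$ (k, j) = inverse (poly dp t) * ((- 1) ^ (j + k) * det (mat_delete (P t) j k))" for t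
        using ij that P[of t] adj_mat(1)[OF P[of t]] by (simp add: P'_def adj_mat_entry cofactor_def)
      ultimately show ?thesis by simp
    qed
    show "regular_off D (\<lambda>t. \<gamma> t a $$ (i, j))"
    proof (rule regular_off_cong[OF eq])
      show "regular_off D (\<lambda>t. \<Sum>k<m. (\<Sum>l<m. P t $$ (i, l) * ?N t $$ (l, k)) * P' t $$ (k, j))"
        using ij by (auto intro!: regular_off_sum regular_off_mult P_reg N_reg P'_reg)
    qed
  qed
qed

text \<open>
  If \<open>\<F>\<close> were dense in the bent family, a minor that detects the maximal rank over all \<open>s \<noteq> 0\<close> would be
  non-zero at some point with \<open>s = 0\<close>, and the jump would lead beyond the maximum.
\<close>

lemma closure_not_component:
  fixes c :: "int \<Rightarrow> 'a letter" and n :: int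
  assumes ok: "\<And>z s. z \<noteq> 0 \<Longrightarrow> bound_rep Q I U (R z s) m"
    and jump: "\<And>z r. z \<noteq> 0 \<Longrightarrow> word_rank_at_least c m n (mats z 0) r \<Longrightarrow>
      \<exists>s. s \<noteq> 0 \<and> word_rank_at_least c m n (mats z s) (Suc r)"
    and arcs_c: "\<And>j \<eta>. c j = Dir \<eta> \<or> c j = Inv \<eta> \<Longrightarrow> \<eta> \<in> arcs Q"
    and \<F>: "\<And>\<phi>. \<phi> \<in> \<F> \<Longrightarrow> \<exists>P P' z. \<phi> = conj_point P P' (point z 0) \<and> P \<in> carrier_mat m m \<and>
      P' \<in> carrier_mat m m \<and> P * P' = 1\<^sub>m m \<and> P' * P = 1\<^sub>m m \<and> z \<noteq> 0"
  shows "\<not> irreducible_component (zariski_topology A m) (zariski_topology A m closure_of \<F>)"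
proof
  let ?X = "zariski_topology A m"
  assume comp: "irreducible_component ?X (?X closure_of \<F>)"
  have irr: "irreducible_in ?X bent_family" by (rule bent_family_irreducible[OF ok])
  then have fam_var: "bent_family \<subseteq> module_variety A m"
    by (simp add: irreducible_in_def topspace_zariski_topology)
  have sub: "\<F> \<subseteq> bent_family" using \<F> unfolding bent_family_def by blast
  then have "?X closure_of bent_family = ?X closure_of \<F>"
    using comp irreducible_in_closure_of[OF irr] closure_of_mono[OF sub] unfolding irreducible_component_def by blast
  then have fam_closure: "bent_family \<subseteq> ?X closure_of \<F>"
    using closure_of_subset[of bent_family ?X] fam_var by (simp add: topspace_zariski_topology)

  define ranks where "ranks = {r. \<exists>z s. z \<noteq> 0 \<and> s \<noteq> 0 \<and> word_rank_at_least c m n (mats z s) r}"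
  have "0 \<in> ranks" using rank_at_least_0 by (auto simp: ranks_def intro!: exI[of _ 1])
  moreover have fin: "finite ranks"
    by (rule finite_subset[of _ "{..card ({0..n + 1} \<times> {..<m})}"]) (auto simp: ranks_def dest: word_rank_bound)
  ultimately have "Max ranks \<in> ranks" by (intro Max_in) auto
  then obtain z s where zs: "z \<noteq> 0" "s \<noteq> 0" "word_rank_at_least c m n (mats z s) (Max ranks)"
    by (auto simp: ranks_def)
  define \<phi> where "\<phi> = conj_point (1\<^sub>m m) (1\<^sub>m m) (point z s)"
  have "\<phi> \<in> bent_family" unfolding bent_family_def \<phi>_def using zs(1) by (intro CollectI exI conjI refl) auto

  define M where "M = (\<lambda>\<phi> \<eta>. mat m m (\<lambda>(i, j). \<phi> (cls (basis_elem (Walk [\<eta>] :: ('v, 'a) walk))) $$ (i, j)) :: 'k mat)"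
  have M: "M \<psi> \<eta> \<in> carrier_mat m m" for \<psi> \<eta> by (simp add: M_def)
  have M_conj: "M (conj_point P P' (point z s)) \<eta> = P * mats z s \<eta> * P'"
    if "P \<in> carrier_mat m m" "P' \<in> carrier_mat m m" "z \<noteq> 0" "\<eta> \<in> arcs Q" for P P' z s \<eta>
  proof -
    have "Walk [\<eta>] \<in> paths Q" using that by (simp add: paths_Walk_iff)
    then have eq: "conj_point P P' (point z s) (cls (basis_elem (Walk [\<eta>]))) = P * mats z s \<eta> * P'"
      using that by (simp add: conj_point_cls basis_in_carrier point_arrow ok)
    have "mat m m (\<lambda>(i, j). B $$ (i, j)) = B" if "B \<in> carrier_mat m m" for B :: "'k mat"
      using that by (intro eq_matI) auto
    moreover have "P * mats z s \<eta> * P' \<in> carrier_mat m m"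
      using that(1,2) mats_carrier[of z s \<eta>] by (intro mult_carrier_mat)
    ultimately show ?thesis unfolding M_def eq .
  qed
  have "word_rank_at_least c m n (M \<phi>) (Max ranks)"
  proof -
    have "M \<phi> \<eta> = mats z s \<eta>" if "\<eta> \<in> arcs Q" for \<eta>
      using M_conj[OF _ _ zs(1) that, of "1\<^sub>m m" "1\<^sub>m m" s] left_mult_one_mat[OF mats_carrier]
        right_mult_one_mat[OF mats_carrier] by (simp add: \<phi>_def)
    then show ?thesis using zs(3) word_rank_cong[of n c "M \<phi>" "mats z s" m] arcs_c by blast
  qed
  then obtain y x where x: "\<forall>j<Max ranks. \<forall>i. x j i \<in> carrier_vec m"
    and nz: "det (minor (word_pairing c m n (M \<phi>)) (Max ranks) y x) \<noteq> 0"
    by (auto simp: rank_at_least_def)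
  define F where "F = (\<lambda>\<psi>. det (minor (word_pairing c m n (M \<psi>)) (Max ranks) y x))"
  have "F \<in> polynomial_functions A m"
    unfolding F_def
  proof (rule polynomial_functions_det[OF minor_carrier])
    fix i j assume ij: "i < Max ranks" "j < Max ranks"
    have entry: "(\<lambda>\<psi>. word_defect c m n (M \<psi>) (x j) k $ l) \<in> polynomial_functions A m" if l: "l < m" for k l
    proof -
      have mv: "(\<lambda>\<psi>. (v - M \<psi> \<eta> *\<^sub>v u) $ l) \<in> polynomial_functions A m"
        if u: "u \<in> carrier_vec m" and \<eta>: "\<eta> \<in> arcs Q" for v u \<eta>
      proof -
        have "Walk [\<eta>] \<in> paths Q" using \<eta> by (simp add: paths_Walk_iff)
        then have a: "cls (basis_elem (Walk [\<eta>])) \<in> carrier A" using cls_in_A basis_in_carrier by blast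
        have "(\<lambda>\<psi>. (v - M \<psi> \<eta> *\<^sub>v u) $ l)
            = (\<lambda>\<psi>. v $ l - (\<Sum>i<m. \<psi> (cls (basis_elem (Walk [\<eta>]))) $$ (l, i) * u $ i))"
          using l u by (auto simp: M_def scalar_prod_def atLeast0LessThan fun_eq_iff)
        moreover have "\<dots> \<in> polynomial_functions A m"
          using a l by (intro polynomial_functions_diff polynomial_functions_sum polynomial_functions.mult
              polynomial_functions.const polynomial_functions.coord) auto
        ultimately show ?thesis by (simp only:)
      qed
      have tr: "trunc m n (x j) k' \<in> carrier_vec m" for k' using x ij by (intro trunc_carrier) auto
      show ?thesis
        using mv[OF tr] arcs_c[of k] by (cases "c k") (simp_all add: word_defect_def)
    qed
    show "(\<lambda>\<psi>. minor (word_pairing c m n (M \<psi>)) (Max ranks) y x $$ (i, j)) \<in> polynomial_functions A m"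
      using ij by (auto simp: minor_def word_pairing_def
          intro!: polynomial_functions_sum polynomial_functions.mult polynomial_functions.const entry)
  qed
  moreover have "F \<phi> \<noteq> 0" using nz by (simp add: F_def)
  ultimately obtain \<psi> where \<psi>: "\<psi> \<in> \<F>" "F \<psi> \<noteq> 0"
    using polynomial_function_zero_on_closure[of F A m \<F> \<phi>] sub fam_var \<open>\<phi> \<in> bent_family\<close> fam_closure by blast
  then obtain P P' z' where P: "\<psi> = conj_point P P' (point z' 0)" "P \<in> carrier_mat m m"
      "P' \<in> carrier_mat m m" "P * P' = 1\<^sub>m m" "z' \<noteq> 0"
    using \<F> by blast
  have "word_rank_at_least c m n (M \<psi>) (Max ranks)"
    using \<psi>(2) x by (auto simp: F_def rank_at_least_def)
  then have "word_rank_at_least c m n (\<lambda>\<eta>. P * mats z' 0 \<eta> * P') (Max ranks)"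
    using word_rank_cong[of n c "M \<psi>" "\<lambda>\<eta>. P * mats z' 0 \<eta> * P'" m] M_conj[OF P(2,3,5)] P(1) arcs_c by blast
  then have "word_rank_at_least c m n (mats z' 0) (Max ranks)"
    by (rule word_rank_conj[OF P(2-4), rotated]) simp
  then obtain s' where "s' \<noteq> 0" "word_rank_at_least c m n (mats z' s') (Suc (Max ranks))"
    using jump[OF P(5)] by blast
  then have "Suc (Max ranks) \<in> ranks" using P(5) by (auto simp: ranks_def)
  then show False using Max_ge[OF fin] by fastforce
qed

end

section \<open>Band modules as walks\<close>

text \<open>
  Stated for the whole sequence instead of one period, so that it is invariant under shifts and
  reversal of the index.
\<close>

definition spans_vec :: "nat \<Rightarrow> (int \<Rightarrow> 'k::field vec) \<Rightarrow> bool" where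
  "spans_vec m v \<longleftrightarrow> (\<forall>W. 0\<^sub>v m \<in> W \<longrightarrow> (\<forall>x\<in>W. \<forall>y\<in>W. x + y \<in> W) \<longrightarrow> (\<forall>a. \<forall>x\<in>W. a \<cdot>\<^sub>v x \<in> W) \<longrightarrow>
     range v \<subseteq> W \<longrightarrow> carrier_vec m \<subseteq> W)"

lemma pm_linear_eqI:
  assumes "pm_linear L" "pm_linear L'" "\<And>i. L (basis_elem i) = L' (basis_elem i)"
  shows "L x = L' x"
  using pm_linear_basis_expansion[OF assms(1) finite_keys order.refl, of x]
    pm_linear_basis_expansion[OF assms(2) finite_keys order.refl, of x] assms(3) by simp

locale band_rep = path_ideal Q I
  for Q :: "('v, 'a) pre_digraph" and I :: "(('v, 'a) walk \<Rightarrow>\<^sub>0 'k::field) set" +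
  fixes b :: "int \<Rightarrow> 'a letter" and m :: nat
  assumes qb: "quasi_band Q I b m"
    and fin: "fin_digraph Q"
    and gen: "\<exists>P \<subseteq> paths Q. I = genideal (path_algebra Q) (basis_elem ` P)"
begin

abbreviation V where "V \<equiv> vertex_act Q b :: 'v \<Rightarrow> (int \<Rightarrow>\<^sub>0 'k) \<Rightarrow> _"
abbreviation E where "E \<equiv> arrow_act b :: 'a \<Rightarrow> (int \<Rightarrow>\<^sub>0 'k) \<Rightarrow> _"

lemma linear_V: "pm_linear (V u)" and linear_E: "pm_linear (E \<eta>)"
  by (simp_all add: vertex_act_def arrow_act_def pm_linear_linear_extension)

lemma V_basis: "V u (basis_elem i) = (if u = letter_source Q (b i) then basis_elem i else 0)"
  by (simp add: vertex_act_def)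

lemma E_basis: "E \<eta> (basis_elem i) = (if b i = Dir \<eta> then basis_elem (i - 1)
    else if b (i + 1) = Inv \<eta> then basis_elem (i + 1) else 0)"
  by (simp add: arrow_act_def)

lemma linear_comp: "pm_linear L \<Longrightarrow> pm_linear L' \<Longrightarrow> pm_linear (\<lambda>v. L (L' v :: int \<Rightarrow>\<^sub>0 'k) :: int \<Rightarrow>\<^sub>0 'k)"
  by (rule pm_linearI) (simp_all add: pm_linear_add pm_linear_scale)

lemma linear_if: "pm_linear L \<Longrightarrow> pm_linear (\<lambda>v :: int \<Rightarrow>\<^sub>0 'k. if P then L v else 0 :: int \<Rightarrow>\<^sub>0 'k)"
  by (rule pm_linearI) (simp_all add: pm_linear_add pm_linear_scale)

lemma band_quiver_rep: "quiver_rep Q V E"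
proof (rule quiver_rep.intro)
  show "pm_linear (V u)" "pm_linear (E \<eta>)" for u \<eta> by (rule linear_V linear_E)+
  show "V u (V u' v) = (if u = u' then V u v else 0)" for u u' v
    by (rule pm_linear_eqI[OF linear_comp[OF linear_V linear_V] linear_if[OF linear_V]])
      (auto simp: V_basis pm_linear_0[OF linear_V])
  have step: "letter_source Q (b i) = letter_target Q (b (i + 1))" for i
    using quasi_band_step(1)[OF qb, of "i + 1"] by simp
  have source: "letter_source Q (b i) = tail Q \<eta>" if "b (i + 1) = Inv \<eta>" for i \<eta>
    using step[of i] that by simp
  show "E \<eta> (V u v) = (if u = tail Q \<eta> then E \<eta> v else 0)" for \<eta> u v
    by (rule pm_linear_eqI[OF linear_comp[OF linear_E linear_V] linear_if[OF linear_E]])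
      (auto simp: V_basis E_basis pm_linear_0[OF linear_E] source)
  show "V u (E \<eta> v) = (if u = head Q \<eta> then E \<eta> v else 0)" for u \<eta> v
    by (rule pm_linear_eqI[OF linear_comp[OF linear_V linear_E] linear_if[OF linear_E]])
      (auto simp: V_basis E_basis pm_linear_0[OF linear_V] step[of "_ - 1", simplified])
qed

sublocale rep: quiver_rep Q V E by (rule band_quiver_rep)

lemma path_algebra_act_eq: "path_algebra_act Q b = (alg_act V E :: (('v, 'a) walk \<Rightarrow>\<^sub>0 'k) \<Rightarrow> _)"
proof -
  have "path_act Q b p v = walk_act V E p v" for p :: "('v, 'a) walk" and v :: "int \<Rightarrow>\<^sub>0 'k"
    by (cases p) simp_all
  then show ?thesis by (simp add: fun_eq_iff path_algebra_act_def alg_act_def)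
qed

lemma act_I: "x \<in> I \<Longrightarrow> alg_act V E x v = 0"
proof -
  assume x: "x \<in> I"
  obtain P where P: "P \<subseteq> paths Q" "I = genideal PA (basis_elem ` P)" using gen by blast
  have "basis_elem ` P \<subseteq> carrier PA" using P basis_in_carrier by auto
  then have in_I: "basis_elem p \<in> I" if "p \<in> P" for p
    using genideal_self[of "basis_elem ` P"] P(2) that by auto
  have walk: "band_walk Q b V E 0 basis_elem"
    by (simp add: band_walk_def V_basis E_basis)
  have "walk_act V E p v = 0" if "p \<in> P" for p v
  proof -
    have "walk_act V E p (basis_elem i) = 0" for i
      by (rule band_walk_killed[OF qb walk pm_linear_0[OF linear_E]]) (use that P in_I in auto)
    then show ?thesis
      by (subst pm_linear_basis_expansion[OF rep.linear_walk_act finite_keys order.refl]) simp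
  qed
  then show ?thesis using rep.alg_act_genideal_eq_0[OF ring_axioms P(1)] x P(2) by simp
qed

lemma act_one: "alg_act V E \<one>\<^bsub>PA\<^esub> v = v"
proof -
  interpret fin: fin_digraph Q by (rule fin)
  have "alg_act V E \<one>\<^bsub>PA\<^esub> (basis_elem i) = basis_elem i" for i
  proof -
    have "letter_source Q (b i) \<in> verts Q"
      using quasi_band_letter[OF qb, of i] by (auto simp: fin.tail_in_verts fin.head_in_verts)
    then show ?thesis
      unfolding path_algebra_simps pm_linear_sum[OF rep.linear_alg_act_left]
      by (simp add: alg_act_def V_basis)
  qed
  note on_basis = this
  have "pm_linear (\<lambda>v. v :: int \<Rightarrow>\<^sub>0 'k)" by (rule pm_linearI) simp_all
  then show ?thesis using pm_linear_eqI[OF rep.linear_alg_act _ on_basis] by blast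
qed

lemma periodic_smult:
  assumes "x \<in> carrier PA"
  shows "cls x \<odot>\<^bsub>periodic_module Q b\<^esub> v = alg_act V E x v"
proof -
  have "alg_act V E y v = alg_act V E x v" if "y \<in> cls x" for y
    using that by (auto simp: mem_cls_iff rep.alg_act_add act_I)
  then have "(\<lambda>y. alg_act V E y v) ` cls x = {alg_act V E x v}"
    using self_mem_cls[of x] by blast
  then show ?thesis by (simp add: periodic_module_def path_algebra_act_eq)
qed

context
  fixes c :: 'k
begin

abbreviation N where "N \<equiv> band_submodule m c"
abbreviation coset where "coset v \<equiv> N +>\<^bsub>periodic_module Q b\<^esub> v"

lemma N_add: "x \<in> N \<Longrightarrow> y \<in> N \<Longrightarrow> x + y \<in> N"
  unfolding band_submodule_def by (rule pm.span_add)

lemma N_diff: "x \<in> N \<Longrightarrow> y \<in> N \<Longrightarrow> x - y \<in> N"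
  unfolding band_submodule_def by (rule pm.span_diff)

lemma N_scale: "x \<in> N \<Longrightarrow> pm_scale a x \<in> N"
  unfolding band_submodule_def by (rule pm.span_scale)

lemma N_0: "0 \<in> N"
  unfolding band_submodule_def by (rule pm.span_zero)

lemma N_gen: "basis_elem i - pm_scale c (basis_elem (i + int m)) \<in> N"
  unfolding band_submodule_def by (rule pm.span_base) blast

lemma N_invariant:
  assumes L: "pm_linear L" and gen: "\<And>i. L (basis_elem i) - pm_scale c (L (basis_elem (i + int m))) \<in> N"
    and "x \<in> N"
  shows "L x \<in> N"
proof -
  have "N \<subseteq> {x. L x \<in> N}"
    unfolding band_submodule_def
  proof (rule pm.span_minimal)
    show "range (\<lambda>i. basis_elem i - pm_scale c (basis_elem (i + int m)))
        \<subseteq> {x. L x \<in> pm.span (range (\<lambda>i. basis_elem i - pm_scale c (basis_elem (i + int m))))}"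
      using gen by (auto simp: pm_linear_diff[OF L] pm_linear_scale[OF L] band_submodule_def)
    show "pm.subspace {x. L x \<in> pm.span (range (\<lambda>i. basis_elem i - pm_scale c (basis_elem (i + int m))))}"
      by (auto simp: pm.subspace_def pm_linear_0[OF L] pm_linear_add[OF L] pm_linear_scale[OF L]
          intro: pm.span_zero pm.span_add pm.span_scale)
  qed
  then show ?thesis using assms(3) by blast
qed

lemma per: "b (i + int m) = b i"
  using quasi_band_period[OF qb, of i 1] by simp

lemma V_N: "x \<in> N \<Longrightarrow> V u x \<in> N"
  by (rule N_invariant[OF linear_V]) (auto simp: V_basis per N_gen N_0)

lemma E_N: "x \<in> N \<Longrightarrow> E \<eta> x \<in> N"
proof (rule N_invariant[OF linear_E])
  fix i
  have "b (i + int m + 1) = b (i + 1)" using per[of "i + 1"] by (simp add: algebra_simps)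
  then have E_next: "E \<eta> (basis_elem (i + int m)) = (if b i = Dir \<eta> then basis_elem (i + int m - 1)
      else if b (i + 1) = Inv \<eta> then basis_elem (i + int m + 1) else 0)"
    by (simp add: E_basis per)
  have "basis_elem (i - 1) - pm_scale c (basis_elem (i + int m - 1)) \<in> N"
    "basis_elem (i + 1) - pm_scale c (basis_elem (i + int m + 1)) \<in> N"
    using N_gen[of "i - 1"] N_gen[of "i + 1"] by (simp_all add: algebra_simps)
  then show "E \<eta> (basis_elem i) - pm_scale c (E \<eta> (basis_elem (i + int m))) \<in> N"
    unfolding E_next E_basis[of \<eta> i] using N_0 by auto
qed

lemma mem_coset_iff: "w \<in> coset v \<longleftrightarrow> w - v \<in> N"
  by (force simp: a_r_coset_def' periodic_module_def algebra_simps)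

lemma coset_eq_iff: "coset v = coset w \<longleftrightarrow> v - w \<in> N"
proof
  assume "coset v = coset w"
  then show "v - w \<in> N" using mem_coset_iff[of v v] mem_coset_iff[of v w] N_0 by simp
next
  assume vw: "v - w \<in> N"
  have "x - v \<in> N \<longleftrightarrow> x - w \<in> N" for x
    using N_add[OF _ vw, of "x - v"] N_diff[OF _ vw, of "x - w"] by (auto simp: algebra_simps)
  then show "coset v = coset w" by (auto simp: mem_coset_iff)
qed

lemma carrier_band_module: "carrier (band_module Q b m c) = range coset"
  by (auto simp: band_module_def quotient_module_def A_RCOSETS_def' periodic_module_def)

lemma add_band_module: "coset v \<oplus>\<^bsub>band_module Q b m c\<^esub> coset w = coset (v + w)"
proof -
  have "x \<in> set_add (periodic_module Q b) (coset v) (coset w) \<longleftrightarrow> x \<in> coset (v + w)" for x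
  proof
    assume "x \<in> set_add (periodic_module Q b) (coset v) (coset w)"
    then obtain h k where "h \<in> coset v" "k \<in> coset w" "x = h + k"
      by (auto simp: set_add_def' periodic_module_def)
    then show "x \<in> coset (v + w)"
      using N_add[of "h - v" "k - w"] by (simp add: mem_coset_iff algebra_simps)
  next
    assume "x \<in> coset (v + w)"
    then have "x - w \<in> coset v" by (simp add: mem_coset_iff algebra_simps)
    moreover have "w \<in> coset w" using N_0 by (simp add: mem_coset_iff)
    moreover have "x = (x - w) + w" by simp
    ultimately show "x \<in> set_add (periodic_module Q b) (coset v) (coset w)"
      unfolding set_add_def' by (force simp: periodic_module_def)
  qed
  then show ?thesis by (auto simp: band_module_def quotient_module_def)
qed

lemma smult_band_module:
  assumes x: "x \<in> carrier PA" and N: "\<And>w. w \<in> N \<Longrightarrow> alg_act V E x w \<in> N"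
  shows "cls x \<odot>\<^bsub>band_module Q b m c\<^esub> coset v = coset (alg_act V E x v)"
proof -
  have "coset (alg_act V E x w) = coset (alg_act V E x v)" if "w \<in> coset v" for w
    using N[of "w - v"] that
    by (simp add: mem_coset_iff coset_eq_iff pm_linear_diff[OF rep.linear_alg_act])
  moreover have "v \<in> coset v" using N_0 by (simp add: mem_coset_iff)
  ultimately have "(\<Union>w\<in>coset v. coset (alg_act V E x w)) = coset (alg_act V E x v)" by blast
  then show ?thesis by (simp add: band_module_def quotient_module_def periodic_smult[OF x])
qed

text \<open>The walk consists of the vectors that correspond to the cosets of the basis of \<open>M(b)\<close>.\<close>

lemma band_family_walk:
  assumes \<phi>: "\<phi> \<in> module_variety A m" and c: "c \<noteq> 0"
    and f: "f \<in> left_module_iso A (point_module m \<phi>) (band_module Q b m c)"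
  shows "\<exists>v. (\<forall>i. v i \<in> carrier_vec m) \<and>
    band_walk Q b (\<lambda>u w. \<phi> (cls (basis_elem (Triv u))) *\<^sub>v w) (\<lambda>\<eta> w. \<phi> (cls (basis_elem (Walk [\<eta>]))) *\<^sub>v w) (0\<^sub>v m) v \<and>
    (\<forall>i. v (i + int m) = inverse c \<cdot>\<^sub>v v i) \<and> spans_vec m v"
proof -
  note \<phi>' = \<phi>[unfolded module_variety_iff]
  have bij: "bij_betw f (carrier_vec m) (range coset)"
    and f_add: "\<And>x y. x \<in> carrier_vec m \<Longrightarrow> y \<in> carrier_vec m \<Longrightarrow> f (x + y) = f x \<oplus>\<^bsub>band_module Q b m c\<^esub> f y"
    and f_smult: "\<And>a x. a \<in> carrier A \<Longrightarrow> x \<in> carrier_vec m \<Longrightarrow> f (\<phi> a *\<^sub>v x) = a \<odot>\<^bsub>band_module Q b m c\<^esub> f x"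
    using f by (auto simp: left_module_iso_def point_module_def carrier_band_module)
  have inj: "x = y" if "f x = f y" "x \<in> carrier_vec m" "y \<in> carrier_vec m" for x y
    using bij that by (auto simp: bij_betw_def inj_on_def)
  define g where "g = (\<lambda>y. inv_into (carrier_vec m) f (coset y))"
  have g: "g y \<in> carrier_vec m" "f (g y) = coset y" for y
    using bij_betw_inv_into_right[OF bij, of "coset y"] bij_betw_apply[OF bij_betw_inv_into[OF bij], of "coset y"]
    by (auto simp: g_def)
  have g_f: "g y = x" if "f x = coset y" "x \<in> carrier_vec m" for x y
    using inj[of "g y" x] g that by simp
  have surj: "\<exists>y. x = g y" if x: "x \<in> carrier_vec m" for x
  proof -
    have "f x \<in> range coset" using bij x by (auto simp: bij_betw_def)
    then obtain y where "f x = coset y" by blast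
    then show ?thesis using g_f[of x y] x by auto
  qed
  have g_eq: "g y = g y'" if "y - y' \<in> N" for y y'
    using that coset_eq_iff[of y y'] by (simp add: g_def)
  have g_add: "g (y + y') = g y + g y'" for y y'
    by (rule g_f) (auto simp: f_add g add_band_module)
  have g_0: "g 0 = 0\<^sub>v m"
  proof -
    have "g 0 = g 0 + g 0" using g_add[of 0 0] by simp
    then have "g 0 - g 0 = g 0 + g 0 - g 0" by simp
    moreover have "g 0 + g 0 - g 0 = g 0" using g(1)[of 0] by auto
    moreover have "g 0 - g 0 = 0\<^sub>v m" using g(1)[of 0] by auto
    ultimately show ?thesis by simp
  qed
  have g_act: "g (alg_act V E x y) = \<phi> (cls x) *\<^sub>v g y"
    if x: "x \<in> carrier PA" and "\<And>w. w \<in> N \<Longrightarrow> alg_act V E x w \<in> N" for x y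
  proof (rule g_f)
    show "f (\<phi> (cls x) *\<^sub>v g y) = coset (alg_act V E x y)"
      using f_smult[OF cls_in_A[OF x] g(1)] smult_band_module[OF that] g(2) by simp
    have "\<phi> (cls x) \<in> carrier_mat m m" using \<phi>' x by blast
    then show "\<phi> (cls x) *\<^sub>v g y \<in> carrier_vec m" using g(1) by simp
  qed
  have g_scale: "g (pm_scale a y) = a \<cdot>\<^sub>v g y" for a y
  proof -
    have "g (alg_act V E (pm_scale a \<one>\<^bsub>PA\<^esub>) y) = \<phi> (cls (pm_scale a \<one>\<^bsub>PA\<^esub>)) *\<^sub>v g y"
      by (rule g_act) (auto simp: scale_in_carrier rep.alg_act_scale act_one N_scale)
    moreover have "\<phi> (cls (pm_scale a \<one>\<^bsub>PA\<^esub>)) = a \<cdot>\<^sub>m 1\<^sub>m m" using \<phi>' one_closed by metis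
    moreover have "(a \<cdot>\<^sub>m 1\<^sub>m m) *\<^sub>v g y = a \<cdot>\<^sub>v g y" using g(1)[of y] by auto
    ultimately show ?thesis by (simp add: rep.alg_act_scale act_one)
  qed
  define v where "v = (\<lambda>i. g (basis_elem i))"
  have "band_walk Q b (\<lambda>u w. \<phi> (cls (basis_elem (Triv u))) *\<^sub>v w) (\<lambda>\<eta> w. \<phi> (cls (basis_elem (Walk [\<eta>]))) *\<^sub>v w) (0\<^sub>v m) v"
    unfolding band_walk_def
  proof (intro conjI allI ballI)
    fix i u assume "u \<in> verts Q"
    then have "basis_elem (Triv u) \<in> carrier PA" by (intro basis_in_carrier) (simp add: paths_Triv_iff)
    then have "g (alg_act V E (basis_elem (Triv u)) (basis_elem i)) = \<phi> (cls (basis_elem (Triv u))) *\<^sub>v v i"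
      unfolding v_def by (rule g_act) (simp add: alg_act_def V_N)
    then show "\<phi> (cls (basis_elem (Triv u))) *\<^sub>v v i = (if u = letter_source Q (b i) then v i else 0\<^sub>v m)"
      by (auto simp: alg_act_def V_basis v_def g_0)
  next
    fix i \<eta> assume "\<eta> \<in> arcs Q"
    then have "basis_elem (Walk [\<eta>]) \<in> carrier PA" by (intro basis_in_carrier) (simp add: paths_Walk_iff)
    then have "g (alg_act V E (basis_elem (Walk [\<eta>])) (basis_elem i)) = \<phi> (cls (basis_elem (Walk [\<eta>]))) *\<^sub>v v i"
      unfolding v_def by (rule g_act) (simp add: alg_act_def E_N)
    then show "\<phi> (cls (basis_elem (Walk [\<eta>]))) *\<^sub>v v i
        = (if b i = Dir \<eta> then v (i - 1) else if b (i + 1) = Inv \<eta> then v (i + 1) else 0\<^sub>v m)"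
      by (auto simp: alg_act_def E_basis v_def g_0)
  qed
  moreover have "v (i + int m) = inverse c \<cdot>\<^sub>v v i" for i
  proof -
    have "v i = c \<cdot>\<^sub>v v (i + int m)"
      unfolding v_def g_scale[symmetric] by (rule g_eq[OF N_gen])
    then show ?thesis using c by (simp add: smult_smult_assoc)
  qed
  moreover have "spans_vec m v"
    unfolding spans_vec_def
  proof (intro allI impI subsetI)
    fix W :: "'k vec set" and x :: "'k vec" assume W: "0\<^sub>v m \<in> W" "\<forall>x\<in>W. \<forall>y\<in>W. x + y \<in> W" "\<forall>a. \<forall>x\<in>W. a \<cdot>\<^sub>v x \<in> W" "range v \<subseteq> W"
      and x: "x \<in> carrier_vec m"
    have sum: "g (\<Sum>i\<in>K. pm_scale (a i) (basis_elem i)) \<in> W" if "finite K" for K a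
      using that
    proof (induction K rule: finite_induct)
      case (insert i K)
      have "a i \<cdot>\<^sub>v g (basis_elem i) \<in> W" using W(3) rangeI[of v i] W(4) unfolding v_def by blast
      then show ?case using insert W(2) by (simp add: g_add g_scale)
    qed (simp add: g_0 W(1))
    obtain y where "x = g y" using surj[OF x] by blast
    moreover have "y = (\<Sum>i\<in>Poly_Mapping.keys y. pm_scale (Poly_Mapping.lookup y i) (basis_elem i))"
      using pm_eq_linear_extension[of y] by (simp add: linear_extension_def)
    ultimately show "x \<in> W" using sum[of "Poly_Mapping.keys y" "Poly_Mapping.lookup y"] by simp
  qed
  ultimately show ?thesis using g(1) by (intro exI[of _ v]) (simp add: v_def)
qed

end

end

context closed_bend
begin

text \<open>One period of the walk is a basis, in which the arrows have the matrices of \<open>N(z, 0)\<close>.\<close>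

lemma conj_point_of_walk:
  assumes \<phi>: "\<phi> \<in> module_variety A m" and z: "z \<noteq> 0"
    and v: "\<And>i. v i \<in> carrier_vec m" "\<And>i. v (i + int m) = z \<cdot>\<^sub>v v i" "spans_vec m v"
    and walk: "band_walk Q b (\<lambda>u w. \<phi> (cls (basis_elem (Triv u))) *\<^sub>v w)
      (\<lambda>\<eta> w. \<phi> (cls (basis_elem (Walk [\<eta>]))) *\<^sub>v w) (0\<^sub>v m) v"
  shows "\<exists>P P'. \<phi> = conj_point P P' (point z 0) \<and> P \<in> carrier_mat m m \<and> P' \<in> carrier_mat m m \<and>
    P * P' = 1\<^sub>m m \<and> P' * P = 1\<^sub>m m"
proof -
  note \<phi>' = \<phi>[unfolded module_variety_iff]
  define P where "P = mat m m (\<lambda>(i, j). v (int j) $ i)"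
  have P: "P \<in> carrier_mat m m" by (simp add: P_def)
  have P_unit: "P *\<^sub>v unit_vec m j = v (int j)" if "j < m" for j
    using that v(1)[of "int j"] P by (intro eq_vecI) (auto simp: P_def scalar_prod_right_unit)
  have "carrier_vec m \<subseteq> (*\<^sub>v) P ` carrier_vec m"
  proof (rule v(3)[unfolded spans_vec_def, rule_format])
    show "0\<^sub>v m \<in> (*\<^sub>v) P ` carrier_vec m" using P by (intro image_eqI[of _ _ "0\<^sub>v m"]) auto
    show "x + y \<in> (*\<^sub>v) P ` carrier_vec m" if xy: "x \<in> (*\<^sub>v) P ` carrier_vec m" "y \<in> (*\<^sub>v) P ` carrier_vec m" for x y
    proof -
      obtain x' y' where "x = P *\<^sub>v x'" "y = P *\<^sub>v y'" "x' \<in> carrier_vec m" "y' \<in> carrier_vec m" using xy by auto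
      then show ?thesis using P by (intro image_eqI[of _ _ "x' + y'"]) (auto simp: mult_add_distrib_mat_vec[of _ m m])
    qed
    show smult: "a \<cdot>\<^sub>v x \<in> (*\<^sub>v) P ` carrier_vec m" if x: "x \<in> (*\<^sub>v) P ` carrier_vec m" for a x
    proof -
      obtain x' where "x = P *\<^sub>v x'" "x' \<in> carrier_vec m" using x by auto
      then show ?thesis using P by (intro image_eqI[of _ _ "a \<cdot>\<^sub>v x'"]) (auto simp: mult_mat_vec[of _ m m])
    qed
    show "range v \<subseteq> (*\<^sub>v) P ` carrier_vec m"
    proof safe
      fix i
      define r where "r = i mod int m"
      have r: "0 \<le> r" "r < int m" using m_pos by (simp_all add: r_def)
      have "v r \<in> (*\<^sub>v) P ` carrier_vec m"
        using P_unit[of "nat r"] r by (intro image_eqI[of _ _ "unit_vec m (nat r)"]) (auto simp: nat_less_iff)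
      then have "v (r + k * int m) \<in> (*\<^sub>v) P ` carrier_vec m" for k
      proof (induction k rule: int_induct[where k = 0])
        case (step1 k)
        then show ?case using smult[of "v (r + k * int m)" z] v(2)[of "r + k * int m"] by (simp add: algebra_simps)
      next
        case (step2 k)
        have "v (r + k * int m) = z \<cdot>\<^sub>v v (r + (k - 1) * int m)"
          using v(2)[of "r + (k - 1) * int m"] by (simp add: algebra_simps)
        then have "v (r + (k - 1) * int m) = inverse z \<cdot>\<^sub>v v (r + k * int m)"
          using z by (simp add: smult_smult_assoc)
        then show ?case using smult step2 by simp
      qed simp
      from this[of "i div int m"] show "v i \<in> (*\<^sub>v) P ` carrier_vec m" by (simp add: r_def)
    qed
  qed
  then have "\<forall>j. \<exists>y. j < m \<longrightarrow> y \<in> carrier_vec m \<and> P *\<^sub>v y = unit_vec m j"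
    by (metis imageE subsetD unit_vec_carrier)
  then obtain y where y: "\<And>j. j < m \<Longrightarrow> y j \<in> carrier_vec m" "\<And>j. j < m \<Longrightarrow> P *\<^sub>v y j = unit_vec m j" by metis
  define P' where "P' = mat m m (\<lambda>(i, j). y j $ i)"
  have P': "P' \<in> carrier_mat m m" by (simp add: P'_def)
  have PP': "P * P' = 1\<^sub>m m"
  proof (rule eq_matI)
    fix i j assume "i < dim_row (1\<^sub>m m :: 'k mat)" "j < dim_col (1\<^sub>m m :: 'k mat)"
    then have ij: "i < m" "j < m" by simp_all
    have "col P' j = y j" using ij y(1)[of j] by (intro eq_vecI) (auto simp: P'_def)
    then have "(P * P') $$ (i, j) = (P *\<^sub>v y j) $ i" using ij P P' by simp
    then show "(P * P') $$ (i, j) = 1\<^sub>m m $$ (i, j)" using y(2)[of j] ij by simp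
  qed (use P P' in auto)
  have P'P: "P' * P = 1\<^sub>m m" by (rule mat_mult_left_right_inverse[OF P P' PP'])

  define Pv where "Pv = (\<lambda>x :: int \<Rightarrow>\<^sub>0 'k. P *\<^sub>v vec m (\<lambda>i. Poly_Mapping.lookup x (int i)))"
  have Pv_single: "Pv (Poly_Mapping.single i a) = a \<cdot>\<^sub>v v i" if "0 \<le> i" "i < int m" for i a
  proof -
    have "vec m (\<lambda>l. Poly_Mapping.lookup (Poly_Mapping.single i a) (int l)) = a \<cdot>\<^sub>v unit_vec m (nat i)"
      using that by (intro eq_vecI) (auto simp: lookup_single when_def unit_vec_def)
    then show ?thesis using P P_unit[of "nat i"] that by (simp add: Pv_def mult_mat_vec[of _ m m] nat_less_iff)
  qed
  have Pv_basis: "Pv (basis_elem i) = v i" if "0 \<le> i" "i < int m" for i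
    using Pv_single[OF that, of 1] v(1) by simp
  have Pv_0: "Pv 0 = 0\<^sub>v m"
  proof -
    have "vec m (\<lambda>i. Poly_Mapping.lookup (0 :: int \<Rightarrow>\<^sub>0 'k) (int i)) = 0\<^sub>v m" by (intro eq_vecI) auto
    then show ?thesis using P by (auto simp: Pv_def)
  qed
  have conj: "X = P * op_mat m L * P'"
    if X: "X \<in> carrier_mat m m" and act: "\<And>j. j < m \<Longrightarrow> X *\<^sub>v v (int j) = Pv (L (basis_elem (int j)))" for X L
  proof -
    have "X * P = P * op_mat m L"
    proof (rule eq_matI)
      fix i j assume "i < dim_row (P * op_mat m L)" "j < dim_col (P * op_mat m L)"
      then have ij: "i < m" "j < m" using P by (simp_all add: op_mat_def)
      have "col P j = v (int j)" using ij v(1)[of "int j"] by (intro eq_vecI) (auto simp: P_def)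
      then have "(X * P) $$ (i, j) = (X *\<^sub>v v (int j)) $ i" using ij X P by simp
      also have "\<dots> = Pv (L (basis_elem (int j))) $ i" using act ij by simp
      also have "\<dots> = (P * op_mat m L) $$ (i, j)"
      proof -
        have "col (op_mat m L) j = vec m (\<lambda>i. Poly_Mapping.lookup (L (basis_elem (int j))) (int i))"
          using ij by (intro eq_vecI) (auto simp: op_mat_def)
        then show ?thesis using ij P by (simp add: Pv_def op_mat_def)
      qed
      finally show "(X * P) $$ (i, j) = (P * op_mat m L) $$ (i, j)" .
    qed (use X P in \<open>auto simp: op_mat_def\<close>)
    then have "(X * P) * P' = P * op_mat m L * P'" by simp
    moreover have "(X * P) * P' = X * (P * P')" by (rule assoc_mult_mat[OF X P P'])
    ultimately show ?thesis using PP' X by simp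
  qed
  have ok: "bound_rep Q I U (R z 0) m" by (rule bound_rep_at_0[OF z])
  interpret N: bound_rep Q I U "R z 0" m by (rule ok)
  have "\<phi> = conj_point P P' (point z 0)"
  proof (rule module_variety_eqI[OF \<phi> conj_point_in_module_variety[OF point_in_module_variety[OF ok] P P' PP' P'P]])
    fix u assume u: "u \<in> verts Q"
    then have p: "basis_elem (Triv u) \<in> carrier PA" by (intro basis_in_carrier) (simp add: paths_Triv_iff)
    have "\<phi> (cls (basis_elem (Triv u))) = P * op_mat m (U u) * P'"
    proof (rule conj)
      show "\<phi> (cls (basis_elem (Triv u))) \<in> carrier_mat m m" using \<phi>' p by blast
      fix j assume "j < m"
      then show "\<phi> (cls (basis_elem (Triv u))) *\<^sub>v v (int j) = Pv (U u (basis_elem (int j)))"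
        using walk u unfolding band_walk_def by (simp add: U_single Pv_basis Pv_0)
    qed
    then show "\<phi> (cls (basis_elem (Triv u))) = conj_point P P' (point z 0) (cls (basis_elem (Triv u)))"
      using p by (simp add: conj_point_cls point_cls[OF ok] op_mat_def alg_act_def)
  next
    fix \<eta> assume \<eta>: "\<eta> \<in> arcs Q"
    then have p: "basis_elem (Walk [\<eta>]) \<in> carrier PA" by (intro basis_in_carrier) (simp add: paths_Walk_iff)
    have "\<phi> (cls (basis_elem (Walk [\<eta>]))) = P * op_mat m (R z 0 \<eta>) * P'"
    proof (rule conj)
      show "\<phi> (cls (basis_elem (Walk [\<eta>]))) \<in> carrier_mat m m" using \<phi>' p by blast
      fix j assume j: "j < m"
      have "Pv (T z 0 (int j + 1)) = v (int j + 1)" if "b (int j + 1) = Inv \<eta>"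
      proof (cases "int j + 1 = int m")
        case True
        then show ?thesis using that v(2)[of 0] m_pos Pv_single[of 0 z] by (simp add: T_def)
      next
        case False
        then show ?thesis using that j Pv_basis[of "int j + 1"] by (simp add: T_def)
      qed
      moreover have "Pv (basis_elem (int j - 1)) = v (int j - 1)" if "b (int j) = Dir \<eta>"
      proof -
        have "j \<noteq> 0" using that b_not_Dir(1) by (cases "j = 0") auto
        then show ?thesis using j Pv_basis[of "int j - 1"] by simp
      qed
      moreover have "\<phi> (cls (basis_elem (Walk [\<eta>]))) *\<^sub>v v (int j) = (if b (int j) = Dir \<eta> then v (int j - 1)
          else if b (int j + 1) = Inv \<eta> then v (int j + 1) else 0\<^sub>v m)"
        using walk \<eta> unfolding band_walk_def by blast
      ultimately show "\<phi> (cls (basis_elem (Walk [\<eta>]))) *\<^sub>v v (int j) = Pv (R z 0 \<eta> (basis_elem (int j)))"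
        using R_basis[of "int j" z 0 \<eta>] j by (auto simp: Pv_0)
    qed
    then show "\<phi> (cls (basis_elem (Walk [\<eta>]))) = conj_point P P' (point z 0) (cls (basis_elem (Walk [\<eta>])))"
      using p by (simp add: conj_point_cls point_cls[OF ok] op_mat_def alg_act_def)
  qed
  then show ?thesis using P P' PP' P'P by blast
qed

end

section \<open>Negligible bands\<close>

lemma length_band_word [simp]: "length (band_word b m) = m"
  by (simp add: band_word_def)

lemma band_word_nth: "i < m \<Longrightarrow> band_word b m ! i = b (int i + 1)"
  by (simp add: band_word_def nth_upto add.commute)

lemma band_word_letter:
  assumes "band_word b m = xs" "1 \<le> j" "j \<le> int (length xs)"
  shows "b j = xs ! nat (j - 1)"
  using band_word_nth[of "nat (j - 1)" m b] assms by (auto simp: nat_less_iff)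

lemma periodic_word_letter:
  assumes "1 \<le> j" "j \<le> int (length xs)"
  shows "xs ! nat ((j - 1) mod int (length xs)) = xs ! nat (j - 1)"
  using assms by simp

lemma letters_string_inv: "letters (string_inv w) = word_inv (letters w)"
  by (cases w) (simp_all add: word_inv_def)

lemma length_word_inv [simp]: "length (word_inv xs) = length xs"
  by (simp add: word_inv_def)

lemma word_inv_append: "word_inv (xs @ ys) = word_inv ys @ word_inv xs"
  by (simp add: word_inv_def)

lemma word_inv_word_inv [simp]: "word_inv (word_inv xs) = xs"
  by (simp add: word_inv_def rev_map[symmetric] comp_def)

lemma word_inv_nth: "i < length xs \<Longrightarrow> word_inv xs ! i = letter_inv (xs ! (length xs - 1 - i))"
  by (simp add: word_inv_def rev_nth)

text \<open>
  This passes from the given band \<open>b'\<close> to an equivalent one, which will be negligible: a walk along \<open>b'\<close> is, shifted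
  or reversed, a walk along \<open>b\<close>, and reversal inverts the parameter.
\<close>

lemma (in closed_bend) not_component_if_jump:
  fixes c :: "int \<Rightarrow> 'a letter" and n :: int
  assumes ok: "\<And>z s. z \<noteq> 0 \<Longrightarrow> s \<noteq> 0 \<Longrightarrow> bound_rep Q I U (R z s) m"
    and jump: "\<And>z r. z \<noteq> 0 \<Longrightarrow> word_rank_at_least c m n (mats z 0) r \<Longrightarrow>
      \<exists>s. s \<noteq> 0 \<and> word_rank_at_least c m n (mats z s) (Suc r)"
    and arcs_c: "\<And>j \<eta>. c j = Dir \<eta> \<or> c j = Inv \<eta> \<Longrightarrow> \<eta> \<in> arcs Q"
    and b': "quasi_band Q I b' m" "band_equiv (b', m) (b, m)"
  shows "\<not> irreducible_component (zariski_topology A m) (zariski_topology A m closure_of band_family Q I b' m)"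
proof (rule closure_not_component[OF _ jump arcs_c])
  show "bound_rep Q I U (R z s) m" if "z \<noteq> 0" for z s
    using bound_rep_at_0[OF that] ok[OF that] by (cases "s = 0") auto
  fix \<phi> assume "\<phi> \<in> band_family Q I b' m"
  then have \<phi>: "\<phi> \<in> module_variety A m"
    and "\<exists>z. z \<noteq> 0 \<and> left_module_iso A (point_module m \<phi>) (band_module Q b' m z) \<noteq> {}"
    by (simp_all add: band_family_def Let_def)
  then obtain z where z: "z \<noteq> 0 \<and> left_module_iso A (point_module m \<phi>) (band_module Q b' m z) \<noteq> {}"
    by (elim exE)
  then obtain f where f: "f \<in> left_module_iso A (point_module m \<phi>) (band_module Q b' m z)"
    by (meson ex_in_conv)
  have z: "z \<noteq> 0" using z by simp
  interpret b': band_rep Q I b' m by (intro band_rep.intro band_rep_axioms.intro path_ideal_axioms b'(1) fin gen)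
  from b'.band_family_walk[OF \<phi> z f]
  obtain v where *: "(\<forall>i. v i \<in> carrier_vec m) \<and>
      band_walk Q b' (\<lambda>u w. \<phi> (cls (basis_elem (Triv u))) *\<^sub>v w)
        (\<lambda>\<eta> w. \<phi> (cls (basis_elem (Walk [\<eta>]))) *\<^sub>v w) (0\<^sub>v m) v \<and>
      (\<forall>i. v (i + int m) = inverse z \<cdot>\<^sub>v v i) \<and> spans_vec m v"
    by (elim exE)
  have v: "v i \<in> carrier_vec m" "v (i + int m) = inverse z \<cdot>\<^sub>v v i" "spans_vec m v" for i
    using * by simp_all
  have walk: "band_walk Q b' (\<lambda>u w. \<phi> (cls (basis_elem (Triv u))) *\<^sub>v w)
      (\<lambda>\<eta> w. \<phi> (cls (basis_elem (Walk [\<eta>]))) *\<^sub>v w) (0\<^sub>v m) v"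
    using * by simp
  have spans: "spans_vec m (\<lambda>i. v (h i))" if "surj h" for h
  proof -
    have "range (\<lambda>i. v (h i)) = v ` range h" by (simp add: image_image)
    then show ?thesis using v(3) that by (simp add: spans_vec_def)
  qed
  obtain k where "(\<forall>j. b' j = b (k + j)) \<or> (\<forall>j. b' j = letter_inv (b (k - j)))"
    using b'(2) by (auto simp: band_equiv_def)
  then have "\<exists>z'. z' \<noteq> 0 \<and> (\<exists>P P'. \<phi> = conj_point P P' (point z' 0) \<and> P \<in> carrier_mat m m \<and>
      P' \<in> carrier_mat m m \<and> P * P' = 1\<^sub>m m \<and> P' * P = 1\<^sub>m m)"
  proof
    assume eq: "\<forall>j. b' j = b (k + j)"
    have period: "v (i + int m - k) = inverse z \<cdot>\<^sub>v v (i - k)" for i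
      using v(2)[of "i - k"] by (simp add: algebra_simps)
    have surj: "surj (\<lambda>i. i - k)" by (rule surjI[of _ "\<lambda>i. i + k"]) simp
    have "\<exists>P P'. \<phi> = conj_point P P' (point (inverse z) 0) \<and> P \<in> carrier_mat m m \<and>
        P' \<in> carrier_mat m m \<and> P * P' = 1\<^sub>m m \<and> P' * P = 1\<^sub>m m"
      by (rule conj_point_of_walk[OF \<phi> _ v(1) period spans[OF surj] band_walk_shift[OF walk]])
        (use eq z in auto)
    then show ?thesis using z by (intro exI[of _ "inverse z"]) simp
  next
    assume eq: "\<forall>j. b' j = letter_inv (b (k - j))"
    have period: "v (k - (i + int m) - 1) = z \<cdot>\<^sub>v v (k - i - 1)" for i
    proof -
      have "v (k - i - 1) = inverse z \<cdot>\<^sub>v v (k - (i + int m) - 1)"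
        using v(2)[of "k - (i + int m) - 1"] by (simp add: algebra_simps)
      then show ?thesis using z by (simp add: smult_smult_assoc)
    qed
    have surj: "surj (\<lambda>i. k - i - 1)" by (rule surjI[of _ "\<lambda>i. k - i - 1"]) simp
    have "\<exists>P P'. \<phi> = conj_point P P' (point z 0) \<and> P \<in> carrier_mat m m \<and>
        P' \<in> carrier_mat m m \<and> P * P' = 1\<^sub>m m \<and> P' * P = 1\<^sub>m m"
      by (rule conj_point_of_walk[OF \<phi> z v(1) period spans[OF surj] band_walk_reverse[OF b'(1) walk]])
        (use eq in auto)
    then show ?thesis using z by (intro exI[of _ z]) simp
  qed
  then obtain z' P P' where "z' \<noteq> 0 \<and> \<phi> = conj_point P P' (point z' 0) \<and> P \<in> carrier_mat m m \<and>
      P' \<in> carrier_mat m m \<and> P * P' = 1\<^sub>m m \<and> P' * P = 1\<^sub>m m"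
    by (elim exE conjE) simp
  then show "\<exists>P P' z. \<phi> = conj_point P P' (point z 0) \<and> P \<in> carrier_mat m m \<and>
      P' \<in> carrier_mat m m \<and> P * P' = 1\<^sub>m m \<and> P' * P = 1\<^sub>m m \<and> z \<noteq> 0"
    by (intro exI[of _ P] exI[of _ P'] exI[of _ z']) simp
qed

lemma string_algebra_locale:
  assumes "string_algebra Q I"
  shows "path_ideal Q I" "fin_digraph Q" "\<exists>P \<subseteq> paths Q. I = genideal (path_algebra Q) (basis_elem ` P)"
  using assms by (auto simp: string_algebra_def admissible_ideal_def path_ideal_def)

text \<open>
  With \<open>p\<close> the length of \<open>u\<gamma>\<close>, the submodule copy of \<open>w\<close> starts at position \<open>0\<close>, after the letter \<open>\<alpha>\<^sup>-\<^sup>1\<close>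
  of the preceding period, and the factor copy at position \<open>p\<close>, after \<open>\<gamma>\<close>.
\<close>

lemma negligible1_not_component:
  fixes I :: "(('v, 'a) walk \<Rightarrow>\<^sub>0 'k::alg_closed_field) set"
  assumes sa: "string_algebra Q I" and qb: "quasi_band Q I b m" and neg: "negligible_band1 Q I b m"
    and b': "quasi_band Q I b' m" "band_equiv (b', m) (b, m)"
  defines "A \<equiv> quotient_algebra (path_algebra Q) I"
  shows "\<not> irreducible_component (zariski_topology A m) (zariski_topology A m closure_of band_family Q I b' m)"
proof -
  obtain u v w x y \<alpha> \<beta> \<gamma> \<delta> s where
    u: "is_concat Q [u, arr \<gamma>, v, inv_arr \<alpha>] (band_word b m)"
    and w: "is_concat Q [w, arr \<beta>, x, inv_arr \<alpha>] (band_word b (s * m))"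
    and y: "is_concat Q [u, arr \<gamma>, w, inv_arr \<delta>, y] (band_word b (s * m))"
    and q1: "concat_quasi_band Q I [u, arr \<gamma>]" and q2: "concat_quasi_band Q I [v, inv_arr \<alpha>]"
    using neg unfolding negligible_band1_def by blast
  define lu lv lw where "lu = letters u" and "lv = letters v" and "lw = letters w"
  define p n where "p = int (length lu) + 1" and "n = int (length lw)"
  have word: "band_word b m = lu @ Dir \<gamma> # lv @ [Inv \<alpha>]"
    and word_w: "band_word b (s * m) = lw @ Dir \<beta> # letters x @ [Inv \<alpha>]"
    and word_y: "band_word b (s * m) = lu @ Dir \<gamma> # lw @ Inv \<delta> # letters y"
    and q1: "quasi_band_word Q I (lu @ [Dir \<gamma>])" and q2: "quasi_band_word Q I (lv @ [Inv \<alpha>])"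
    using u w y q1 q2 by (simp_all add: is_concat_def concat_quasi_band_def lu_def lv_def lw_def)
  define c1 where "c1 = (\<lambda>i. (lu @ [Dir \<gamma>]) ! nat ((i - 1) mod int (length (lu @ [Dir \<gamma>]))))"
  define c2 where "c2 = (\<lambda>i. (lv @ [Inv \<alpha>]) ! nat ((i - 1) mod int (length (lv @ [Inv \<alpha>]))))"
  have m: "int m = p + int (length lv) + 1" using arg_cong[OF word, of length] by (simp add: p_def)
  have qc1: "quasi_band Q I c1 (nat p)" using q1 by (simp add: quasi_band_word_def c1_def p_def nat_add_distrib)
  have qc2: "quasi_band Q I c2 (nat (int m - p))"
    using q2 m by (simp add: quasi_band_word_def c2_def nat_add_distrib)
  have p: "1 \<le> p" "p < int m" using m by (simp_all add: p_def)
  have n: "0 \<le> n" by (simp add: n_def)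
  have c1: "c1 j = b j" if "1 \<le> j" "j \<le> p" for j
    using that band_word_letter[OF word, of j] m unfolding c1_def
    by (auto simp: periodic_word_letter p_def nth_append nat_less_iff)
  have c2: "c2 j = b (p + j)" if "1 \<le> j" "j \<le> int m - p" for j
  proof -
    have "nat (p + j - 1) = length lu + Suc (nat (j - 1))" using that by (simp add: p_def)
    then have "b (p + j) = (lv @ [Inv \<alpha>]) ! nat (j - 1)"
      using that band_word_letter[OF word, of "p + j"] m p by (simp add: nth_append)
    then show ?thesis using that m unfolding c2_def by (subst periodic_word_letter) simp_all
  qed
  have b_p: "b p = Dir \<gamma>" using band_word_letter[OF word, of p] m by (simp add: p_def nth_append)
  have b_m: "b (int m) = Inv \<alpha>" using band_word_letter[OF word, of "int m"] m p
    by (simp add: nth_append p_def nat_add_distrib)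
  have b_w: "b j = lw ! nat (j - 1)" if "1 \<le> j" "j \<le> n" for j
    using that band_word_letter[OF word_w, of j] by (simp add: nth_append n_def nat_less_iff)
  have b_n: "b (n + 1) = Dir \<beta>"
    using band_word_letter[OF word_w, of "n + 1"] by (simp add: nth_append n_def)
  have b_pw: "b (p + j) = lw ! nat (j - 1)" if "1 \<le> j" "j \<le> n" for j
  proof -
    have "nat (p + j - 1) = length lu + Suc (nat (j - 1))" using that by (simp add: p_def)
    moreover have "nat (j - 1) < length lw" using that by (simp add: n_def nat_less_iff)
    ultimately show ?thesis
      using that band_word_letter[OF word_y, of "p + j"] p by (simp add: nth_append n_def p_def)
  qed
  have b_pn: "b (p + n + 1) = Inv \<delta>"
  proof -
    have "nat (p + n + 1 - 1) = length lu + Suc (length lw)" by (simp add: p_def n_def)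
    then show ?thesis
      using band_word_letter[OF word_y, of "p + n + 1"] p n by (simp add: nth_append n_def p_def)
  qed
  have c1_0: "c1 0 = Dir \<gamma>"
    using quasi_band_period[OF qc1, of 0 1] c1[of p] b_p p by simp
  have source_p: "letter_source Q (b p) = letter_source Q (b 0)"
    using quasi_band_step(1)[OF qc1, of 1] quasi_band_step(1)[OF qb, of 1] c1_0 c1[of 1] b_p p by simp
  have b_1: "b 1 \<noteq> Inv \<gamma>"
    using quasi_band_not_inverse(1)[OF qc1, of 0 \<gamma>] c1_0 c1[of 1] p by simp
  interpret closed_bend Q I b m p p
    using string_algebra_locale[OF sa] qb p b_p b_m source_p
    by (intro closed_bend.intro bend.intro bend_axioms.intro) auto
  show ?thesis
    unfolding A_def
  proof (rule not_component_if_jump[OF _ _ _ b'])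
    show "bound_rep Q I U (R z s) m" if "z \<noteq> 0" "s \<noteq> 0" for z s
      by (rule bound_rep_two_bands[OF that refl b_p qc1 c1 qc2 c2 n]) (use b_w b_pw b_n b_pn in auto)
    show "\<exists>s. s \<noteq> 0 \<and> word_rank_at_least (\<lambda>j. b (p + j)) m n (mats z s) (Suc r)"
      if "z \<noteq> 0" "word_rank_at_least (\<lambda>j. b (p + j)) m n (mats z 0) r" for z r
      by (rule word_rank_jump_two_bands[OF that(1) refl b_p b_1 n _ _ b_pn that(2)]) (use b_w b_pw b_n in auto)
    show "\<eta> \<in> arcs Q" if "b (p + j) = Dir \<eta> \<or> b (p + j) = Inv \<eta>" for j \<eta>
      using that quasi_band_letter[OF qb, of "p + j"] by auto
  qed
qed

text \<open>
  Here the factor copy of \<open>w\<close> is the inverse of the subword \<open>w\<^sup>-\<^sup>1\<close>; its left end is the position \<open>f\<close> at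
  which \<open>w\<^sup>-\<^sup>1\<close> ends and \<open>v\<close> begins.
\<close>

lemma negligible2_not_component:
  fixes I :: "(('v, 'a) walk \<Rightarrow>\<^sub>0 'k::alg_closed_field) set"
  assumes sa: "string_algebra Q I" and qb: "quasi_band Q I b m" and neg: "negligible_band2 Q I b m"
    and b': "quasi_band Q I b' m" "band_equiv (b', m) (b, m)"
  defines "A \<equiv> quotient_algebra (path_algebra Q) I"
  shows "\<not> irreducible_component (zariski_topology A m) (zariski_topology A m closure_of band_family Q I b' m)"
proof -
  obtain u v w where u: "starts_and_ends_with_arrow u" and v: "starts_and_ends_with_inverse_arrow v"
    and word: "is_concat Q [w, u, string_inv w, v] (band_word b m)"
    and q: "concat_quasi_band Q I [w, string_inv u, string_inv w, v]"
    using neg unfolding negligible_band2_def by blast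
  define lu lv lw where "lu = letters u" and "lv = letters v" and "lw = letters w"
  define B where "B = lw @ lu @ word_inv lw"
  define n where "n = int (length lw)"
  define f where "f = int (length B)"
  have word: "band_word b m = B @ lv" and q: "quasi_band_word Q I (word_inv B @ lv)"
    using word q by (simp_all add: is_concat_def concat_quasi_band_def lu_def lv_def lw_def B_def
        letters_string_inv word_inv_append)
  have lu: "lu \<noteq> []" "hd lu \<in> range Dir" "last lu \<in> range Dir"
    and lv: "lv \<noteq> []" "hd lv \<in> range Inv" "last lv \<in> range Inv"
    using u v by (simp_all add: starts_and_ends_with_arrow_def starts_and_ends_with_inverse_arrow_def lu_def lv_def)
  define c where "c = (\<lambda>i. (word_inv B @ lv) ! nat ((i - 1) mod int (length (word_inv B @ lv))))"
  have m: "int m = f + int (length lv)" "m = length (B @ lv)"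
    using arg_cong[OF word, of length] by (simp_all add: f_def)
  have qc: "quasi_band Q I c m" using q m(2) by (simp add: quasi_band_word_def c_def)
  have f: "0 < f" "f < int m" "0 \<le> n" "2 * n < f"
  proof -
    have "0 < int (length lu)" "0 < int (length lv)" using lu(1) lv(1) by simp_all
    moreover have "f = 2 * n + int (length lu)" "0 \<le> n" by (simp_all add: f_def B_def n_def)
    ultimately show "0 < f" "f < int m" "0 \<le> n" "2 * n < f" using m(1) by linarith+
  qed
  have b_low: "b j = B ! nat (j - 1)" if "1 \<le> j" "j \<le> f" for j
    using that band_word_letter[OF word, of j] by (simp add: nth_append f_def nat_less_iff)
  have b_high: "b j = lv ! nat (j - 1 - f)" if "f < j" "j \<le> int m" for j
  proof -
    have "nat (j - 1) = length B + nat (j - 1 - f)" using that by (simp add: f_def)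
    then show ?thesis using that band_word_letter[OF word, of j] f m by (simp add: nth_append)
  qed
  have c_eq: "c j = (word_inv B @ lv) ! nat (j - 1)" if "1 \<le> j" "j \<le> int m" for j
    using that m unfolding c_def by (subst periodic_word_letter) simp_all
  have c_low: "c j = letter_inv (b (f + 1 - j))" if "1 \<le> j" "j \<le> f" for j
  proof -
    have lt: "nat (j - 1) < length B" using that by (simp add: f_def nat_less_iff)
    have "c j = word_inv B ! nat (j - 1)" using c_eq[of j] that f lt by (simp add: nth_append)
    also have "\<dots> = letter_inv (B ! (length B - 1 - nat (j - 1)))" by (rule word_inv_nth[OF lt])
    also have "length B - 1 - nat (j - 1) = nat (f + 1 - j - 1)" using that lt by (simp add: f_def)
    finally show ?thesis using b_low[of "f + 1 - j"] that by simp
  qed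
  have c_high: "c j = b j" if "f < j" "j \<le> int m" for j
  proof -
    have "nat (j - 1) = length B + nat (j - 1 - f)" using that by (simp add: f_def)
    then show ?thesis using that c_eq[of j] b_high[of j] f by (simp add: nth_append)
  qed
  have c_w: "c j = b j" if "1 \<le> j" "j \<le> n" for j
  proof -
    have lt: "nat (j - 1) < length lw" using that by (simp add: n_def nat_less_iff)
    have "word_inv B = lw @ word_inv lu @ word_inv lw" by (simp add: B_def word_inv_append)
    then have "c j = lw ! nat (j - 1)" using c_eq[of j] that f lt by (simp add: nth_append)
    moreover have "b j = lw ! nat (j - 1)" using b_low[of j] that f lt by (simp add: B_def nth_append)
    ultimately show ?thesis by simp
  qed
  have b_n: "b (n + 1) \<in> range Dir"
    using b_low[of "n + 1"] f lu by (simp add: B_def n_def nth_append hd_conv_nth)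
  have c_n: "c (n + 1) \<in> range Inv"
  proof -
    have "nat (f + 1 - (n + 1) - 1) = length lw + (length lu - 1)"
      using lu(1) by (cases lu) (simp_all add: f_def n_def B_def)
    then have "b (f + 1 - (n + 1)) = last lu"
      using b_low[of "f + 1 - (n + 1)"] f lu(1) by (cases lu rule: rev_cases) (simp_all add: B_def nth_append)
    then show ?thesis using c_low[of "n + 1"] lu(3) f by auto
  qed
  obtain \<gamma> where \<gamma>: "b (f + 1) = Inv \<gamma>"
    using b_high[of "f + 1"] f lv by (auto simp: hd_conv_nth)
  have b_m: "b (int m) \<in> range Inv"
    using b_high[of "int m"] f lv m(1) by (simp add: last_conv_nth nat_diff_distrib)
  obtain \<delta> where \<delta>: "c (n + 1) = Inv \<delta>" using c_n by auto
  have c_f: "c f = letter_inv (b 1)" "c (f + 1) = b (f + 1)" using c_low[of f] c_high[of "f + 1"] f by simp_all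
  have source_f: "letter_source Q (b f) = letter_source Q (b 0)"
    using quasi_band_step(1)[OF qc, of "f + 1"] quasi_band_step(1)[OF qb, of "f + 1"]
      quasi_band_step(1)[OF qb, of 1] c_f by simp
  have b_1: "b 1 \<noteq> Inv \<gamma>"
    using quasi_band_not_inverse(1)[OF qc, of f \<gamma>] c_f \<gamma> by auto
  interpret closed_bend Q I b m f "f + 1"
    using string_algebra_locale[OF sa] qb f \<gamma> b_m source_f
    by (intro closed_bend.intro bend.intro bend_axioms.intro) auto
  let ?c = "\<lambda>j. letter_inv (b (f + 1 - j))"
  have c'_w: "?c j = b j" if "1 \<le> j" "j \<le> n" for j using that c_low[of j] c_w[of j] f by simp
  have c'_n: "?c (n + 1) = Inv \<delta>" using c_low[of "n + 1"] \<delta> f by simp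
  show ?thesis
    unfolding A_def
  proof (rule not_component_if_jump[OF _ _ _ b'])
    show "bound_rep Q I U (R z s) m" if "z \<noteq> 0" "s \<noteq> 0" for z s
      by (rule bound_rep_one_band[OF that refl \<gamma> qc c_low c_high f(3,4) c_w b_n c_n])
    show "\<exists>s. s \<noteq> 0 \<and> word_rank_at_least ?c m n (mats z s) (Suc r)"
      if "z \<noteq> 0" "word_rank_at_least ?c m n (mats z 0) r" for z r
      by (rule word_rank_jump_one_band[OF that(1) refl \<gamma> b_1 f(3) _ c'_w b_n c'_n that(2)]) (use f in auto)
    show "\<eta> \<in> arcs Q" if "?c j = Dir \<eta> \<or> ?c j = Inv \<eta>" for j \<eta>
      using that quasi_band_letter[OF qb, of "f + 1 - j"] by auto
  qed
qed

theorem proposition1p3: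
  fixes Q :: "('v, 'a) pre_digraph"
    and I :: "(('v, 'a) walk \<Rightarrow>\<^sub>0 'k::alg_closed_field) set"
    and b :: "int \<Rightarrow> 'a letter" and m d :: nat
  defines "A \<equiv> quotient_algebra (path_algebra Q) I"
  assumes "string_algebra Q I"
    and "band Q I b m"
    and "band_family Q I b m \<subseteq> module_variety A d"
    and "irreducible_component (zariski_topology A d)
           (zariski_topology A d closure_of band_family Q I b m)"
  shows "\<not> negligible_class Q I (band_class Q I (b, m))"
proof
  interpret path_ideal Q I by (rule string_algebra_locale(1)[OF assms(2)])
  have qb: "quasi_band Q I b m" using assms(3) by (simp add: band_def)
  have "zariski_topology A d closure_of band_family Q I b m \<noteq> {}"
    using assms(5) by (simp add: irreducible_component_def irreducible_in_def)
  then have "band_family Q I b m \<noteq> {}" by auto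
  then obtain \<phi> where \<phi>: "\<phi> \<in> band_family Q I b m" by blast
  then have "\<phi> \<in> module_variety A m" unfolding band_family_def Let_def A_def by blast
  moreover have "\<phi> \<in> module_variety A d" using \<phi> assms(4) by blast
  ultimately have "\<phi> (cls \<one>\<^bsub>PA\<^esub>) = 1\<^sub>m m" "\<phi> (cls \<one>\<^bsub>PA\<^esub>) = 1\<^sub>m d"
    unfolding A_def module_variety_iff by blast+
  then have d: "d = m" by (metis index_one_mat(2))
  assume "negligible_class Q I (band_class Q I (b, m))"
  then obtain b' m' where b': "quasi_band Q I b' m'" "band_equiv (b, m) (b', m')" "negligible_band Q I b' m'"
    by (auto simp: negligible_class_def band_class_def)
  have m': "m' = m" using b'(2) by (simp add: band_equiv_def)
  have "negligible_band1 Q I b' m \<or> negligible_band2 Q I b' m"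
    using b'(3) m' by (simp add: negligible_band_def)
  then show False
    using negligible1_not_component[OF assms(2) b'(1)[unfolded m'] _ qb b'(2)[unfolded m']]
      negligible2_not_component[OF assms(2) b'(1)[unfolded m'] _ qb b'(2)[unfolded m']]
      assms(5) unfolding A_def d by blast
qed

end
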